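(* Each instance of $\mathcal{TI}(\varepsilon_0,\Pi^-_1)$ can be proved in $\mathbf{PA}+\mathcal K\Sigma^-_1$.
   Context: $\mathbf{PA}$ is first order Peano arithmetic. A formula of first order arithmetic is $\Delta^0_0=\Sigma^0_0=\Pi^0_0$ if all its quantifiers are bounded; a $\Sigma^0_{n+1}$-formula (resp. $\Pi^0_{n+1}$-formula) has the form $\exists_x\varphi$ with $\varphi$ a $\Pi^0_n$-formula (resp. $\forall_x\varphi$ with $\varphi$ a $\Sigma^0_n$-formula). Binary trees. $\mathcal B$ is the set of finite binary trees, inductively generated by: $\circ\in\mathcal B$; if $s,t\in\mathcal B$ then $\circ(s,t)\in\mathcal B$. The relation $\leq_{\mathcal B}$ on $\mathcal B$ is defined recursively by: $\circ\leq_{\mathcal B}t$ for every $t$; $s\leq_{\mathcal B}\circ$ only for $s=\circ$; and $\circ(s_0,s_1)\leq_{\mathcal B}\circ(t_0,t_1)$ iff ($s_0\leq_{\mathcal B}t_0$ and $s_1\leq_{\mathcal B}t_1$) or $\circ(s_0,s_1)\leq_{\mathcal B}t_i$ for some $i\in\{0,1\}$. In $\mathbf{PA}$ trees are represented by numerical codes, so that $s\in\mathcal B$ and $s\leq_{\mathcal B}t$ are $\Delta^0_1$-definable in $\mathbf{PA}$. Finite basis scheme. For a formula $\varphi(s)$ with a distinguished free variable, $\mathcal K\varphi$ is the formula $\exists_a\big(\text{``}a\text{ codes a finite subset of }\mathcal B\text{''}\land\forall_{s\in a}\varphi(s)\land\forall_{t\in\mathcal B}(\varphi(t)\rightarrow\exists_{s\in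 a}\,s\leq_{\mathcal B}t)\big)$. The scheme $\mathcal K\Sigma^-_1$ consists of all $\mathcal K\varphi$ where $\varphi$ is a $\Sigma^0_1$-formula with exactly one free variable (no parameters). Transfinite induction. Ordinals below $\varepsilon_0=\min\{\gamma\mid\omega^\gamma=\gamma\}$ are represented in $\mathbf{PA}$ by the usual finite terms in Cantor normal form $\omega^{\alpha_0}+\dots+\omega^{\alpha_{n-1}}$ with $\alpha_0\succeq\dots\succeq\alpha_{n-1}$ (the case $n=0$ being $0$; the exponents are recursively terms of the same kind), with the usual decidable order $\prec$. For a formula $\psi$ with a distinguished free variable, $\mathcal{TI}(\varepsilon_0,\psi)$ is the formula $\forall_{\gamma\prec\varepsilon_0}(\forall_{\beta\prec\gamma}\psi(\beta)\rightarrow\psi(\gamma))\rightarrow\forall_{\alpha\prec\varepsilon_0}\psi(\alpha)$. The scheme $\mathcal{TI}(\varepsilon_0,\Pi^-_1)$ consists of all $\mathcal{TI}(\varepsilon_0,\psi)$ where $\psi$ is a $\Pi^0_1$-formula with exactly one free variable. *)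

theory Defs
  imports Main "HOL-Library.Nat_Bijection"
begin

section \<open>First-order arithmetic\<close>

text \<open>
  Terms and formulas over the language \<open>0, S, +, \<cdot>, <, =\<close>, with de Bruijn indices:
  \<open>All\<close> and \<open>Ex\<close> bind the variable with index 0.
\<close>

datatype tm =
    Var nat
  | Zr
  | Sc tm
  | Add tm tm  (infixl "\<^bold>+" 65)
  | Mul tm tm  (infixl "\<^bold>*" 70)

datatype fm =
    Fls
  | Eq tm tm   (infix "\<^bold>=" 50)
  | Lt tm tm   (infix "\<^bold><" 50)
  | Conj fm fm (infixr "\<^bold>\<and>" 35)
  | Disj fm fm (infixr "\<^bold>\<or>" 30)
  | Imp fm fm  (infixr "\<^bold>\<longrightarrow>" 25)
  | All fm
  | Ex fm

abbreviation Neg :: "fm \<Rightarrow> fm" where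
  "Neg \<phi> \<equiv> Imp \<phi> Fls"

abbreviation Iff :: "fm \<Rightarrow> fm \<Rightarrow> fm" where
  "Iff \<phi> \<psi> \<equiv> Conj (Imp \<phi> \<psi>) (Imp \<psi> \<phi>)"

primrec fvt :: "tm \<Rightarrow> nat set" where
  "fvt (Var i) = {i}"
| "fvt Zr = {}"
| "fvt (Sc t) = fvt t"
| "fvt (s \<^bold>+ t) = fvt s \<union> fvt t"
| "fvt (s \<^bold>* t) = fvt s \<union> fvt t"

primrec fv :: "fm \<Rightarrow> nat set" where
  "fv Fls = {}"
| "fv (s \<^bold>= t) = fvt s \<union> fvt t"
| "fv (s \<^bold>< t) = fvt s \<union> fvt t"
| "fv (\<phi> \<^bold>\<and> \<psi>) = fv \<phi> \<union> fv \<psi>"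
| "fv (\<phi> \<^bold>\<or> \<psi>) = fv \<phi> \<union> fv \<psi>"
| "fv (\<phi> \<^bold>\<longrightarrow> \<psi>) = fv \<phi> \<union> fv \<psi>"
| "fv (All \<phi>) = {i. Suc i \<in> fv \<phi>}"
| "fv (Ex \<phi>) = {i. Suc i \<in> fv \<phi>}"

primrec substt :: "(nat \<Rightarrow> tm) \<Rightarrow> tm \<Rightarrow> tm" where
  "substt \<sigma> (Var i) = \<sigma> i"
| "substt \<sigma> Zr = Zr"
| "substt \<sigma> (Sc t) = Sc (substt \<sigma> t)"
| "substt \<sigma> (s \<^bold>+ t) = substt \<sigma> s \<^bold>+ substt \<sigma> t"
| "substt \<sigma> (s \<^bold>* t) = substt \<sigma> s \<^bold>* substt \<sigma> t"

text \<open>\<open>shift k t\<close> is \<open>t\<close> read below \<open>k\<close> additional quantifiers.\<close>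

definition shift :: "nat \<Rightarrow> tm \<Rightarrow> tm" where
  "shift k = substt (\<lambda>i. Var (i + k))"

definition up :: "(nat \<Rightarrow> tm) \<Rightarrow> nat \<Rightarrow> tm" where
  "up \<sigma> = case_nat (Var 0) (\<lambda>i. shift 1 (\<sigma> i))"

primrec subst :: "(nat \<Rightarrow> tm) \<Rightarrow> fm \<Rightarrow> fm" where
  "subst \<sigma> Fls = Fls"
| "subst \<sigma> (s \<^bold>= t) = (substt \<sigma> s \<^bold>= substt \<sigma> t)"
| "subst \<sigma> (s \<^bold>< t) = (substt \<sigma> s \<^bold>< substt \<sigma> t)"
| "subst \<sigma> (\<phi> \<^bold>\<and> \<psi>) = (subst \<sigma> \<phi> \<^bold>\<and> subst \<sigma> \<psi>)"
| "subst \<sigma> (\<phi> \<^bold>\<or> \<psi>) = (subst \<sigma> \<phi> \<^bold>\<or> subst \<sigma> \<psi>)"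
| "subst \<sigma> (\<phi> \<^bold>\<longrightarrow> \<psi>) = (subst \<sigma> \<phi> \<^bold>\<longrightarrow> subst \<sigma> \<psi>)"
| "subst \<sigma> (All \<phi>) = All (subst (up \<sigma>) \<phi>)"
| "subst \<sigma> (Ex \<phi>) = Ex (subst (up \<sigma>) \<phi>)"

definition lift :: "fm \<Rightarrow> fm" where
  "lift = subst (\<lambda>i. Var (Suc i))"

definition inst :: "fm \<Rightarrow> tm \<Rightarrow> fm" where
  "inst \<phi> t = subst (case_nat t Var) \<phi>"

text \<open>
  \<open>app k \<phi> t\<close> is the formula \<open>\<phi>(t)\<close>, where the distinguished variable of \<open>\<phi>\<close> has index 0,
  for \<open>\<phi>\<close> stated outside, and \<open>t\<close> inside, the scope of \<open>k\<close> quantifiers.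
\<close>

definition app :: "nat \<Rightarrow> fm \<Rightarrow> tm \<Rightarrow> fm" where
  "app k \<phi> t = subst (case_nat t (\<lambda>i. Var (i + k))) \<phi>"


section \<open>Provability\<close>

inductive nd :: "fm set \<Rightarrow> fm \<Rightarrow> bool"  (infix "\<turnstile>" 20) where
  nd_assm: "\<phi> \<in> \<Gamma> \<Longrightarrow> \<Gamma> \<turnstile> \<phi>"
| nd_ccontr: "insert (Neg \<phi>) \<Gamma> \<turnstile> Fls \<Longrightarrow> \<Gamma> \<turnstile> \<phi>"
| nd_conjI: "\<Gamma> \<turnstile> \<phi> \<Longrightarrow> \<Gamma> \<turnstile> \<psi> \<Longrightarrow> \<Gamma> \<turnstile> \<phi> \<^bold>\<and> \<psi>"
| nd_conjE1: "\<Gamma> \<turnstile> \<phi> \<^bold>\<and> \<psi> \<Longrightarrow> \<Gamma> \<turnstile> \<phi>"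
| nd_conjE2: "\<Gamma> \<turnstile> \<phi> \<^bold>\<and> \<psi> \<Longrightarrow> \<Gamma> \<turnstile> \<psi>"
| nd_disjI1: "\<Gamma> \<turnstile> \<phi> \<Longrightarrow> \<Gamma> \<turnstile> \<phi> \<^bold>\<or> \<psi>"
| nd_disjI2: "\<Gamma> \<turnstile> \<psi> \<Longrightarrow> \<Gamma> \<turnstile> \<phi> \<^bold>\<or> \<psi>"
| nd_disjE: "\<Gamma> \<turnstile> \<phi> \<^bold>\<or> \<psi> \<Longrightarrow> insert \<phi> \<Gamma> \<turnstile> \<chi> \<Longrightarrow> insert \<psi> \<Gamma> \<turnstile> \<chi> \<Longrightarrow> \<Gamma> \<turnstile> \<chi>"
| nd_impI: "insert \<phi> \<Gamma> \<turnstile> \<psi> \<Longrightarrow> \<Gamma> \<turnstile> \<phi> \<^bold>\<longrightarrow> \<psi>"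
| nd_impE: "\<Gamma> \<turnstile> \<phi> \<^bold>\<longrightarrow> \<psi> \<Longrightarrow> \<Gamma> \<turnstile> \<phi> \<Longrightarrow> \<Gamma> \<turnstile> \<psi>"
| nd_allI: "lift ` \<Gamma> \<turnstile> \<phi> \<Longrightarrow> \<Gamma> \<turnstile> All \<phi>"
| nd_allE: "\<Gamma> \<turnstile> All \<phi> \<Longrightarrow> \<Gamma> \<turnstile> inst \<phi> t"
| nd_exI: "\<Gamma> \<turnstile> inst \<phi> t \<Longrightarrow> \<Gamma> \<turnstile> Ex \<phi>"
| nd_exE: "\<Gamma> \<turnstile> Ex \<phi> \<Longrightarrow> insert \<phi> (lift ` \<Gamma>) \<turnstile> lift \<psi> \<Longrightarrow> \<Gamma> \<turnstile> \<psi>"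
| nd_eq_refl: "\<Gamma> \<turnstile> t \<^bold>= t"
| nd_eq_subst: "\<Gamma> \<turnstile> s \<^bold>= t \<Longrightarrow> \<Gamma> \<turnstile> inst \<phi> s \<Longrightarrow> \<Gamma> \<turnstile> inst \<phi> t"


section \<open>Peano arithmetic\<close>

definition basic_axioms :: "fm set" where
  "basic_axioms =
    {All (Neg (Sc (Var 0) \<^bold>= Zr)),
     All (All (Sc (Var 1) \<^bold>= Sc (Var 0) \<^bold>\<longrightarrow> Var 1 \<^bold>= Var 0)),
     All (Var 0 \<^bold>+ Zr \<^bold>= Var 0),
     All (All (Var 1 \<^bold>+ Sc (Var 0) \<^bold>= Sc (Var 1 \<^bold>+ Var 0))),
     All (Var 0 \<^bold>* Zr \<^bold>= Zr),
     All (All (Var 1 \<^bold>* Sc (Var 0) \<^bold>= Var 1 \<^bold>* Var 0 \<^bold>+ Var 1)),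
     All (All (Iff (Var 1 \<^bold>< Var 0) (Ex (Var 2 \<^bold>+ Sc (Var 0) \<^bold>= Var 1))))}"

definition induction :: "fm \<Rightarrow> fm" where
  "induction \<phi> = (inst \<phi> Zr \<^bold>\<and> All (\<phi> \<^bold>\<longrightarrow> app 1 \<phi> (Sc (Var 0))) \<^bold>\<longrightarrow> All \<phi>)"

text \<open>The induction axioms are universally closed, so that parameters are allowed.\<close>

definition PA :: "fm set" where
  "PA = basic_axioms \<union>
    {(All ^^ n) (induction \<phi>) | n \<phi>. fv ((All ^^ n) (induction \<phi>)) = {}}"


section \<open>The arithmetical hierarchy\<close>

definition Allb :: "tm \<Rightarrow> fm \<Rightarrow> fm" where
  "Allb t \<phi> = All (Var 0 \<^bold>< shift 1 t \<^bold>\<longrightarrow> \<phi>)"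

definition Exb :: "tm \<Rightarrow> fm \<Rightarrow> fm" where
  "Exb t \<phi> = Ex (Var 0 \<^bold>< shift 1 t \<^bold>\<and> \<phi>)"

inductive Delta0 :: "fm \<Rightarrow> bool" where
  "Delta0 Fls"
| "Delta0 (s \<^bold>= t)"
| "Delta0 (s \<^bold>< t)"
| "Delta0 \<phi> \<Longrightarrow> Delta0 \<psi> \<Longrightarrow> Delta0 (\<phi> \<^bold>\<and> \<psi>)"
| "Delta0 \<phi> \<Longrightarrow> Delta0 \<psi> \<Longrightarrow> Delta0 (\<phi> \<^bold>\<or> \<psi>)"
| "Delta0 \<phi> \<Longrightarrow> Delta0 \<psi> \<Longrightarrow> Delta0 (\<phi> \<^bold>\<longrightarrow> \<psi>)"
| "Delta0 \<phi> \<Longrightarrow> Delta0 (Allb t \<phi>)"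
| "Delta0 \<phi> \<Longrightarrow> Delta0 (Exb t \<phi>)"

fun Sigma_fm :: "nat \<Rightarrow> fm \<Rightarrow> bool" and Pi_fm :: "nat \<Rightarrow> fm \<Rightarrow> bool" where
  "Sigma_fm 0 \<phi> = Delta0 \<phi>"
| "Sigma_fm (Suc n) \<phi> = (\<exists>\<psi>. \<phi> = Ex \<psi> \<and> Pi_fm n \<psi>)"
| "Pi_fm 0 \<phi> = Delta0 \<phi>"
| "Pi_fm (Suc n) \<phi> = (\<exists>\<psi>. \<phi> = All \<psi> \<and> Sigma_fm n \<psi>)"


section \<open>Pairs and finite sets in arithmetic\<close>

text \<open>\<open>is_pair x y z\<close>: \<open>z\<close> is the Cantor pair \<open>prod_encode (x, y)\<close>, which is
  \<open>(x + y)(x + y + 1)/2 + x\<close>.\<close>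

definition is_pair :: "tm \<Rightarrow> tm \<Rightarrow> tm \<Rightarrow> fm" where
  "is_pair x y z =
    (Sc (Sc Zr) \<^bold>* z \<^bold>= (x \<^bold>+ y) \<^bold>* Sc (x \<^bold>+ y) \<^bold>+ Sc (Sc Zr) \<^bold>* x)"

text \<open>\<open>is_cons x y z\<close>: \<open>z = prod_encode (x, y) + 1\<close>.\<close>

definition is_cons :: "tm \<Rightarrow> tm \<Rightarrow> tm \<Rightarrow> fm" where
  "is_cons x y z =
    (Sc (Sc Zr) \<^bold>* z \<^bold>= (x \<^bold>+ y) \<^bold>* Sc (x \<^bold>+ y) \<^bold>+ Sc (Sc Zr) \<^bold>* Sc x)"

text \<open>
  Every number \<open>a\<close> codes a finite set, and every finite set has a code: for \<open>a = (w, (u, v))\<close>,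
  the elements are the \<open>x < w\<close> such that \<open>1 + (x + 1)v\<close> divides \<open>u\<close> (Goedel's beta function).
  See \<open>finite_coded\<close> and \<open>ex_coded\<close> below.
\<close>

definition mem :: "tm \<Rightarrow> tm \<Rightarrow> fm" where
  "mem x a =
    Exb (Sc a) (Exb (Sc (shift 1 a)) (Exb (Sc (shift 2 a)) (Exb (Sc (shift 3 a))
      (is_pair (Var 3) (Var 2) (shift 4 a) \<^bold>\<and> is_pair (Var 1) (Var 0) (Var 2) \<^bold>\<and>
       shift 4 x \<^bold>< Var 3 \<^bold>\<and>
       Exb (Sc (Var 1)) (Var 0 \<^bold>* Sc (Sc (shift 5 x) \<^bold>* Var 1) \<^bold>= Var 2)))))"

definition pmem :: "tm \<Rightarrow> tm \<Rightarrow> tm \<Rightarrow> fm" where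
  "pmem x y a =
    Exb a (is_pair (shift 1 x) (shift 1 y) (Var 0) \<^bold>\<and> mem (Var 0) (shift 1 a))"


section \<open>Binary trees\<close>

datatype tree = Leaf | Node tree tree

fun tree_le :: "tree \<Rightarrow> tree \<Rightarrow> bool" where
  "tree_le Leaf t = True"
| "tree_le (Node s0 s1) Leaf = False"
| "tree_le (Node s0 s1) (Node t0 t1) =
    (tree_le s0 t0 \<and> tree_le s1 t1 \<or> tree_le (Node s0 s1) t0 \<or> tree_le (Node s0 s1) t1)"

primrec tree_code :: "tree \<Rightarrow> nat" where
  "tree_code Leaf = 0"
| "tree_code (Node s t) = Suc (prod_encode (tree_code s, tree_code t))"

text \<open>
  Inductive relations are rendered in arithmetic in the usual way: an instance holds if it
  belongs to a finite set \<open>c\<close> (the outermost quantifier) all of whose elements follow, by one of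
  the clauses, from other elements of \<open>c\<close>. The recursions are well-founded, so the least and the
  greatest solution agree. The formulas are justified by \<open>sat_tree_fm\<close> and \<open>sat_tree_le_fm\<close>
  below.
\<close>

definition tree_fm :: "tm \<Rightarrow> fm" where
  "tree_fm x = Ex (mem (shift 1 x) (Var 0) \<^bold>\<and>
    Allb (Var 0) (mem (Var 0) (Var 1) \<^bold>\<longrightarrow>
      Var 0 \<^bold>= Zr \<^bold>\<or>
      Exb (Var 0) (Exb (Var 1)
        (is_cons (Var 1) (Var 0) (Var 2) \<^bold>\<and> mem (Var 1) (Var 3) \<^bold>\<and> mem (Var 0) (Var 3)))))"

definition tree_le_fm :: "tm \<Rightarrow> tm \<Rightarrow> fm" where
  "tree_le_fm s t = Ex (pmem (shift 1 s) (shift 1 t) (Var 0) \<^bold>\<and>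
    Allb (Var 0) (Allb (Var 1) (pmem (Var 1) (Var 0) (Var 2) \<^bold>\<longrightarrow>
      Var 1 \<^bold>= Zr \<^bold>\<or>
      Exb (Var 0) (Exb (Var 1)
        (is_cons (Var 1) (Var 0) (Var 2) \<^bold>\<and>
         (Exb (Var 3) (Exb (Var 4)
            (is_cons (Var 1) (Var 0) (Var 5) \<^bold>\<and>
             pmem (Var 1) (Var 3) (Var 6) \<^bold>\<and> pmem (Var 0) (Var 2) (Var 6))) \<^bold>\<or>
          pmem (Var 3) (Var 1) (Var 4) \<^bold>\<or> pmem (Var 3) (Var 0) (Var 4)))))))"


section \<open>The finite basis scheme\<close>

text \<open>As every number codes a finite set, a finite subset of \<open>\<B>\<close> is a set of trees.\<close>

definition finite_tree_set_fm :: "tm \<Rightarrow> fm" where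
  "finite_tree_set_fm a = All (mem (Var 0) (shift 1 a) \<^bold>\<longrightarrow> tree_fm (Var 0))"

definition K_fm :: "fm \<Rightarrow> fm" where
  "K_fm \<phi> = Ex (finite_tree_set_fm (Var 0) \<^bold>\<and>
    All (mem (Var 0) (Var 1) \<^bold>\<longrightarrow> app 2 \<phi> (Var 0)) \<^bold>\<and>
    All (tree_fm (Var 0) \<^bold>\<longrightarrow> app 2 \<phi> (Var 0) \<^bold>\<longrightarrow>
      Ex (mem (Var 0) (Var 2) \<^bold>\<and> tree_le_fm (Var 0) (Var 1))))"

definition K_Sigma1_minus :: "fm set" where
  "K_Sigma1_minus = {K_fm \<phi> | \<phi>. Sigma_fm 1 \<phi> \<and> fv \<phi> = {0}}"


section \<open>Ordinals below \<open>\<epsilon>\<^sub>0\<close> and transfinite induction\<close>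

text \<open>
  \<open>Omega [\<alpha>, \<dots>, \<beta>]\<close> stands for \<open>\<omega>\<^sup>\<alpha> + \<dots> + \<omega>\<^sup>\<beta>\<close>. Terms satisfying \<open>nf\<close> are in Cantor normal form,
  and \<open>ord_less\<close> compares such terms lexicographically. In arithmetic, 0 codes the empty sum and
  \<open>is_cons x y z\<close> says that \<open>z\<close> codes the sum with leading exponent \<open>x\<close> and remaining sum \<open>y\<close>; see
  \<open>sat_ord_less_fm\<close> and \<open>sat_nf_fm\<close> below.
\<close>

datatype ord = Omega "ord list"

fun ord_less :: "ord \<Rightarrow> ord \<Rightarrow> bool" where
  "ord_less (Omega as) (Omega []) = False"
| "ord_less (Omega []) (Omega (b # bs)) = True"
| "ord_less (Omega (a # as)) (Omega (b # bs)) =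
    (ord_less a b \<or> a = b \<and> ord_less (Omega as) (Omega bs))"

fun nf :: "ord \<Rightarrow> bool" where
  "nf (Omega as) =
    ((\<forall>a \<in> set as. nf a) \<and> sorted_wrt (\<lambda>a b. b = a \<or> ord_less b a) as)"

primrec ord_code :: "ord \<Rightarrow> nat" where
  "ord_code (Omega as) = list_encode (map ord_code as)"

definition ord_less_fm :: "tm \<Rightarrow> tm \<Rightarrow> fm" where
  "ord_less_fm x y = Ex (pmem (shift 1 x) (shift 1 y) (Var 0) \<^bold>\<and>
    Allb (Var 0) (Allb (Var 1) (pmem (Var 1) (Var 0) (Var 2) \<^bold>\<longrightarrow>
      Exb (Var 0) (Exb (Var 1)
        (is_cons (Var 1) (Var 0) (Var 2) \<^bold>\<and>
         (Var 3 \<^bold>= Zr \<^bold>\<or>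
          Exb (Var 3) (Exb (Var 4)
            (is_cons (Var 1) (Var 0) (Var 5) \<^bold>\<and>
             (pmem (Var 1) (Var 3) (Var 6) \<^bold>\<or>
              Var 1 \<^bold>= Var 3 \<^bold>\<and> pmem (Var 0) (Var 2) (Var 6))))))))))"

text \<open>
  A nonzero term is in normal form if its leading exponent and the remaining sum are, and the
  leading exponent of the latter (if any) is not above the former.
\<close>

definition nf_fm :: "tm \<Rightarrow> fm" where
  "nf_fm x = Ex (mem (shift 1 x) (Var 0) \<^bold>\<and>
    Allb (Var 0) (mem (Var 0) (Var 1) \<^bold>\<longrightarrow>
      Var 0 \<^bold>= Zr \<^bold>\<or>
      Exb (Var 0) (Exb (Var 1)
        (is_cons (Var 1) (Var 0) (Var 2) \<^bold>\<and> mem (Var 1) (Var 3) \<^bold>\<and> mem (Var 0) (Var 3) \<^bold>\<and>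
         (Var 0 \<^bold>= Zr \<^bold>\<or>
          Exb (Var 0) (Exb (Var 1)
            (is_cons (Var 1) (Var 0) (Var 2) \<^bold>\<and>
             (Var 1 \<^bold>= Var 3 \<^bold>\<or> ord_less_fm (Var 1) (Var 3)))))))))"

definition TI_fm :: "fm \<Rightarrow> fm" where
  "TI_fm \<psi> =
    (All (nf_fm (Var 0) \<^bold>\<longrightarrow>
       All (nf_fm (Var 0) \<^bold>\<longrightarrow> ord_less_fm (Var 0) (Var 1) \<^bold>\<longrightarrow> app 2 \<psi> (Var 0)) \<^bold>\<longrightarrow> app 1 \<psi> (Var 0)) \<^bold>\<longrightarrow>
     All (nf_fm (Var 0) \<^bold>\<longrightarrow> app 1 \<psi> (Var 0)))"

definition TI_Pi1_minus :: "fm set" where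
  "TI_Pi1_minus = {TI_fm \<psi> | \<psi>. Pi_fm 1 \<psi> \<and> fv \<psi> = {0}}"


section \<open>Adequacy in the standard model\<close>

primrec eval :: "(nat \<Rightarrow> nat) \<Rightarrow> tm \<Rightarrow> nat" where
  "eval e (Var i) = e i"
| "eval e Zr = 0"
| "eval e (Sc t) = Suc (eval e t)"
| "eval e (s \<^bold>+ t) = eval e s + eval e t"
| "eval e (s \<^bold>* t) = eval e s * eval e t"

primrec sat :: "(nat \<Rightarrow> nat) \<Rightarrow> fm \<Rightarrow> bool" where
  "sat e Fls = False"
| "sat e (s \<^bold>= t) = (eval e s = eval e t)"
| "sat e (s \<^bold>< t) = (eval e s < eval e t)"
| "sat e (\<phi> \<^bold>\<and> \<psi>) = (sat e \<phi> \<and> sat e \<psi>)"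
| "sat e (\<phi> \<^bold>\<or> \<psi>) = (sat e \<phi> \<or> sat e \<psi>)"
| "sat e (\<phi> \<^bold>\<longrightarrow> \<psi>) = (sat e \<phi> \<longrightarrow> sat e \<psi>)"
| "sat e (All \<phi>) = (\<forall>x. sat (case_nat x e) \<phi>)"
| "sat e (Ex \<phi>) = (\<exists>x. sat (case_nat x e) \<phi>)"

lemma eval_substt: "eval e (substt \<sigma> t) = eval (\<lambda>i. eval e (\<sigma> i)) t"
  by (induction t) auto

lemma eval_shift [simp]: "eval e (shift k t) = eval (\<lambda>i. e (i + k)) t"
  by (simp add: shift_def eval_substt)

lemma eval_up: "(\<lambda>i. eval (case_nat x e) (up \<sigma> i)) = case_nat x (\<lambda>i. eval e (\<sigma> i))"
  by (rule ext) (simp add: up_def split: nat.split)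

lemma sat_subst: "sat e (subst \<sigma> \<phi>) = sat (\<lambda>i. eval e (\<sigma> i)) \<phi>"
  by (induction \<phi> arbitrary: e \<sigma>) (simp_all add: eval_substt eval_up)

lemma sat_lift [simp]: "sat (case_nat x e) (lift \<phi>) = sat e \<phi>"
  by (simp add: lift_def sat_subst)

lemma sat_inst [simp]: "sat e (inst \<phi> t) = sat (case_nat (eval e t) e) \<phi>"
proof -
  have "(\<lambda>i. eval e (case_nat t Var i)) = case_nat (eval e t) e"
    by (rule ext) (simp split: nat.split)
  then show ?thesis
    by (simp add: inst_def sat_subst)
qed

lemma sat_app [simp]: "sat e (app k \<phi> t) = sat (case_nat (eval e t) (\<lambda>i. e (i + k))) \<phi>"
proof -
  have "(\<lambda>i. eval e (case_nat t (\<lambda>i. Var (i + k)) i)) = case_nat (eval e t) (\<lambda>i. e (i + k))"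
    by (rule ext) (simp split: nat.split)
  then show ?thesis
    by (simp add: app_def sat_subst)
qed

theorem soundness: "\<Gamma> \<turnstile> \<phi> \<Longrightarrow> (\<And>\<chi>. \<chi> \<in> \<Gamma> \<Longrightarrow> sat e \<chi>) \<Longrightarrow> sat e \<phi>"
proof (induction arbitrary: e rule: nd.induct)
  case (nd_exE \<Gamma> \<phi> \<psi>)
  from nd_exE.IH(1)[OF nd_exE.prems] obtain x where x: "sat (case_nat x e) \<phi>"
    by auto
  have "sat (case_nat x e) (lift \<psi>)"
    by (rule nd_exE.IH(2)) (use x nd_exE.prems in auto)
  then show ?case
    by simp
next
  case (nd_allI \<Gamma> \<phi>)
  have "sat (case_nat x e) \<phi>" for x
    by (rule nd_allI.IH) (use nd_allI.prems in auto)
  then show ?case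
    by simp
next
  case (nd_allE \<Gamma> \<phi> t)
  then show ?case
    by auto
next
  case (nd_exI \<Gamma> \<phi> t)
  then show ?case
    by auto
next
  case (nd_eq_subst \<Gamma> s t \<phi>)
  then show ?case
    by auto
next
  case (nd_ccontr \<phi> \<Gamma>)
  then show ?case
    by (metis insertE sat.simps(1) sat.simps(6))
next
  case (nd_disjE \<Gamma> \<phi> \<psi> \<chi>)
  then show ?case
    by (metis insertE sat.simps(5))
next
  case (nd_impI \<phi> \<Gamma> \<psi>)
  then show ?case
    by (metis insertE sat.simps(6))
qed auto

lemma sat_Alls: "(\<And>e. sat e \<phi>) \<Longrightarrow> sat e ((All ^^ n) \<phi>)"
  by (induction n arbitrary: e) auto

lemma sat_induction: "sat e (induction \<phi>)"
proof -
  have "sat (case_nat x e) \<phi>"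
    if "sat (case_nat 0 e) \<phi>"
      and "\<And>x. sat (case_nat x e) \<phi> \<Longrightarrow> sat (case_nat (Suc x) e) \<phi>" for x
    using that by (induction x) auto
  then show ?thesis
    by (simp add: induction_def)
qed

theorem sat_PA: "\<phi> \<in> PA \<Longrightarrow> sat e \<phi>"
  unfolding PA_def basic_axioms_def
  by (auto simp: sat_Alls sat_induction less_iff_Suc_add eval_nat_numeral algebra_simps)

lemma sat_Allb [simp]: "sat e (Allb t \<phi>) = (\<forall>x < eval e t. sat (case_nat x e) \<phi>)"
  by (auto simp: Allb_def)

lemma sat_Exb [simp]: "sat e (Exb t \<phi>) = (\<exists>x < eval e t. sat (case_nat x e) \<phi>)"
  by (auto simp: Exb_def)

lemma prod_encode_iff: "z = prod_encode (x, y) \<longleftrightarrow> 2 * z = (x + y) * Suc (x + y) + 2 * x"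
proof -
  have "2 * triangle n = n * Suc n" for n
    by (induction n) auto
  then have "2 * prod_encode (x, y) = (x + y) * Suc (x + y) + 2 * x"
    by (simp add: prod_encode_def)
  then show ?thesis
    by linarith
qed

lemma sat_is_pair [simp]:
  "sat e (is_pair x y z) \<longleftrightarrow> eval e z = prod_encode (eval e x, eval e y)"
  by (simp only: is_pair_def sat.simps eval.simps prod_encode_iff numeral_2_eq_2)

lemma sat_is_cons [simp]:
  "sat e (is_cons x y z) \<longleftrightarrow> eval e z = Suc (prod_encode (eval e x, eval e y))"
proof (cases "eval e z")
  case (Suc p)
  then show ?thesis
    using prod_encode_iff[of p "eval e x" "eval e y"] by (simp add: is_cons_def) linarith
qed (simp add: is_cons_def)

definition coded :: "nat \<Rightarrow> nat set" where
  "coded a = {x. \<exists>w u v. a = prod_encode (w, prod_encode (u, v)) \<and> x < w \<and> Suc (Suc x * v) dvd u}"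

lemma finite_coded: "finite (coded a)"
proof -
  obtain w u v where "a = prod_encode (w, prod_encode (u, v))"
    by (metis prod_decode_inverse surj_pair)
  then have "coded a \<subseteq> {..<w}"
    by (auto simp: coded_def)
  then show ?thesis
    by (rule finite_subset) simp
qed

lemma coded_less: "x \<in> coded a \<Longrightarrow> x < a"
  unfolding coded_def using le_prod_encode_1 order_less_le_trans by blast

lemma ex_coded:
  assumes "finite A"
  shows "\<exists>a. coded a = A"
proof -
  obtain N where N: "A \<subseteq> {..<N}"
    using assms unfolding finite_nat_set_iff_bounded by blast
  define v :: nat where "v = fact N"
  define d where "d x = Suc (Suc x * v)" for x
  define u where "u = (\<Prod>x\<in>A. d x)"
  have coprime: "coprime (d x) (d y)" if "x < y" "y < N" for x y
  proof (rule coprimeI)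
    fix c assume c: "c dvd d x" "c dvd d y"
    have "c dvd Suc y * d x" "c dvd Suc x * d y"
      using c by simp_all
    then have "c dvd Suc y * d x - Suc x * d y"
      by (rule dvd_diff_nat)
    also have "Suc y * d x - Suc x * d y = y - x"
      by (simp add: d_def algebra_simps)
    also have "y - x dvd v"
      using that unfolding v_def by (intro dvd_fact) auto
    finally have "c dvd Suc x * v"
      by simp
    then show "c dvd 1"
      using c(1) dvd_diff_nat[of c "d x" "Suc x * v"] by (simp add: d_def)
  qed
  have "d y dvd u \<longleftrightarrow> y \<in> A" if "y < N" for y
  proof
    assume y: "d y dvd u"
    show "y \<in> A"
    proof (rule ccontr)
      assume "y \<notin> A"
      then have "coprime (d y) (d x)" if "x \<in> A" for x
        using that coprime[of x y] coprime[of y x] \<open>y < N\<close> N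
        by (metis coprime_commute lessThan_iff linorder_neqE_nat subsetD)
      then have "coprime (d y) u"
        unfolding u_def by (intro prod_coprime_right) auto
      then have "d y dvd 1"
        using y by (metis coprime_common_divisor dvd_refl)
      then show False
        by (simp add: d_def v_def)
    qed
  next
    assume "y \<in> A"
    then show "d y dvd u"
      unfolding u_def using assms by (rule dvd_prodI[rotated])
  qed
  then have "coded (prod_encode (N, prod_encode (u, v))) = A"
    using N by (auto simp: coded_def d_def)
  then show ?thesis ..
qed

lemma sat_mem [simp]: "sat e (mem x a) \<longleftrightarrow> eval e x \<in> coded (eval e a)"
proof -
  have bound: "(\<exists>q < Suc u. q * Suc (k * v) = u) \<longleftrightarrow> Suc (k * v) dvd u" for u v k :: nat
  proof
    assume "Suc (k * v) dvd u"
    then obtain q where "u = Suc (k * v) * q" ..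
    then show "\<exists>q < Suc u. q * Suc (k * v) = u"
      by (intro HOL.exI[of _ q]) (auto simp: mult.commute)
  qed (metis dvd_triv_right)
  have "sat e (mem x a) \<longleftrightarrow>
    (\<exists>w < Suc (eval e a). \<exists>p < Suc (eval e a). \<exists>u < Suc (eval e a). \<exists>v < Suc (eval e a).
      eval e a = prod_encode (w, p) \<and> p = prod_encode (u, v) \<and> eval e x < w \<and>
      Suc (Suc (eval e x) * v) dvd u)"
    unfolding bound[symmetric] by (simp add: mem_def eval_nat_numeral del: mult_Suc)
  also have "\<dots> \<longleftrightarrow> eval e x \<in> coded (eval e a)"
  proof
    assume "eval e x \<in> coded (eval e a)"
    then obtain w u v where a: "eval e a = prod_encode (w, prod_encode (u, v))"
      and *: "eval e x < w" "Suc (Suc (eval e x) * v) dvd u"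
      unfolding coded_def by blast
    have "w < Suc (eval e a)" "prod_encode (u, v) < Suc (eval e a)"
      unfolding a by (simp_all add: less_Suc_eq_le le_prod_encode_1 le_prod_encode_2)
    moreover from this have "u < Suc (eval e a)" "v < Suc (eval e a)"
      using le_prod_encode_1[of u v] le_prod_encode_2[of v u] by linarith+
    ultimately show "\<exists>w < Suc (eval e a). \<exists>p < Suc (eval e a). \<exists>u < Suc (eval e a). \<exists>v < Suc (eval e a).
      eval e a = prod_encode (w, p) \<and> p = prod_encode (u, v) \<and> eval e x < w \<and>
      Suc (Suc (eval e x) * v) dvd u"
      using a * by blast
  qed (unfold coded_def, blast)
  finally show ?thesis .
qed

lemma sat_pmem [simp]:
  "sat e (pmem x y a) \<longleftrightarrow> prod_encode (eval e x, eval e y) \<in> coded (eval e a)"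
  by (auto simp: pmem_def coded_less)

lemma prod_encode_coded_less:
  assumes "prod_encode (x, y) \<in> coded c"
  shows "x < c" "y < c"
  using coded_less[OF assms] le_prod_encode_1[of x y] le_prod_encode_2[of y x] by simp_all

lemma cons_less: "x < Suc (prod_encode (x, y))" "y < Suc (prod_encode (x, y))"
  using le_prod_encode_1[of x y] le_prod_encode_2[of y x] by simp_all

lemma ex_cons_bounded:
  "(\<exists>x<z. \<exists>y<z. z = Suc (prod_encode (x, y)) \<and> P x y) \<longleftrightarrow>
    (\<exists>x y. z = Suc (prod_encode (x, y)) \<and> P x y)"
  using cons_less by blast

lemma ex_coded_pairs:
  "\<exists>c. \<forall>x y. prod_encode (x, y) \<in> coded c \<longleftrightarrow> x \<le> m \<and> y \<le> n \<and> R x y"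
proof -
  have "finite (prod_encode ` {(x, y). x \<le> m \<and> y \<le> n \<and> R x y})"
    by (rule finite_imageI, rule finite_subset[of _ "{..m} \<times> {..n}"]) auto
  from ex_coded[OF this] obtain c where
    "coded c = prod_encode ` {(x, y). x \<le> m \<and> y \<le> n \<and> R x y}" ..
  then show ?thesis
    by (intro exI[of _ c]) (auto simp: image_iff)
qed

lemma bij_tree_code: "bij tree_code"
proof (rule bijI)
  have "tree_code s = tree_code t \<Longrightarrow> s = t" for s t
  proof (induction s arbitrary: t)
    case Leaf
    then show ?case by (cases t) auto
  next
    case (Node s0 s1)
    then show ?case by (cases t) auto
  qed
  then show "inj tree_code"
    by (rule injI)
  have "\<exists>s. n = tree_code s" for n
  proof (induction n rule: less_induct)
    case (less n)
    show ?case
    proof (cases n)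
      case 0
      then show ?thesis
        by (metis tree_code.simps(1))
    next
      case (Suc p)
      then obtain x y where n: "n = Suc (prod_encode (x, y))"
        by (metis prod_decode_inverse surj_pair)
      then show ?thesis
        using less[of x] less[of y] cons_less[of x y] cons_less[of y x]
        by (metis tree_code.simps(2) cons_less)
    qed
  qed
  then show "surj tree_code"
    by (auto simp: surj_def)
qed


theorem sat_tree_fm: "sat e (tree_fm x) \<longleftrightarrow> eval e x \<in> range tree_code"
proof -
  obtain c where c: "coded c = {..eval e x}"
    using ex_coded by blast
  have step: "\<exists>l<y. \<exists>r<y. y = Suc (prod_encode (l, r))" if "y \<noteq> 0" for y
    using that by (metis cons_less not0_implies_Suc prod_decode_inverse surj_pair)
  have "y = 0 \<or> (\<exists>l<y. \<exists>r<y. y = Suc (prod_encode (l, r)) \<and> l \<in> coded c \<and> r \<in> coded c)"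
    if "y \<in> coded c" for y
    using step[of y] that c by fastforce
  moreover have "sat e (tree_fm x) \<longleftrightarrow> (\<exists>c. eval e x \<in> coded c \<and> (\<forall>y<c. y \<in> coded c \<longrightarrow> y = 0 \<or>
      (\<exists>l<y. \<exists>r<y. y = Suc (prod_encode (l, r)) \<and> l \<in> coded c \<and> r \<in> coded c)))"
    by (simp add: tree_fm_def eval_nat_numeral)
  moreover have "eval e x \<in> coded c"
    by (simp add: c)
  ultimately have "sat e (tree_fm x)"
    by blast
  then show ?thesis
    using bij_tree_code by (simp add: bij_is_surj)
qed

theorem sat_tree_le_fm:
  assumes "eval e x = tree_code s" "eval e y = tree_code t"
  shows "sat e (tree_le_fm x y) \<longleftrightarrow> tree_le s t"
proof -
  define clause where "clause c x y \<longleftrightarrow> x = 0 \<or>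
    (\<exists>t0 t1. y = Suc (prod_encode (t0, t1)) \<and>
      ((\<exists>s0 s1. x = Suc (prod_encode (s0, s1)) \<and>
         prod_encode (s0, t0) \<in> coded c \<and> prod_encode (s1, t1) \<in> coded c) \<or>
       prod_encode (x, t0) \<in> coded c \<or> prod_encode (x, t1) \<in> coded c))" for c x y
  have sat: "sat e (tree_le_fm x y) \<longleftrightarrow>
      (\<exists>c. prod_encode (tree_code s, tree_code t) \<in> coded c \<and>
        (\<forall>x<c. \<forall>y<c. prod_encode (x, y) \<in> coded c \<longrightarrow> clause c x y))"
    by (simp add: tree_le_fm_def clause_def ex_cons_bounded eval_nat_numeral assms)
  have "tree_le s t"
    if c: "\<forall>x<c. \<forall>y<c. prod_encode (x, y) \<in> coded c \<longrightarrow> clause c x y"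
      and "prod_encode (tree_code s, tree_code t) \<in> coded c" for c
  proof -
    have "prod_encode (tree_code s, tree_code t) \<in> coded c \<Longrightarrow>
        clause c (tree_code s) (tree_code t)" for s t
      using c prod_encode_coded_less by blast
    then show ?thesis
      using that(2) unfolding clause_def
      by (induction s t rule: tree_le.induct) fastforce+
  qed
  moreover have "\<exists>c. prod_encode (tree_code s, tree_code t) \<in> coded c \<and>
        (\<forall>x<c. \<forall>y<c. prod_encode (x, y) \<in> coded c \<longrightarrow> clause c x y)"
    if st: "tree_le s t"
  proof -
    define R where "R x y \<longleftrightarrow> (\<exists>s t. x = tree_code s \<and> y = tree_code t \<and> tree_le s t)" for x y
    obtain c where c: "prod_encode (x, y) \<in> coded c \<longleftrightarrow>
        x \<le> tree_code s \<and> y \<le> tree_code t \<and> R x y" for x y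
      using ex_coded_pairs by blast
    have "clause c x y" if xy: "prod_encode (x, y) \<in> coded c" for x y
    proof -
      from xy c have le: "x \<le> tree_code s" "y \<le> tree_code t" and "R x y"
        by auto
      have mem: "prod_encode (x', y') \<in> coded c" if "x' \<le> x" "y' \<le> y" "R x' y'" for x' y'
        unfolding c using that le by auto
      from \<open>R x y\<close> obtain s' t' where s': "x = tree_code s'" "y = tree_code t'" "tree_le s' t'"
        by (auto simp: R_def)
      show ?thesis
      proof (cases s')
        case Leaf
        then show ?thesis by (simp add: clause_def s')
      next
        case s: (Node s0 s1)
        with s' obtain t0 t1 where t: "t' = Node t0 t1"
          by (cases t') auto
        have less: "tree_code s0 < x" "tree_code s1 < x" "tree_code t0 < y" "tree_code t1 < y"
          using s t s' cons_less by auto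
        have "tree_le s0 t0 \<and> tree_le s1 t1 \<or> tree_le s' t0 \<or> tree_le s' t1"
          using s t s' by simp
        then have "R (tree_code s0) (tree_code t0) \<and> R (tree_code s1) (tree_code t1) \<or>
            R x (tree_code t0) \<or> R x (tree_code t1)"
          unfolding R_def s'(1) by blast
        then have "prod_encode (tree_code s0, tree_code t0) \<in> coded c \<and>
            prod_encode (tree_code s1, tree_code t1) \<in> coded c \<or>
            prod_encode (x, tree_code t0) \<in> coded c \<or> prod_encode (x, tree_code t1) \<in> coded c"
          using mem less by (meson less_imp_le_nat order_refl)
        moreover have "x = Suc (prod_encode (tree_code s0, tree_code s1))"
          "y = Suc (prod_encode (tree_code t0, tree_code t1))"
          using s t s' by simp_all
        ultimately show ?thesis
          unfolding clause_def by blast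
      qed
    qed
    moreover have "prod_encode (tree_code s, tree_code t) \<in> coded c"
      using c st by (auto simp: R_def)
    ultimately show ?thesis
      by blast
  qed
  ultimately show ?thesis
    unfolding sat by blast
qed

lemma ord_code_Cons:
  "ord_code (Omega (a # as)) = Suc (prod_encode (ord_code a, ord_code (Omega as)))"
  by simp

lemma ord_code_Nil: "ord_code (Omega []) = 0"
  by simp

lemma ord_code_inject: "ord_code a = ord_code b \<Longrightarrow> a = b"
proof (induction a b rule: ord_less.induct)
  case (1 as)
  then show ?case by (cases as) auto
qed auto

lemma ord_code_eq_iff [simp]: "ord_code a = ord_code b \<longleftrightarrow> a = b"
  using ord_code_inject by blast

lemma bij_ord_code: "bij ord_code"
proof (rule bijI)
  show "inj ord_code"
    by (rule injI) simp
  have "\<exists>a. n = ord_code a" for n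
  proof (induction n rule: less_induct)
    case (less n)
    show ?case
    proof (cases n)
      case 0
      then show ?thesis
        by (metis ord_code_Nil)
    next
      case (Suc p)
      then obtain x y where n: "n = Suc (prod_encode (x, y))"
        by (metis prod_decode_inverse surj_pair)
      then obtain a b where "x = ord_code a" "y = ord_code b"
        using less cons_less by metis
      then show ?thesis
        using n by (metis ord.exhaust ord_code_Cons)
    qed
  qed
  then show "surj ord_code"
    by (auto simp: surj_def)
qed

declare ord_code.simps [simp del] ord_code_Cons [simp] ord_code_Nil [simp]

theorem sat_ord_less_fm:
  assumes "eval e x = ord_code a" "eval e y = ord_code b"
  shows "sat e (ord_less_fm x y) \<longleftrightarrow> ord_less a b"
proof -
  define clause where "clause c x y \<longleftrightarrow>
    (\<exists>t0 t1. y = Suc (prod_encode (t0, t1)) \<and> (x = 0 \<or>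
      (\<exists>s0 s1. x = Suc (prod_encode (s0, s1)) \<and>
         (prod_encode (s0, t0) \<in> coded c \<or> s0 = t0 \<and> prod_encode (s1, t1) \<in> coded c))))"
    for c x y
  have sat: "sat e (ord_less_fm x y) \<longleftrightarrow>
      (\<exists>c. prod_encode (ord_code a, ord_code b) \<in> coded c \<and>
        (\<forall>x<c. \<forall>y<c. prod_encode (x, y) \<in> coded c \<longrightarrow> clause c x y))"
    by (simp add: ord_less_fm_def clause_def ex_cons_bounded eval_nat_numeral assms)
  have "ord_less a b"
    if c: "\<forall>x<c. \<forall>y<c. prod_encode (x, y) \<in> coded c \<longrightarrow> clause c x y"
      and "prod_encode (ord_code a, ord_code b) \<in> coded c" for c
  proof -
    have "prod_encode (ord_code a, ord_code b) \<in> coded c \<Longrightarrow>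
        clause c (ord_code a) (ord_code b)" for a b
      using c prod_encode_coded_less by blast
    then show ?thesis
      using that(2) unfolding clause_def
      by (induction a b rule: ord_less.induct) fastforce+
  qed
  moreover have "\<exists>c. prod_encode (ord_code a, ord_code b) \<in> coded c \<and>
        (\<forall>x<c. \<forall>y<c. prod_encode (x, y) \<in> coded c \<longrightarrow> clause c x y)"
    if ab: "ord_less a b"
  proof -
    define R where "R x y \<longleftrightarrow> (\<exists>a b. x = ord_code a \<and> y = ord_code b \<and> ord_less a b)" for x y
    obtain c where c: "prod_encode (x, y) \<in> coded c \<longleftrightarrow>
        x \<le> ord_code a \<and> y \<le> ord_code b \<and> R x y" for x y
      using ex_coded_pairs by blast
    have "clause c x y" if xy: "prod_encode (x, y) \<in> coded c" for x y
    proof -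
      from xy c have le: "x \<le> ord_code a" "y \<le> ord_code b" and "R x y"
        by auto
      have mem: "prod_encode (x', y') \<in> coded c" if "x' \<le> x" "y' \<le> y" "R x' y'" for x' y'
        unfolding c using that le by auto
      from \<open>R x y\<close> obtain a' b' where R: "x = ord_code a'" "y = ord_code b'" "ord_less a' b'"
        by (auto simp: R_def)
      then obtain b0 bs where b: "b' = Omega (b0 # bs)"
        by (metis ord.exhaust ord_less.simps(1) list.exhaust)
      have y: "ord_code b0 < y" "ord_code (Omega bs) < y"
        "y = Suc (prod_encode (ord_code b0, ord_code (Omega bs)))"
        using b R cons_less by auto
      show ?thesis
      proof (cases "a' = Omega []")
        case True
        then show ?thesis
          unfolding clause_def using R(1) y(3) by auto
      next
        case False
        then obtain a0 as where a: "a' = Omega (a0 # as)"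
          by (metis ord.exhaust list.exhaust)
        have x: "ord_code a0 < x" "ord_code (Omega as) < x"
          "x = Suc (prod_encode (ord_code a0, ord_code (Omega as)))"
          using a R cons_less by auto
        have "ord_less a0 b0 \<or> a0 = b0 \<and> ord_less (Omega as) (Omega bs)"
          using R(3) unfolding a b by simp
        then have "R (ord_code a0) (ord_code b0) \<or>
            ord_code a0 = ord_code b0 \<and> R (ord_code (Omega as)) (ord_code (Omega bs))"
          unfolding R_def by blast
        then have "prod_encode (ord_code a0, ord_code b0) \<in> coded c \<or>
            ord_code a0 = ord_code b0 \<and>
            prod_encode (ord_code (Omega as), ord_code (Omega bs)) \<in> coded c"
          using mem x(1,2) y(1,2) by (meson less_imp_le_nat)
        then show ?thesis
          unfolding clause_def using x(3) y(3) by blast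
      qed
    qed
    moreover have "prod_encode (ord_code a, ord_code b) \<in> coded c"
      using c ab by (auto simp: R_def)
    ultimately show ?thesis
      by blast
  qed
  ultimately show ?thesis
    unfolding sat by blast
qed

lemma ord_less_trans: "ord_less a b \<Longrightarrow> ord_less b c \<Longrightarrow> ord_less a c"
proof (induction b c arbitrary: a rule: ord_less.induct)
  case (3 b bs c cs)
  then show ?case
    by (cases a rule: ord.exhaust, rename_tac as, case_tac as) auto
next
  case (2 c cs)
  then show ?case
    by (cases a) auto
qed auto

lemma nf_Cons:
  "nf (Omega (a # as)) \<longleftrightarrow> nf a \<and> nf (Omega as) \<and>
    (as = [] \<or> hd as = a \<or> ord_less (hd as) a)"
  by (cases as) (auto dest: ord_less_trans)

theorem sat_nf_fm:
  assumes "eval e x = ord_code a"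
  shows "sat e (nf_fm x) \<longleftrightarrow> nf a"
proof -
  define clause where "clause c x \<longleftrightarrow> x = 0 \<or>
    (\<exists>l r. x = Suc (prod_encode (l, r)) \<and> l \<in> coded c \<and> r \<in> coded c \<and>
      (r = 0 \<or> (\<exists>l' r'. r = Suc (prod_encode (l', r')) \<and>
        (l' = l \<or> (\<exists>a b. l' = ord_code a \<and> l = ord_code b \<and> ord_less a b)))))" for c x
  have less: "sat e' (ord_less_fm x y) \<longleftrightarrow>
      (\<exists>a b. eval e' x = ord_code a \<and> eval e' y = ord_code b \<and> ord_less a b)" for e' x y
    using sat_ord_less_fm[of e' x _ y] bij_ord_code by (metis bij_pointE)
  have sat: "sat e (nf_fm x) \<longleftrightarrow>
      (\<exists>c. ord_code a \<in> coded c \<and> (\<forall>x<c. x \<in> coded c \<longrightarrow> clause c x))"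
    by (simp add: nf_fm_def clause_def ex_cons_bounded eval_nat_numeral assms less)
  have "nf a" if c: "\<forall>x<c. x \<in> coded c \<longrightarrow> clause c x" and "ord_code a \<in> coded c" for c
    using that(2)
  proof (induction "ord_code a" arbitrary: a rule: less_induct)
    case (less a)
    then have cl: "clause c (ord_code a)"
      using c coded_less by blast
    show ?case
    proof (cases "a = Omega []")
      case False
      then obtain a0 as where a: "a = Omega (a0 # as)"
        by (metis ord.exhaust list.exhaust)
      have "nf a0" "nf (Omega as)"
        using cl less.hyps[of a0] less.hyps[of "Omega as"] cons_less unfolding clause_def a by auto
      moreover have "as = [] \<or> hd as = a0 \<or> ord_less (hd as) a0"
        using cl unfolding clause_def a by (cases as) auto
      ultimately show ?thesis
        unfolding a nf_Cons by blast
    qed simp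
  qed
  moreover have "\<exists>c. ord_code a \<in> coded c \<and> (\<forall>x<c. x \<in> coded c \<longrightarrow> clause c x)" if "nf a"
  proof -
    obtain c where c: "coded c = {x. x \<le> ord_code a \<and> (\<exists>b. x = ord_code b \<and> nf b)}"
      using ex_coded[of "{x. x \<le> ord_code a \<and> (\<exists>b. x = ord_code b \<and> nf b)}"] by auto
    have "clause c x" if x: "x \<in> coded c" for x
    proof -
      from x c obtain b where b: "x = ord_code b" "nf b" "x \<le> ord_code a"
        by auto
      show ?thesis
      proof (cases "b = Omega []")
        case True
        then show ?thesis
          by (simp add: clause_def b)
      next
        case False
        then obtain b0 bs where b0: "b = Omega (b0 # bs)"
          by (metis ord.exhaust list.exhaust)
        have x: "x = Suc (prod_encode (ord_code b0, ord_code (Omega bs)))"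
          using b b0 by simp
        have nf: "nf b0" "nf (Omega bs)" "bs = [] \<or> hd bs = b0 \<or> ord_less (hd bs) b0"
          using b(2) unfolding b0 nf_Cons by blast+
        have "ord_code b0 \<in> coded c" "ord_code (Omega bs) \<in> coded c"
          using nf b(3) cons_less(1)[of "ord_code b0" "ord_code (Omega bs)"]
            cons_less(2)[of "ord_code (Omega bs)" "ord_code b0"]
          unfolding c x by (auto simp del: nf.simps)
        moreover have "ord_code (Omega bs) = 0 \<or>
          (\<exists>l r. ord_code (Omega bs) = Suc (prod_encode (l, r)) \<and>
            (l = ord_code b0 \<or> (\<exists>a b. l = ord_code a \<and> ord_code b0 = ord_code b \<and> ord_less a b)))"
          using nf(3) by (cases bs) auto
        ultimately show ?thesis
          unfolding clause_def using x by blast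
      qed
    qed
    moreover have "ord_code a \<in> coded c"
      using that c by auto
    ultimately show ?thesis
      by blast
  qed
  ultimately show ?thesis
    unfolding sat by blast
qed

lemma all_tree_code: "(\<forall>n. P n) \<longleftrightarrow> (\<forall>t. P (tree_code t))"
  and all_ord_code: "(\<forall>n. P n) \<longleftrightarrow> (\<forall>a. P (ord_code a))"
  using bij_tree_code bij_ord_code by (metis bij_pointE)+

theorem sat_K_fm:
  "sat e (K_fm \<phi>) \<longleftrightarrow> (\<exists>A. finite A \<and> (\<forall>s\<in>A. sat (case_nat (tree_code s) e) \<phi>) \<and>
    (\<forall>t. sat (case_nat (tree_code t) e) \<phi> \<longrightarrow> (\<exists>s\<in>A. tree_le s t)))"
proof -
  have range: "range tree_code = UNIV" and inj: "inj tree_code"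
    using bij_tree_code by (simp_all add: bij_is_surj bij_is_inj)
  have ex: "(\<exists>n. P n) \<longleftrightarrow> (\<exists>t. P (tree_code t))" for P
    using range by (metis surjD)
  have le: "sat (case_nat (tree_code s) (case_nat (tree_code t) e'))
      (tree_le_fm (Var 0) (Var (Suc 0))) \<longleftrightarrow> tree_le s t" for e' s t
    by (rule sat_tree_le_fm) simp_all
  have "sat e (K_fm \<phi>) \<longleftrightarrow> (\<exists>a. (\<forall>s. tree_code s \<in> coded a \<longrightarrow> sat (case_nat (tree_code s) e) \<phi>) \<and>
    (\<forall>t. sat (case_nat (tree_code t) e) \<phi> \<longrightarrow> (\<exists>s. tree_code s \<in> coded a \<and> tree_le s t)))"
    by (simp add: K_fm_def finite_tree_set_fm_def sat_tree_fm range eval_nat_numeral le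
        all_tree_code[where P = "\<lambda>n. n \<in> coded _ \<longrightarrow> _ n"]
        all_tree_code[where P = "\<lambda>n. sat (case_nat n _) _ \<longrightarrow> _ n"]
        ex[where P = "\<lambda>n. n \<in> coded _ \<and> _ n"])
  also have "\<dots> \<longleftrightarrow> (\<exists>A. finite A \<and> (\<forall>s\<in>A. sat (case_nat (tree_code s) e) \<phi>) \<and>
    (\<forall>t. sat (case_nat (tree_code t) e) \<phi> \<longrightarrow> (\<exists>s\<in>A. tree_le s t)))" (is "?l \<longleftrightarrow> ?r")
  proof
    assume ?l
    then obtain a where a: "\<forall>s. tree_code s \<in> coded a \<longrightarrow> sat (case_nat (tree_code s) e) \<phi>"
      "\<forall>t. sat (case_nat (tree_code t) e) \<phi> \<longrightarrow> (\<exists>s. tree_code s \<in> coded a \<and> tree_le s t)"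
      by blast
    have "finite (tree_code -` coded a)"
      using finite_coded inj by (rule finite_vimageI)
    with a show ?r
      unfolding Bex_def Ball_def
      by (intro exI[of _ "tree_code -` coded a"] conjI) (simp_all only: vimage_eq)
  next
    assume ?r
    then obtain A where A: "finite A" "\<forall>s\<in>A. sat (case_nat (tree_code s) e) \<phi>"
      "\<forall>t. sat (case_nat (tree_code t) e) \<phi> \<longrightarrow> (\<exists>s\<in>A. tree_le s t)"
      by blast
    obtain a where "coded a = tree_code ` A"
      using ex_coded[OF finite_imageI[OF A(1)]] ..
    then have "tree_code s \<in> coded a \<longleftrightarrow> s \<in> A" for s
      using inj by (simp add: inj_image_mem_iff)
    then show ?l
      using A(2,3) unfolding Bex_def Ball_def by (intro exI[of _ a]) simp
  qed
  finally show ?thesis .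
qed

theorem sat_TI_fm:
  "sat e (TI_fm \<psi>) \<longleftrightarrow>
    ((\<forall>c. nf c \<longrightarrow> (\<forall>b. nf b \<longrightarrow> ord_less b c \<longrightarrow> sat (case_nat (ord_code b) e) \<psi>) \<longrightarrow>
        sat (case_nat (ord_code c) e) \<psi>) \<longrightarrow>
     (\<forall>a. nf a \<longrightarrow> sat (case_nat (ord_code a) e) \<psi>))"
proof -
  have nf: "sat (case_nat (ord_code a) e') (nf_fm (Var 0)) \<longleftrightarrow> nf a" for e' a
    by (rule sat_nf_fm) simp
  have less: "sat (case_nat (ord_code b) (case_nat (ord_code c) e'))
      (ord_less_fm (Var 0) (Var 1)) \<longleftrightarrow> ord_less b c" for e' b c
    by (rule sat_ord_less_fm) simp_all
  show ?thesis
    unfolding TI_fm_def sat.simps sat_app all_ord_code nf less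
    by (simp add: eval_nat_numeral)
qed

end

theory Submission
  imports Defs "HOL-Library.Countable_Set"
begin

text \<open>
  Reading \<open>\<omega>\<^sup>\<alpha> + \<rho>\<close> as the tree with subtrees \<open>\<alpha>\<close> and \<open>\<rho>\<close> gives a quasi-embedding of the ordinals
  below \<open>\<epsilon>\<^sub>0\<close> into the binary trees: if \<open>s \<le> t\<close> as trees, then \<open>s\<close> is not above \<open>t\<close> as an ordinal.
  With the given encodings it is the identity on codes. If \<open>\<psi>\<close> is \<open>\<Pi>\<^sub>1\<close> and fails somewhere, a finite
  basis of the \<open>\<Sigma>\<^sub>1\<close> set of counterexamples to \<open>\<psi>\<close> therefore contains a least counterexample, so \<open>\<psi>\<close>
  is not progressive. By the completeness theorem this argument may be carried out in an arbitrary
  countable model, where induction holds for all relations that are definable with parameters.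
\<close>

section \<open>Substitution\<close>

text \<open>The least counterexample is the smallest element \<open>m\<close> of the basis. A
  counterexample \<open>y\<close> below \<open>m\<close> would lie above some basis element
  \<open>s\<close> in the tree order; then \<open>s\<close> is at most \<open>y\<close>, hence below
  \<open>m\<close>, as an ordinal. The quasi-embedding rests on one fact about normal forms: the
  leading exponent and the remaining sum are both smaller than the whole, so passing from a tree to
  a subtree decreases the ordinal.

  The obstacle is that elements of the model may be nonstandard. The datatypes \<open>tree\<close>
  and \<open>ord\<close> and their recursions say nothing about such codes. Both orders and the
  normal forms exist only through witness sets, and each of their properties is proved by induction
  on numerical codes, for a statement that has to be shown definable. The witness sets come from the
  beta function, which is therefore developed again inside the model. The scheme also demands a
  formula with a bounded matrix and a single free variable, so all witnesses for normality and
  comparison must be gathered under one unbounded quantifier.\<close>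

lemma substt_cong: "(\<And>i. i \<in> fvt t \<Longrightarrow> \<sigma> i = \<tau> i) \<Longrightarrow> substt \<sigma> t = substt \<tau> t"
  by (induction t) auto

lemma subst_cong: "(\<And>i. i \<in> fv \<phi> \<Longrightarrow> \<sigma> i = \<tau> i) \<Longrightarrow> subst \<sigma> \<phi> = subst \<tau> \<phi>"
proof (induction \<phi> arbitrary: \<sigma> \<tau>)
  case (All \<phi>)
  then have "subst (up \<sigma>) \<phi> = subst (up \<tau>) \<phi>"
    by (intro All.IH) (auto simp: up_def split: nat.split)
  then show ?case by simp
next
  case (Ex \<phi>)
  then have "subst (up \<sigma>) \<phi> = subst (up \<tau>) \<phi>"
    by (intro Ex.IH) (auto simp: up_def split: nat.split)
  then show ?case by simp
next
  case (Conj \<phi> \<psi>)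
  have "subst \<sigma> \<phi> = subst \<tau> \<phi>" "subst \<sigma> \<psi> = subst \<tau> \<psi>"
    by (rule Conj.IH; use Conj.prems in simp)+
  then show ?case by simp
next
  case (Disj \<phi> \<psi>)
  have "subst \<sigma> \<phi> = subst \<tau> \<phi>" "subst \<sigma> \<psi> = subst \<tau> \<psi>"
    by (rule Disj.IH; use Disj.prems in simp)+
  then show ?case by simp
next
  case (Imp \<phi> \<psi>)
  have "subst \<sigma> \<phi> = subst \<tau> \<phi>" "subst \<sigma> \<psi> = subst \<tau> \<psi>"
    by (rule Imp.IH; use Imp.prems in simp)+
  then show ?case by simp
qed (auto intro!: substt_cong)

lemma substt_substt: "substt \<sigma> (substt \<tau> t) = substt (\<lambda>i. substt \<sigma> (\<tau> i)) t"
  by (induction t) auto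

lemma substt_up_shift: "substt (up \<sigma>) (shift 1 t) = shift 1 (substt \<sigma> t)"
  by (simp add: shift_def substt_substt up_def)

lemma substt_case_nat_shift: "substt (case_nat s \<sigma>) (shift 1 t) = substt \<sigma> t"
  by (simp add: shift_def substt_substt)

lemma up_substt: "(\<lambda>i. substt (up \<sigma>) (up \<tau> i)) = up (\<lambda>i. substt \<sigma> (\<tau> i))"
proof
  show "substt (up \<sigma>) (up \<tau> i) = up (\<lambda>i. substt \<sigma> (\<tau> i)) i" for i
  proof (cases i)
    case (Suc j)
    then have "up \<tau> i = shift 1 (\<tau> j)"
      by (simp add: up_def)
    then show ?thesis
      unfolding substt_up_shift[symmetric] using Suc substt_up_shift[of \<sigma> "\<tau> j"]
      by (simp add: up_def[of "\<lambda>i. substt \<sigma> (\<tau> i)"])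
  qed (simp add: up_def)
qed

lemma subst_subst: "subst \<sigma> (subst \<tau> \<phi>) = subst (\<lambda>i. substt \<sigma> (\<tau> i)) \<phi>"
  by (induction \<phi> arbitrary: \<sigma> \<tau>) (simp_all add: substt_substt up_substt)

lemma substt_Var [simp]: "substt Var t = t"
  by (induction t) auto

lemma up_Var [simp]: "up Var = Var"
  by (rule ext) (simp add: up_def shift_def split: nat.split)

lemma subst_Var [simp]: "subst Var \<phi> = \<phi>"
  by (induction \<phi>) auto

lemma subst_lift: "subst \<sigma> (lift \<phi>) = subst (\<lambda>i. \<sigma> (Suc i)) \<phi>"
  by (simp add: lift_def subst_subst)

lemma lift_subst: "lift (subst \<sigma> \<phi>) = subst (\<lambda>i. shift 1 (\<sigma> i)) \<phi>"
  by (simp add: lift_def subst_subst shift_def)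

lemma subst_up_lift: "subst (up \<sigma>) (lift \<phi>) = lift (subst \<sigma> \<phi>)"
  by (simp add: subst_lift lift_subst up_def)

lemma inst_subst_up: "inst (subst (up \<sigma>) \<phi>) t = subst (case_nat t \<sigma>) \<phi>"
proof -
  have "(\<lambda>i. substt (case_nat t Var) (up \<sigma> i)) = case_nat t \<sigma>"
  proof
    show "substt (case_nat t Var) (up \<sigma> i) = case_nat t \<sigma> i" for i
      by (cases i) (simp_all add: up_def substt_case_nat_shift del: One_nat_def)
  qed
  then show ?thesis
    by (simp add: inst_def subst_subst)
qed

lemma subst_inst: "subst \<sigma> (inst \<phi> t) = inst (subst (up \<sigma>) \<phi>) (substt \<sigma> t)"
proof -
  have "(\<lambda>i. substt \<sigma> (case_nat t Var i)) = case_nat (substt \<sigma> t) \<sigma>"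
    by (rule ext) (simp split: nat.split)
  then show ?thesis
    unfolding inst_subst_up by (simp add: inst_def subst_subst)
qed

lemma finite_fvt: "finite (fvt t)"
  by (induction t) auto

lemma finite_fv: "finite (fv \<phi>)"
proof (induction \<phi>)
  case (All \<phi>)
  then show ?case
    using finite_vimageI[of "fv \<phi>" Suc] by (simp add: vimage_def)
next
  case (Ex \<phi>)
  then show ?case
    using finite_vimageI[of "fv \<phi>" Suc] by (simp add: vimage_def)
qed (auto simp: finite_fvt)


section \<open>Henkin theories\<close>

lemma nd_weaken: "\<Gamma> \<turnstile> \<phi> \<Longrightarrow> \<Gamma> \<subseteq> \<Delta> \<Longrightarrow> \<Delta> \<turnstile> \<phi>"
proof (induction arbitrary: \<Delta> rule: nd.induct)
  case (nd_disjE \<Gamma> \<phi> \<psi> \<chi>)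
  then show ?case
    by (meson insert_mono nd.nd_disjE)
next
  case (nd_exE \<Gamma> \<phi> \<psi>)
  then show ?case
    by (meson image_mono insert_mono nd.nd_exE)
next
  case (nd_allI \<Gamma> \<phi>)
  then show ?case
    by (meson image_mono nd.nd_allI)
next
  case (nd_ccontr \<phi> \<Gamma>)
  then show ?case
    by (meson insert_mono nd.nd_ccontr)
next
  case (nd_impI \<phi> \<Gamma> \<psi>)
  then show ?case
    by (meson insert_mono nd.nd_impI)
qed (blast intro: nd.intros)+

text \<open>Allows free variables to be renamed in a whole derivation. This turns a fresh variable
  into the index 0 that the quantifier rules expect.\<close>

lemma nd_subst: "\<Gamma> \<turnstile> \<phi> \<Longrightarrow> subst \<sigma> ` \<Gamma> \<turnstile> subst \<sigma> \<phi>"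
proof (induction arbitrary: \<sigma> rule: nd.induct)
  case (nd_allI \<Gamma> \<phi>)
  have "subst (up \<sigma>) ` lift ` \<Gamma> = lift ` subst \<sigma> ` \<Gamma>"
    by (simp add: image_image subst_up_lift)
  then show ?case
    using nd_allI.IH[of "up \<sigma>"] nd.nd_allI by simp
next
  case (nd_exE \<Gamma> \<phi> \<psi>)
  have "subst (up \<sigma>) ` lift ` \<Gamma> = lift ` subst \<sigma> ` \<Gamma>"
    by (simp add: image_image subst_up_lift)
  then show ?case
    using nd_exE.IH(1)[of \<sigma>] nd_exE.IH(2)[of "up \<sigma>"] nd.nd_exE by (simp add: subst_up_lift)
next
  case (nd_allE \<Gamma> \<phi> t)
  then show ?case
    unfolding subst_inst by (metis nd.nd_allE subst.simps(7))
next
  case (nd_exI \<Gamma> \<phi> t)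
  then show ?case
    unfolding subst_inst by (metis nd.nd_exI subst.simps(8))
next
  case (nd_eq_subst \<Gamma> s t \<phi>)
  then show ?case
    unfolding subst_inst by (metis nd.nd_eq_subst subst.simps(2))
next
  case (nd_ccontr \<phi> \<Gamma>)
  then show ?case
    using nd.nd_ccontr by simp
next
  case (nd_disjE \<Gamma> \<phi> \<psi> \<chi>)
  then show ?case
    using nd.nd_disjE[of "subst \<sigma> ` \<Gamma>" "subst \<sigma> \<phi>" "subst \<sigma> \<psi>"] by simp
next
  case (nd_conjE1 \<Gamma> \<phi> \<psi>)
  then show ?case
    by (metis nd.nd_conjE1 subst.simps(4))
next
  case (nd_conjE2 \<Gamma> \<phi> \<psi>)
  then show ?case
    by (metis nd.nd_conjE2 subst.simps(4))
next
  case (nd_impE \<Gamma> \<phi> \<psi>)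
  then show ?case
    by (metis nd.nd_impE subst.simps(6))
qed (simp_all add: nd.nd_assm nd.nd_conjI nd.nd_disjI1 nd.nd_disjI2 nd.nd_impI nd.nd_eq_refl)

lemma nd_finite: "\<Gamma> \<turnstile> \<phi> \<Longrightarrow> \<exists>\<Delta> \<subseteq> \<Gamma>. finite \<Delta> \<and> (\<Delta> \<turnstile> \<phi>)"
proof (induction rule: nd.induct)
  case (nd_assm \<phi> \<Gamma>)
  then show ?case
    by (intro exI[of _ "{\<phi>}"]) (simp add: nd.nd_assm)
next
  case (nd_ccontr \<phi> \<Gamma>)
  then obtain \<Delta> where "\<Delta> \<subseteq> insert (Neg \<phi>) \<Gamma>" "finite \<Delta>" "\<Delta> \<turnstile> Fls"
    by blast
  then have "\<Delta> - {Neg \<phi>} \<turnstile> \<phi>"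
    by - (rule nd.nd_ccontr, erule nd_weaken, blast)
  then show ?case
    using \<open>\<Delta> \<subseteq> _\<close> \<open>finite \<Delta>\<close> by (intro exI[of _ "\<Delta> - {Neg \<phi>}"]) auto
next
  case (nd_impI \<phi> \<Gamma> \<psi>)
  then obtain \<Delta> where "\<Delta> \<subseteq> insert \<phi> \<Gamma>" "finite \<Delta>" "\<Delta> \<turnstile> \<psi>"
    by blast
  then have "\<Delta> - {\<phi>} \<turnstile> \<phi> \<^bold>\<longrightarrow> \<psi>"
    by - (rule nd.nd_impI, erule nd_weaken, blast)
  then show ?case
    using \<open>\<Delta> \<subseteq> _\<close> \<open>finite \<Delta>\<close> by (intro exI[of _ "\<Delta> - {\<phi>}"]) auto
next
  case (nd_disjE \<Gamma> \<phi> \<psi> \<chi>)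
  then obtain \<Delta>1 \<Delta>2 \<Delta>3 where *:
    "\<Delta>1 \<subseteq> \<Gamma>" "finite \<Delta>1" "\<Delta>1 \<turnstile> \<phi> \<^bold>\<or> \<psi>"
    "\<Delta>2 \<subseteq> insert \<phi> \<Gamma>" "finite \<Delta>2" "\<Delta>2 \<turnstile> \<chi>"
    "\<Delta>3 \<subseteq> insert \<psi> \<Gamma>" "finite \<Delta>3" "\<Delta>3 \<turnstile> \<chi>"
    by blast
  define \<Delta> where "\<Delta> = \<Delta>1 \<union> (\<Delta>2 - {\<phi>}) \<union> (\<Delta>3 - {\<psi>})"
  have "\<Delta> \<turnstile> \<phi> \<^bold>\<or> \<psi>" "insert \<phi> \<Delta> \<turnstile> \<chi>" "insert \<psi> \<Delta> \<turnstile> \<chi>"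
    by (rule nd_weaken[OF *(3)], use * in \<open>auto simp: \<Delta>_def\<close>)
      (rule nd_weaken[OF *(6)], use * in \<open>auto simp: \<Delta>_def\<close>,
       rule nd_weaken[OF *(9)], use * in \<open>auto simp: \<Delta>_def\<close>)
  then have "\<Delta> \<turnstile> \<chi>"
    by (rule nd.nd_disjE)
  then show ?case
    using * by (intro exI[of _ \<Delta>]) (auto simp: \<Delta>_def)
next
  case (nd_allI \<Gamma> \<phi>)
  then obtain \<Delta> where "\<Delta> \<subseteq> \<Gamma>" "finite \<Delta>" "lift ` \<Delta> \<turnstile> \<phi>"
    by (metis finite_subset_image)
  then show ?case
    by (meson nd.nd_allI)
next
  case (nd_exE \<Gamma> \<phi> \<psi>)
  then obtain \<Delta>1 \<Delta>2 where *: "\<Delta>1 \<subseteq> \<Gamma>" "finite \<Delta>1" "\<Delta>1 \<turnstile> Ex \<phi>"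
    "\<Delta>2 \<subseteq> insert \<phi> (lift ` \<Gamma>)" "finite \<Delta>2" "\<Delta>2 \<turnstile> lift \<psi>"
    by blast
  \<comment> \<open>Apart from the eigenformula, all assumptions used are lifts, so they form the
    image of a finite subset of the context.\<close>
  then have "\<Delta>2 - {\<phi>} \<subseteq> lift ` \<Gamma>" "finite (\<Delta>2 - {\<phi>})"
    by auto
  then obtain \<Delta>3 where \<Delta>3: "\<Delta>3 \<subseteq> \<Gamma>" "finite \<Delta>3" "\<Delta>2 - {\<phi>} = lift ` \<Delta>3"
    by (metis finite_subset_image)
  have "\<Delta>1 \<union> \<Delta>3 \<turnstile> Ex \<phi>" "insert \<phi> (lift ` (\<Delta>1 \<union> \<Delta>3)) \<turnstile> lift \<psi>"
    by (rule nd_weaken[OF *(3)], use \<Delta>3 in blast)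
      (rule nd_weaken[OF *(6)], use \<Delta>3 in blast)
  then have "\<Delta>1 \<union> \<Delta>3 \<turnstile> \<psi>"
    by (rule nd.nd_exE)
  then show ?case
    using * \<Delta>3 by (intro exI[of _ "\<Delta>1 \<union> \<Delta>3"]) auto
next
  case (nd_conjI \<Gamma> \<phi> \<psi>)
  then obtain \<Delta>1 \<Delta>2 where *: "\<Delta>1 \<subseteq> \<Gamma>" "finite \<Delta>1" "\<Delta>1 \<turnstile> \<phi>"
      "\<Delta>2 \<subseteq> \<Gamma>" "finite \<Delta>2" "\<Delta>2 \<turnstile> \<psi>"
    by blast
  then have "\<Delta>1 \<union> \<Delta>2 \<turnstile> \<phi> \<^bold>\<and> \<psi>"
    by (meson nd.nd_conjI nd_weaken sup_ge1 sup_ge2)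
  then show ?case
    using * by (intro exI[of _ "\<Delta>1 \<union> \<Delta>2"]) auto
next
  case (nd_impE \<Gamma> \<phi> \<psi>)
  then obtain \<Delta>1 \<Delta>2 where *: "\<Delta>1 \<subseteq> \<Gamma>" "finite \<Delta>1" "\<Delta>1 \<turnstile> \<phi> \<^bold>\<longrightarrow> \<psi>"
      "\<Delta>2 \<subseteq> \<Gamma>" "finite \<Delta>2" "\<Delta>2 \<turnstile> \<phi>"
    by blast
  then have "\<Delta>1 \<union> \<Delta>2 \<turnstile> \<psi>"
    by (meson nd.nd_impE nd_weaken sup_ge1 sup_ge2)
  then show ?case
    using * by (intro exI[of _ "\<Delta>1 \<union> \<Delta>2"]) auto
next
  case (nd_eq_subst \<Gamma> s t \<phi>)
  then obtain \<Delta>1 \<Delta>2 where *: "\<Delta>1 \<subseteq> \<Gamma>" "finite \<Delta>1" "\<Delta>1 \<turnstile> s \<^bold>= t"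
      "\<Delta>2 \<subseteq> \<Gamma>" "finite \<Delta>2" "\<Delta>2 \<turnstile> inst \<phi> s"
    by blast
  then have "\<Delta>1 \<union> \<Delta>2 \<turnstile> inst \<phi> t"
    by (meson nd.nd_eq_subst nd_weaken sup_ge1 sup_ge2)
  then show ?case
    using * by (intro exI[of _ "\<Delta>1 \<union> \<Delta>2"]) auto
qed (blast intro: nd.intros)+

lemma nd_cut: "\<Gamma> \<turnstile> \<phi> \<Longrightarrow> insert \<phi> \<Gamma> \<turnstile> \<psi> \<Longrightarrow> \<Gamma> \<turnstile> \<psi>"
  by (meson nd_impE nd_impI)

lemma nd_NegD: "\<Gamma> \<turnstile> Neg \<phi> \<Longrightarrow> insert \<phi> \<Gamma> \<turnstile> Fls"
  by (rule nd_impE[of _ \<phi>], erule nd_weaken, blast, rule nd_assm, blast)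

lemma nd_FlsE: "\<Gamma> \<turnstile> Fls \<Longrightarrow> \<Gamma> \<turnstile> \<phi>"
  by (rule nd_ccontr) (blast intro: nd_weaken)

text \<open>The renaming \<open>\<sigma>\<close> sends \<open>k\<close> to 0 and raises every other
  variable by one. As \<open>k\<close> is fresh, it acts on the context like \<open>lift\<close> and
  turns the instance at \<open>k\<close> back into \<open>\<phi>\<close>, so \<open>nd_exE\<close>
  applies.\<close>

lemma nd_exE_fresh:
  assumes "insert (inst \<phi> (Var k)) \<Gamma> \<turnstile> Fls" "\<Gamma> \<turnstile> Ex \<phi>"
    and fresh: "k \<notin> fv (Ex \<phi>)" "\<And>\<chi>. \<chi> \<in> \<Gamma> \<Longrightarrow> k \<notin> fv \<chi>"
  shows "\<Gamma> \<turnstile> Fls"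
proof -
  define \<sigma> where "\<sigma> i = (if i = k then Var 0 else Var (Suc i))" for i
  have "subst (\<lambda>i. substt \<sigma> (case_nat (Var k) Var i)) \<phi> = subst Var \<phi>"
    using fresh(1) by (intro subst_cong) (auto simp: \<sigma>_def split: nat.split)
  then have "subst \<sigma> (inst \<phi> (Var k)) = \<phi>"
    by (simp add: inst_def subst_subst)
  moreover have "subst \<sigma> \<chi> = lift \<chi>" if "\<chi> \<in> \<Gamma>" for \<chi>
    unfolding lift_def using fresh(2)[OF that] by (intro subst_cong) (auto simp: \<sigma>_def)
  ultimately have "subst \<sigma> ` insert (inst \<phi> (Var k)) \<Gamma> = insert \<phi> (lift ` \<Gamma>)"
    by auto
  then have "insert \<phi> (lift ` \<Gamma>) \<turnstile> lift Fls"
    using nd_subst[OF assms(1), of \<sigma>] by (simp add: lift_def)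
  then show ?thesis
    using assms(2) nd_exE by blast
qed

section \<open>Countability of the syntax and the Henkin construction\<close>

instance tm :: countable
  by countable_datatype

instance fm :: countable
  by countable_datatype

text \<open>Completion and witnessing are interleaved: formula number \<open>n\<close> is decided at
  stage \<open>n\<close>, and an existential formula receives its witness when it is adopted. Each
  stage adds finitely many free variables, so a fresh one always remains if only finitely many occur
  at the start.\<close>

primrec henkin :: "fm set \<Rightarrow> nat \<Rightarrow> fm set" where
  "henkin \<Gamma> 0 = \<Gamma>"
| "henkin \<Gamma> (Suc n) =
    (let \<phi> = from_nat n; \<Delta> = insert \<phi> (henkin \<Gamma> n) in
     if \<Delta> \<turnstile> Fls then henkin \<Gamma> n
     else case \<phi> of Ex \<psi> \<Rightarrow> insert (inst \<psi> (Var (SOME k. k \<notin> \<Union> (fv ` \<Delta>)))) \<Delta> | _ \<Rightarrow> \<Delta>)"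

lemma finite_fv_henkin: "finite (\<Union> (fv ` \<Gamma>)) \<Longrightarrow> finite (\<Union> (fv ` henkin \<Gamma> n))"
proof (induction n)
  case (Suc n)
  then show ?case
    by (auto simp: Let_def finite_fv simp del: fv.simps split: fm.split)
qed simp

lemma henkin_step: "henkin \<Gamma> n \<subseteq> henkin \<Gamma> (Suc n)"
  by (auto simp: Let_def split: fm.split)

lemma consistent_henkin:
  assumes "\<not> (\<Gamma> \<turnstile> Fls)" and fin: "finite (\<Union> (fv ` \<Gamma>))"
  shows "\<not> (henkin \<Gamma> n \<turnstile> Fls)"
proof (induction n)
  case (Suc n)
  define \<phi> where "\<phi> = (from_nat n :: fm)"
  define \<Delta> where "\<Delta> = insert \<phi> (henkin \<Gamma> n)"
  show ?case
  proof (cases "\<exists>\<psi>. \<phi> = Ex \<psi> \<and> \<not> (\<Delta> \<turnstile> Fls)")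
    case True
    then obtain \<psi> where \<psi>: "\<phi> = Ex \<psi>" "\<not> (\<Delta> \<turnstile> Fls)"
      by blast
    define k where "k = (SOME k. k \<notin> \<Union> (fv ` \<Delta>))"
    have "finite (\<Union> (fv ` \<Delta>))"
      using finite_fv_henkin[OF fin, of n] by (simp add: \<Delta>_def finite_fv)
    then have k: "k \<notin> \<Union> (fv ` \<Delta>)"
      unfolding k_def by (metis ex_new_if_finite infinite_UNIV_nat someI_ex)
    have "henkin \<Gamma> (Suc n) = insert (inst \<psi> (Var k)) \<Delta>"
      using \<psi> unfolding henkin.simps \<phi>_def[symmetric] Let_def \<Delta>_def[symmetric] k_def
      by simp
    moreover have "\<not> (insert (inst \<psi> (Var k)) \<Delta> \<turnstile> Fls)"
    proof
      assume "insert (inst \<psi> (Var k)) \<Delta> \<turnstile> Fls"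
      then have "\<Delta> \<turnstile> Fls"
        by (rule nd_exE_fresh) (use k \<psi>(1) nd_assm in \<open>auto simp: \<Delta>_def\<close>)
      with \<psi>(2) show False ..
    qed
    ultimately show ?thesis
      by simp
  next
    case False
    then have "henkin \<Gamma> (Suc n) = (if \<Delta> \<turnstile> Fls then henkin \<Gamma> n else \<Delta>)"
      unfolding henkin.simps \<phi>_def[symmetric] Let_def \<Delta>_def[symmetric]
      by (auto split: fm.split)
    then show ?thesis
      using Suc.IH by simp
  qed
qed (simp add: assms)

text \<open>Free variables serve as Henkin constants.\<close>

lemma ex_Henkin_theory:
  assumes "\<not> (\<Gamma> \<turnstile> Fls)" "finite (\<Union> (fv ` \<Gamma>))"
  obtains H where "\<Gamma> \<subseteq> H" "\<not> (H \<turnstile> Fls)"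
    "\<And>\<phi>. (H \<turnstile> \<phi>) \<or> (H \<turnstile> Neg \<phi>)" "\<And>\<phi>. H \<turnstile> Ex \<phi> \<Longrightarrow> \<exists>t. H \<turnstile> inst \<phi> t"
proof
  define H where "H = (\<Union>n. henkin \<Gamma> n)"
  show "\<Gamma> \<subseteq> H"
    unfolding H_def using henkin.simps(1) by blast
  have mono: "henkin \<Gamma> m \<subseteq> henkin \<Gamma> n" if "m \<le> n" for m n
    using lift_Suc_mono_le[of "henkin \<Gamma>", OF henkin_step that] .
  have stage: "\<exists>n. henkin \<Gamma> n \<turnstile> \<phi>" if H: "H \<turnstile> \<phi>" for \<phi>
  proof -
    obtain \<Delta> where \<Delta>: "\<Delta> \<subseteq> H" "finite \<Delta>" "\<Delta> \<turnstile> \<phi>"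
      using nd_finite[OF H] by blast
    have "\<exists>n. \<Delta> \<subseteq> henkin \<Gamma> n"
      using \<Delta>(2,1)
    proof (induction \<Delta>)
      case (insert \<psi> \<Delta>)
      then obtain m n where "\<Delta> \<subseteq> henkin \<Gamma> m" "\<psi> \<in> henkin \<Gamma> n"
        unfolding H_def by blast
      then have "insert \<psi> \<Delta> \<subseteq> henkin \<Gamma> (max m n)"
        using mono[of m "max m n"] mono[of n "max m n"] by auto
      then show ?case ..
    qed simp
    then show ?thesis
      using nd_weaken[OF \<Delta>(3)] by blast
  qed
  show consistent: "\<not> (H \<turnstile> Fls)"
    using stage consistent_henkin[OF assms] by blast
  have sub: "henkin \<Gamma> n \<subseteq> H" for n
    unfolding H_def by blast
  \<comment> \<open>A formula consistent with the union \<open>H\<close> is consistent with the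
    stage at which its number comes up, hence was adopted there.\<close>
  have added: "henkin \<Gamma> (Suc (to_nat \<phi>)) = (case \<phi> of
      Ex \<psi> \<Rightarrow> insert (inst \<psi> (Var (SOME k. k \<notin> \<Union> (fv ` insert \<phi> (henkin \<Gamma> (to_nat \<phi>))))))
        (insert \<phi> (henkin \<Gamma> (to_nat \<phi>)))
    | _ \<Rightarrow> insert \<phi> (henkin \<Gamma> (to_nat \<phi>)))"
    if "\<not> (insert \<phi> H \<turnstile> Fls)" for \<phi>
  proof -
    have "\<not> (insert \<phi> (henkin \<Gamma> (to_nat \<phi>)) \<turnstile> Fls)"
      using that nd_weaken[of _ Fls "insert \<phi> H"] sub by blast
    then show ?thesis
      by (simp add: Let_def)
  qed
  show "(H \<turnstile> \<phi>) \<or> (H \<turnstile> Neg \<phi>)" for \<phi>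
  proof (cases "insert \<phi> H \<turnstile> Fls")
    case False
    have "\<phi> \<in> henkin \<Gamma> (Suc (to_nat \<phi>))"
      unfolding added[OF False] by (simp split: fm.split)
    then show ?thesis
      using sub nd_assm by blast
  qed (simp add: nd_impI)
  show "\<exists>t. H \<turnstile> inst \<phi> t" if Ex: "H \<turnstile> Ex \<phi>" for \<phi>
  proof -
    have "\<not> (insert (Ex \<phi>) H \<turnstile> Fls)"
      using consistent Ex nd_cut by blast
    from added[OF this] obtain k where "inst \<phi> (Var k) \<in> henkin \<Gamma> (Suc (to_nat (Ex \<phi>)))"
      by auto
    then show ?thesis
      using sub nd_assm by blast
  qed
qed

section \<open>Structures and completeness\<close>

record 'a struct =
  zero_of :: 'a
  suc_of :: "'a \<Rightarrow> 'a"
  add_of :: "'a \<Rightarrow> 'a \<Rightarrow> 'a"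
  mul_of :: "'a \<Rightarrow> 'a \<Rightarrow> 'a"
  less_of :: "'a \<Rightarrow> 'a \<Rightarrow> bool"

primrec val :: "'a struct \<Rightarrow> (nat \<Rightarrow> 'a) \<Rightarrow> tm \<Rightarrow> 'a" where
  "val M e (Var i) = e i"
| "val M e Zr = zero_of M"
| "val M e (Sc t) = suc_of M (val M e t)"
| "val M e (s \<^bold>+ t) = add_of M (val M e s) (val M e t)"
| "val M e (s \<^bold>* t) = mul_of M (val M e s) (val M e t)"

primrec holds :: "'a struct \<Rightarrow> (nat \<Rightarrow> 'a) \<Rightarrow> fm \<Rightarrow> bool" where
  "holds M e Fls = False"
| "holds M e (s \<^bold>= t) = (val M e s = val M e t)"
| "holds M e (s \<^bold>< t) = less_of M (val M e s) (val M e t)"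
| "holds M e (\<phi> \<^bold>\<and> \<psi>) = (holds M e \<phi> \<and> holds M e \<psi>)"
| "holds M e (\<phi> \<^bold>\<or> \<psi>) = (holds M e \<phi> \<or> holds M e \<psi>)"
| "holds M e (\<phi> \<^bold>\<longrightarrow> \<psi>) = (holds M e \<phi> \<longrightarrow> holds M e \<psi>)"
| "holds M e (All \<phi>) = (\<forall>x. holds M (case_nat x e) \<phi>)"
| "holds M e (Ex \<phi>) = (\<exists>x. holds M (case_nat x e) \<phi>)"

lemma val_substt: "val M e (substt \<sigma> t) = val M (\<lambda>i. val M e (\<sigma> i)) t"
  by (induction t) auto

lemma val_shift [simp]: "val M e (shift k t) = val M (\<lambda>i. e (i + k)) t"
  by (simp add: shift_def val_substt)

lemma val_up: "(\<lambda>i. val M (case_nat x e) (up \<sigma> i)) = case_nat x (\<lambda>i. val M e (\<sigma> i))"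
  by (rule ext) (simp add: up_def split: nat.split)

lemma holds_subst: "holds M e (subst \<sigma> \<phi>) = holds M (\<lambda>i. val M e (\<sigma> i)) \<phi>"
  by (induction \<phi> arbitrary: e \<sigma>) (simp_all add: val_substt val_up)

lemma val_case_nat: "(\<lambda>i. val M e (case_nat t \<sigma> i)) = case_nat (val M e t) (\<lambda>i. val M e (\<sigma> i))"
  by (rule ext) (simp split: nat.split)

lemma holds_inst [simp]: "holds M e (inst \<phi> t) = holds M (case_nat (val M e t) e) \<phi>"
  by (simp add: inst_def holds_subst val_case_nat)

lemma holds_app [simp]:
  "holds M e (app k \<phi> t) = holds M (case_nat (val M e t) (\<lambda>i. e (i + k))) \<phi>"
  by (simp add: app_def holds_subst val_case_nat)

lemma val_cong: "(\<And>i. i \<in> fvt t \<Longrightarrow> e i = e' i) \<Longrightarrow> val M e t = val M e' t"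
  by (induction t) auto

lemma holds_cong: "(\<And>i. i \<in> fv \<phi> \<Longrightarrow> e i = e' i) \<Longrightarrow> holds M e \<phi> = holds M e' \<phi>"
proof (induction \<phi> arbitrary: e e')
  case (Eq s t)
  then show ?case
    using val_cong[of s e e'] val_cong[of t e e'] by simp
next
  case (Lt s t)
  then show ?case
    using val_cong[of s e e'] val_cong[of t e e'] by simp
next
  case (Conj \<phi> \<psi>)
  have "holds M e \<phi> = holds M e' \<phi>" "holds M e \<psi> = holds M e' \<psi>"
    by (rule Conj.IH; use Conj.prems in simp)+
  then show ?case by simp
next
  case (Disj \<phi> \<psi>)
  have "holds M e \<phi> = holds M e' \<phi>" "holds M e \<psi> = holds M e' \<psi>"
    by (rule Disj.IH; use Disj.prems in simp)+
  then show ?case by simp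
next
  case (Imp \<phi> \<psi>)
  have "holds M e \<phi> = holds M e' \<phi>" "holds M e \<psi> = holds M e' \<psi>"
    by (rule Imp.IH; use Imp.prems in simp)+
  then show ?case by simp
next
  case (All \<phi>)
  have "holds M (case_nat x e) \<phi> = holds M (case_nat x e') \<phi>" for x
    by (rule All.IH) (use All.prems in \<open>auto split: nat.split\<close>)
  then show ?case by simp
next
  case (Ex \<phi>)
  have "holds M (case_nat x e) \<phi> = holds M (case_nat x e') \<phi>" for x
    by (rule Ex.IH) (use Ex.prems in \<open>auto split: nat.split\<close>)
  then show ?case by simp
qed simp

section \<open>Equational reasoning in the calculus\<close>

text \<open>The calculus has only the Leibniz rule. Shifting protects the left side from the
  replacement, so that reflexivity at \<open>s\<close> is rewritten on the right side alone.\<close>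

lemma nd_eq_cong:
  assumes "\<Gamma> \<turnstile> s \<^bold>= t"
  shows "\<Gamma> \<turnstile> substt (case_nat s Var) u \<^bold>= substt (case_nat t Var) u"
proof -
  define \<phi> where "\<phi> = (shift 1 (substt (case_nat s Var) u) \<^bold>= u)"
  have inst: "inst \<phi> r = (substt (case_nat s Var) u \<^bold>= substt (case_nat r Var) u)" for r
    by (simp add: \<phi>_def inst_def substt_case_nat_shift del: One_nat_def)
  show ?thesis
    using nd_eq_subst[OF assms, of \<phi>] nd_eq_refl unfolding inst by blast
qed

lemma nd_eq_sym: "\<Gamma> \<turnstile> s \<^bold>= t \<Longrightarrow> \<Gamma> \<turnstile> t \<^bold>= s"
  using nd_eq_subst[of \<Gamma> s t "Var 0 \<^bold>= shift 1 s"] nd_eq_refl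
  by (simp add: inst_def substt_case_nat_shift del: One_nat_def)

lemma nd_eq_trans: "\<Gamma> \<turnstile> r \<^bold>= s \<Longrightarrow> \<Gamma> \<turnstile> s \<^bold>= t \<Longrightarrow> \<Gamma> \<turnstile> r \<^bold>= t"
  using nd_eq_subst[of \<Gamma> s t "shift 1 r \<^bold>= Var 0"]
  by (simp add: inst_def substt_case_nat_shift del: One_nat_def)

lemma nd_eq_Sc: "\<Gamma> \<turnstile> s \<^bold>= t \<Longrightarrow> \<Gamma> \<turnstile> Sc s \<^bold>= Sc t"
  using nd_eq_cong[of \<Gamma> s t "Sc (Var 0)"] by simp

lemma nd_eq_Add: "\<Gamma> \<turnstile> s \<^bold>= s' \<Longrightarrow> \<Gamma> \<turnstile> t \<^bold>= t' \<Longrightarrow> \<Gamma> \<turnstile> s \<^bold>+ t \<^bold>= s' \<^bold>+ t'"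
  using nd_eq_cong[of \<Gamma> s s' "Var 0 \<^bold>+ shift 1 t"] nd_eq_cong[of \<Gamma> t t' "shift 1 s' \<^bold>+ Var 0"]
  by (simp add: substt_case_nat_shift nd_eq_trans del: One_nat_def)

lemma nd_eq_Mul: "\<Gamma> \<turnstile> s \<^bold>= s' \<Longrightarrow> \<Gamma> \<turnstile> t \<^bold>= t' \<Longrightarrow> \<Gamma> \<turnstile> s \<^bold>* t \<^bold>= s' \<^bold>* t'"
  using nd_eq_cong[of \<Gamma> s s' "Var 0 \<^bold>* shift 1 t"] nd_eq_cong[of \<Gamma> t t' "shift 1 s' \<^bold>* Var 0"]
  by (simp add: substt_case_nat_shift nd_eq_trans del: One_nat_def)

lemma nd_Lt_cong:
  assumes "\<Gamma> \<turnstile> s \<^bold>= s'" "\<Gamma> \<turnstile> t \<^bold>= t'" "\<Gamma> \<turnstile> s \<^bold>< t"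
  shows "\<Gamma> \<turnstile> s' \<^bold>< t'"
proof -
  have "\<Gamma> \<turnstile> s' \<^bold>< t"
    using nd_eq_subst[OF assms(1), of "Var 0 \<^bold>< shift 1 t"] assms(3)
    by (simp add: inst_def substt_case_nat_shift del: One_nat_def)
  then show ?thesis
    using nd_eq_subst[OF assms(2), of "shift 1 s' \<^bold>< Var 0"]
    by (simp add: inst_def substt_case_nat_shift del: One_nat_def)
qed

text \<open>Makes the term model infinite, so that it can be transported to any prescribed countably
  infinite type.\<close>

lemma numerals_distinct:
  assumes basic: "basic_axioms \<subseteq> H" and "\<not> (H \<turnstile> Fls)"
    and "H \<turnstile> (Sc ^^ m) Zr \<^bold>= (Sc ^^ n) Zr"
  shows "m = n"
proof -
  have neq: "\<not> (H \<turnstile> Sc t \<^bold>= Zr)" for t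
  proof -
    have "H \<turnstile> All (Neg (Sc (Var 0) \<^bold>= Zr))"
      using basic by (intro nd_assm) (auto simp: basic_axioms_def)
    from nd_allE[OF this, of t] have "H \<turnstile> Neg (Sc t \<^bold>= Zr)"
      by (simp add: inst_def)
    then show ?thesis
      using assms(2) nd_impE by blast
  qed
  have inj: "H \<turnstile> s \<^bold>= t" if "H \<turnstile> Sc s \<^bold>= Sc t" for s t
  proof -
    have "H \<turnstile> All (All (Sc (Var 1) \<^bold>= Sc (Var 0) \<^bold>\<longrightarrow> Var 1 \<^bold>= Var 0))"
      using basic by (intro nd_assm) (auto simp: basic_axioms_def)
    from nd_allE[OF this, of s] have "H \<turnstile> All (Sc (shift 1 s) \<^bold>= Sc (Var 0) \<^bold>\<longrightarrow> shift 1 s \<^bold>= Var 0)"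
      by (simp add: inst_def up_def)
    from nd_allE[OF this, of t] have "H \<turnstile> Sc s \<^bold>= Sc t \<^bold>\<longrightarrow> s \<^bold>= t"
      by (simp add: inst_def substt_case_nat_shift del: One_nat_def)
    then show ?thesis
      using that nd_impE by blast
  qed
  show ?thesis
    using assms(3)
  proof (induction m arbitrary: n)
    case 0
    then show ?case
      using neq nd_eq_sym by (cases n) auto
  next
    case (Suc m)
    then show ?case
      using neq inj by (cases n) auto
  qed
qed

text \<open>The domain is a type fixed in advance. Terms modulo provable equality form a countable
  set, which the basic axioms force to be infinite; hence it is in bijection with \<open>'a\<close>.
  The bound on free variables is what the Henkin witnesses require.\<close>

theorem completeness:
  assumes inf: "infinite (UNIV :: 'a::countable set)"
    and basic: "basic_axioms \<subseteq> \<Gamma>" and fin: "finite (\<Union> (fv ` \<Gamma>))" and "\<not> (\<Gamma> \<turnstile> \<phi>)"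
  obtains M :: "'a::countable struct" and e where "\<And>\<psi>. \<psi> \<in> \<Gamma> \<Longrightarrow> holds M e \<psi>" "\<not> holds M e \<phi>"
proof -
  have "\<not> (insert (Neg \<phi>) \<Gamma> \<turnstile> Fls)" "finite (\<Union> (fv ` insert (Neg \<phi>) \<Gamma>))"
    using assms(4) nd_ccontr fin by (auto simp: finite_fv)
  then obtain H where sub: "insert (Neg \<phi>) \<Gamma> \<subseteq> H" and consistent: "\<not> (H \<turnstile> Fls)"
    and complete: "\<And>\<phi>. (H \<turnstile> \<phi>) \<or> (H \<turnstile> Neg \<phi>)"
    and witness: "\<And>\<phi>. H \<turnstile> Ex \<phi> \<Longrightarrow> \<exists>t. H \<turnstile> inst \<phi> t"
    by (rule ex_Henkin_theory) blast
  define R where "R = {(s, t). H \<turnstile> s \<^bold>= t}"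
  have equiv: "equiv UNIV R"
  proof (rule equivI)
    show "refl R"
      by (simp add: refl_on_def R_def nd_eq_refl)
    show "sym R"
      unfolding R_def using nd_eq_sym by (intro symI) blast
    show "trans R"
      unfolding R_def using nd_eq_trans by (intro transI) blast
  qed simp
  have "inj (\<lambda>n. R `` {(Sc ^^ n) Zr})"
  proof (rule injI)
    fix m n assume "R `` {(Sc ^^ m) Zr} = R `` {(Sc ^^ n) Zr}"
    then have "((Sc ^^ m) Zr, (Sc ^^ n) Zr) \<in> R"
      by (rule eq_equiv_class[OF _ equiv]) simp
    then have "H \<turnstile> (Sc ^^ m) Zr \<^bold>= (Sc ^^ n) Zr"
      unfolding R_def by simp
    moreover have "basic_axioms \<subseteq> H"
      using basic sub by blast
    ultimately show "m = n"
      using numerals_distinct[OF _ consistent] by blast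
  qed
  moreover have "range (\<lambda>n. R `` {(Sc ^^ n) Zr}) \<subseteq> UNIV // R"
    by (auto intro: quotientI)
  ultimately have "infinite (UNIV // R)"
    using finite_subset range_inj_infinite by blast
  moreover have "countable (UNIV // R)"
    unfolding quotient_def by auto
  ultimately have "bij_betw (from_nat_into (UNIV :: 'a set) \<circ> to_nat_on (UNIV // R)) (UNIV // R) UNIV"
    using inf by (intro bij_betw_trans[OF to_nat_on_infinite] bij_betw_from_nat_into) auto
  then obtain f :: "tm set \<Rightarrow> 'a" where f: "bij_betw f (UNIV // R) UNIV"
    by blast
  define g where "g t = f (R `` {t})" for t
  have g_eq: "g s = g t \<longleftrightarrow> (H \<turnstile> s \<^bold>= t)" for s t
  proof -
    have "g s = g t \<longleftrightarrow> R `` {s} = R `` {t}"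
      unfolding g_def using inj_on_eq_iff[OF bij_betw_imp_inj_on[OF f]] by (simp add: quotientI)
    then show ?thesis
      using eq_equiv_class_iff[OF equiv] by (simp add: R_def)
  qed
  have "\<exists>t. g t = x" for x
  proof -
    have "x \<in> f ` (UNIV // R)"
      using f by (simp add: bij_betw_def)
    then show ?thesis
      unfolding g_def by (auto simp: quotient_def)
  qed
  then obtain r where r: "g (r x) = x" for x
    by metis
  \<comment> \<open>The operations act on chosen representatives; provable congruence makes the
    choice immaterial.\<close>
  define M where "M = \<lparr>zero_of = g Zr, suc_of = \<lambda>x. g (Sc (r x)),
    add_of = \<lambda>x y. g (r x \<^bold>+ r y), mul_of = \<lambda>x y. g (r x \<^bold>* r y),
    less_of = \<lambda>x y. H \<turnstile> r x \<^bold>< r y\<rparr>"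
  have rg: "H \<turnstile> r (g t) \<^bold>= t" "H \<turnstile> t \<^bold>= r (g t)" for t
    using r g_eq by metis+
  have val: "val M (\<lambda>i. g (\<sigma> i)) t = g (substt \<sigma> t)" for \<sigma> t
    by (induction t) (simp_all add: M_def g_eq nd_eq_Sc nd_eq_Add nd_eq_Mul rg)
  have less: "less_of M (g s) (g t) \<longleftrightarrow> (H \<turnstile> s \<^bold>< t)" for s t
    using nd_Lt_cong[OF rg(1) rg(1), of s t] nd_Lt_cong[OF rg(2) rg(2), of s t]
    by (auto simp: M_def)
  have env: "(\<lambda>i. g (case_nat t \<sigma> i)) = case_nat (g t) (\<lambda>i. g (\<sigma> i))" for t \<sigma>
    by (rule ext) (simp split: nat.split)
  have neg: "(H \<turnstile> Neg \<phi>) \<longleftrightarrow> \<not> (H \<turnstile> \<phi>)" for \<phi>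
    using complete consistent nd_impE by blast
  have imp: "(H \<turnstile> \<phi> \<^bold>\<longrightarrow> \<psi>) \<longleftrightarrow> ((H \<turnstile> \<phi>) \<longrightarrow> (H \<turnstile> \<psi>))" for \<phi> \<psi>
  proof
    assume *: "(H \<turnstile> \<phi>) \<longrightarrow> (H \<turnstile> \<psi>)"
    show "H \<turnstile> \<phi> \<^bold>\<longrightarrow> \<psi>"
    proof (cases "H \<turnstile> \<phi>")
      case True
      then show ?thesis
        using * by (meson nd_impI nd_weaken subset_insertI)
    next
      case False
      then have "insert \<phi> H \<turnstile> Fls"
        using neg nd_NegD by blast
      then show ?thesis
        by (rule nd_impI[OF nd_FlsE])
    qed
  qed (use nd_impE in blast)
  have disj: "(H \<turnstile> \<phi> \<^bold>\<or> \<psi>) \<longleftrightarrow> (H \<turnstile> \<phi>) \<or> (H \<turnstile> \<psi>)" for \<phi> \<psi>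
  proof
    assume *: "H \<turnstile> \<phi> \<^bold>\<or> \<psi>"
    show "(H \<turnstile> \<phi>) \<or> (H \<turnstile> \<psi>)"
    proof (rule ccontr)
      assume "\<not> ((H \<turnstile> \<phi>) \<or> (H \<turnstile> \<psi>))"
      then have "H \<turnstile> Neg \<phi>" "H \<turnstile> Neg \<psi>"
        using neg by auto
      then have "insert \<phi> H \<turnstile> Fls" "insert \<psi> H \<turnstile> Fls"
        using nd_NegD by blast+
      with * consistent show False
        using nd_disjE by blast
    qed
  qed (use nd_disjI1 nd_disjI2 in blast)
  have ex: "(H \<turnstile> Ex (subst (up \<sigma>) \<phi>)) \<longleftrightarrow> (\<exists>t. H \<turnstile> subst (case_nat t \<sigma>) \<phi>)" for \<phi> \<sigma>
    unfolding inst_subst_up[symmetric] using witness nd_exI by blast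
  have all: "(H \<turnstile> All \<phi>) \<longleftrightarrow> (\<forall>t. H \<turnstile> inst \<phi> t)" for \<phi>
  proof
    assume *: "\<forall>t. H \<turnstile> inst \<phi> t"
    show "H \<turnstile> All \<phi>"
    proof (rule ccontr)
      assume no: "\<not> (H \<turnstile> All \<phi>)"
      have "\<not> (H \<turnstile> Ex (Neg \<phi>))"
        using witness[of "Neg \<phi>"] * neg by (auto simp: inst_def)
      then have H: "H \<turnstile> Neg (Ex (Neg \<phi>))"
        using neg by blast
      define \<Delta> where "\<Delta> = insert (Neg \<phi>) (lift ` H)"
      \<comment> \<open>After lifting, index 0 is the eigenvariable of \<open>nd_allI\<close>, and
        \<open>\<phi>\<close> is the instance at \<open>Var 0\<close> of its own lifted body. Thus
        \<open>Neg \<phi>\<close> contradicts the lifted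
        \<open>Neg (Ex (Neg \<phi>))\<close>.\<close>
      have "subst (\<lambda>i. substt (case_nat (Var 0) Var) (up (\<lambda>i. Var (Suc i)) i)) \<phi> = subst Var \<phi>"
        by (rule subst_cong) (auto simp: up_def shift_def split: nat.split)
      then have inst: "inst (subst (up (\<lambda>i. Var (Suc i))) \<phi>) (Var 0) = \<phi>"
        by (simp add: inst_def subst_subst)
      have "\<Delta> \<turnstile> Ex (Neg (subst (up (\<lambda>i. Var (Suc i))) \<phi>))"
        by (rule nd_exI[of _ _ "Var 0"], rule nd_assm)
          (use inst in \<open>simp add: \<Delta>_def inst_def\<close>)
      moreover have "\<Delta> \<turnstile> Neg (Ex (Neg (subst (up (\<lambda>i. Var (Suc i))) \<phi>)))"
        using nd_weaken[OF nd_subst[OF H, of "\<lambda>i. Var (Suc i)"], of \<Delta>]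
        by (auto simp: \<Delta>_def lift_def)
      ultimately have "\<Delta> \<turnstile> Fls"
        using nd_impE by blast
      then have "lift ` H \<turnstile> \<phi>"
        unfolding \<Delta>_def by (rule nd_ccontr)
      then show False
        using no nd_allI by blast
    qed
  qed (use nd_allE in blast)
  \<comment> \<open>Generality in \<open>\<sigma>\<close> serves the quantifiers: every element of
    the domain is some \<open>g t\<close>, so extending the environment by it amounts to extending
    \<open>\<sigma>\<close> by \<open>t\<close>.\<close>
  have truth: "holds M (\<lambda>i. g (\<sigma> i)) \<phi> \<longleftrightarrow> (H \<turnstile> subst \<sigma> \<phi>)" for \<sigma> \<phi>
  proof (induction \<phi> arbitrary: \<sigma>)
    case (Conj \<phi> \<psi>)
    then show ?case
      by (auto intro: nd_conjI nd_conjE1 nd_conjE2)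
  next
    case (All \<phi>)
    have "holds M (\<lambda>i. g (\<sigma> i)) (All \<phi>) \<longleftrightarrow> (\<forall>t. holds M (case_nat (g t) (\<lambda>i. g (\<sigma> i))) \<phi>)"
      using r by (auto, metis)
    also have "\<dots> \<longleftrightarrow> (\<forall>t. H \<turnstile> subst (case_nat t \<sigma>) \<phi>)"
      unfolding env[symmetric] All.IH ..
    finally show ?case
      by (simp add: all inst_subst_up)
  next
    case (Ex \<phi>)
    have "holds M (\<lambda>i. g (\<sigma> i)) (Ex \<phi>) \<longleftrightarrow> (\<exists>t. holds M (case_nat (g t) (\<lambda>i. g (\<sigma> i))) \<phi>)"
      using r by (auto, metis)
    also have "\<dots> \<longleftrightarrow> (\<exists>t. H \<turnstile> subst (case_nat t \<sigma>) \<phi>)"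
      unfolding env[symmetric] Ex.IH ..
    finally show ?case
      by (simp add: ex)
  qed (simp_all add: consistent val g_eq less imp disj)
  have "holds M (\<lambda>i. g (Var i)) \<psi> \<longleftrightarrow> (H \<turnstile> \<psi>)" for \<psi>
    using truth[of Var \<psi>] by simp
  then show ?thesis
    using that[of M "\<lambda>i. g (Var i)"] sub neg nd_assm by blast
qed

section \<open>A countermodel as a type\<close>

lemma fv_Alls: "fv ((All ^^ n) \<phi>) = {i. i + n \<in> fv \<phi>}"
  by (induction n arbitrary: \<phi>) auto

lemma ex_closed_Alls: "\<exists>n. fv ((All ^^ n) \<phi>) = {}"
proof -
  obtain n where "fv \<phi> \<subseteq> {..<n}"
    using finite_fv[of \<phi>] unfolding finite_nat_set_iff_bounded by blast
  then have "fv ((All ^^ n) \<phi>) = {}"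
    unfolding fv_Alls by auto
  then show ?thesis ..
qed

lemma holds_All_all: "(\<forall>e. holds M e (All \<phi>)) \<longleftrightarrow> (\<forall>e. holds M e \<phi>)"
proof
  assume *: "\<forall>e. holds M e (All \<phi>)"
  show "\<forall>e. holds M e \<phi>"
  proof
    fix e
    have "holds M (case_nat (e 0) (\<lambda>i. e (Suc i))) \<phi>"
      using * by simp
    also have "case_nat (e 0) (\<lambda>i. e (Suc i)) = e"
      by (rule ext) (simp split: nat.split)
    finally show "holds M e \<phi>" .
  qed
qed simp

lemma holds_Alls_all: "(\<forall>e. holds M e ((All ^^ n) \<phi>)) \<longleftrightarrow> (\<forall>e. holds M e \<phi>)"
  by (induction n) (simp_all add: holds_All_all del: holds.simps)

lemma closed_PA: "\<phi> \<in> PA \<Longrightarrow> fv \<phi> = {}"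
  unfolding PA_def basic_axioms_def by auto

lemma holds_closed: "fv \<phi> = {} \<Longrightarrow> holds M e \<phi> \<Longrightarrow> holds M e' \<phi>"
  using holds_cong[of \<phi> e e'] by simp

text \<open>A fresh copy of the natural numbers: the type classes are to be instantiated with the
  operations of an arbitrary model, whereas \<open>nat\<close> already carries the standard
  ones.\<close>

datatype model = Element nat

instance model :: countable
  by countable_datatype

lemma infinite_model: "infinite (UNIV :: model set)"
proof -
  have "infinite (range Element)"
    by (rule range_inj_infinite) (simp add: inj_def)
  then show ?thesis
    by (rule infinite_super[OF subset_UNIV])
qed

definition countermodel :: "(nat \<Rightarrow> model) \<Rightarrow> model struct \<Rightarrow> bool" where
  "countermodel e M \<longleftrightarrow> (\<forall>\<phi> \<in> PA \<union> K_Sigma1_minus. holds M e \<phi>) \<and>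
    (\<exists>\<chi> \<in> TI_Pi1_minus. \<not> holds M e \<chi>)"

text \<open>
  The theorem amounts to the absence of countermodels. For a contradiction, we turn an alleged
  countermodel into a type, so that its arithmetic becomes available through type classes; if
  there is none, any model of \<open>PA\<close> serves as a dummy.
\<close>

definition the_model :: "model struct" where
  "the_model = (SOME M. (\<forall>\<phi>\<in>PA. \<forall>e. holds M e \<phi>) \<and>
    ((\<exists>e M'. countermodel e M') \<longrightarrow> (\<exists>e. countermodel e M)))"

lemma the_model: "(\<forall>\<phi>\<in>PA. \<forall>e. holds the_model e \<phi>) \<and>
    ((\<exists>e M'. countermodel e M') \<longrightarrow> (\<exists>e. countermodel e the_model))"
  unfolding the_model_def
proof (rule someI_ex)
  show "\<exists>M. (\<forall>\<phi>\<in>PA. \<forall>e. holds M e \<phi>) \<and>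
    ((\<exists>e M'. countermodel e M') \<longrightarrow> (\<exists>e. countermodel e M))"
  proof (cases "\<exists>e M. countermodel e M")
    case True
    then show ?thesis
      unfolding countermodel_def using holds_closed closed_PA by blast
  next
    case False
    \<comment> \<open>The standard model shows that \<open>PA\<close> is consistent, so the dummy
      model exists.\<close>
    have "\<not> (PA \<turnstile> Fls)"
      using soundness[of PA Fls "\<lambda>_. 0"] sat_PA by auto
    moreover have "finite (\<Union> (fv ` PA))" "basic_axioms \<subseteq> PA"
      using closed_PA by (auto simp: PA_def)
    ultimately obtain M :: "model struct" and e where "\<And>\<psi>. \<psi> \<in> PA \<Longrightarrow> holds M e \<psi>"
      using completeness[OF infinite_model] by metis
    then show ?thesis
      using False holds_closed closed_PA by blast
  qed
qed

section \<open>Arithmetic on the elements of the model\<close>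

instantiation model :: "{zero, one, plus, times, minus, ord}"
begin

definition "0 = zero_of the_model"
definition "1 = suc_of the_model 0"
definition "x + y = add_of the_model x y" for x y :: model
definition "x * y = mul_of the_model x y" for x y :: model
definition "x < y \<longleftrightarrow> less_of the_model x y" for x y :: model
definition "x \<le> y \<longleftrightarrow> x < y \<or> x = y" for x y :: model
text \<open>Truncated subtraction, as the class of cancellative semirings prescribes it;
  cancellation makes the chosen \<open>z\<close> unique.\<close>

definition "x - y = (if y \<le> x then SOME z. z + y = x else 0)" for x y :: model

instance ..

end

abbreviation value_at :: "(nat \<Rightarrow> model) \<Rightarrow> tm \<Rightarrow> model" where
  "value_at \<equiv> val the_model"

abbreviation true_at :: "(nat \<Rightarrow> model) \<Rightarrow> fm \<Rightarrow> bool" where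
  "true_at \<equiv> holds the_model"

lemma the_model_ops [simp]:
  "zero_of the_model = 0" "add_of the_model x y = x + y" "mul_of the_model x y = x * y"
  "less_of the_model x y \<longleftrightarrow> x < y"
  by (simp_all add: zero_model_def plus_model_def times_model_def less_model_def)

lemma basic_axioms_true: "\<phi> \<in> basic_axioms \<Longrightarrow> true_at e \<phi>"
  using the_model by (auto simp: PA_def)

text \<open>\<open>PA\<close> contains only universal closures. Truth of a closure in all
  environments is truth of its body in all environments, which yields induction with arbitrary
  parameters.\<close>

lemma induction_true: "true_at e (induction \<phi>)"
proof -
  obtain n where "fv ((All ^^ n) (induction \<phi>)) = {}"
    using ex_closed_Alls by blast
  then have "(All ^^ n) (induction \<phi>) \<in> PA"
    unfolding PA_def by blast
  then have "\<forall>e. true_at e ((All ^^ n) (induction \<phi>))"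
    using the_model by blast
  then show ?thesis
    unfolding holds_Alls_all by blast
qed

lemma add_zero_model: "x + 0 = (x :: model)"
  using basic_axioms_true[of "All (Var 0 \<^bold>+ Zr \<^bold>= Var 0)"] by (simp add: basic_axioms_def)

lemma suc_model [simp]: "suc_of the_model x = x + 1"
  using basic_axioms_true[of "All (All (Var 1 \<^bold>+ Sc (Var 0) \<^bold>= Sc (Var 1 \<^bold>+ Var 0)))"]
  by (simp add: basic_axioms_def one_model_def add_zero_model)

lemma peano_model:
  fixes x y :: model
  shows "x + 1 \<noteq> 0" "x + 1 = y + 1 \<longleftrightarrow> x = y" "x + (y + 1) = (x + y) + 1"
    "x * 0 = 0" "x * (y + 1) = x * y + x" "x < y \<longleftrightarrow> (\<exists>z. x + (z + 1) = y)"
proof -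
  have "true_at (\<lambda>_. 0) \<phi>" if "\<phi> \<in> basic_axioms" for \<phi>
    using that by (rule basic_axioms_true)
  note * = this[unfolded basic_axioms_def]
  have "\<forall>x::model. x + 1 \<noteq> 0"
    using *[of "All (Neg (Sc (Var 0) \<^bold>= Zr))"] by simp
  then show "x + 1 \<noteq> 0" ..
  have "\<forall>x y::model. x + 1 = y + 1 \<longrightarrow> x = y"
    using *[of "All (All (Sc (Var 1) \<^bold>= Sc (Var 0) \<^bold>\<longrightarrow> Var 1 \<^bold>= Var 0))"] by simp
  then show "x + 1 = y + 1 \<longleftrightarrow> x = y"
    by metis
  have "\<forall>x y::model. x + (y + 1) = (x + y) + 1"
    using *[of "All (All (Var 1 \<^bold>+ Sc (Var 0) \<^bold>= Sc (Var 1 \<^bold>+ Var 0)))"] by simp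
  then show "x + (y + 1) = (x + y) + 1"
    by (rule spec2)
  have "\<forall>x::model. x * 0 = 0"
    using *[of "All (Var 0 \<^bold>* Zr \<^bold>= Zr)"] by simp
  then show "x * 0 = 0" ..
  have "\<forall>x y::model. x * (y + 1) = x * y + x"
    using *[of "All (All (Var 1 \<^bold>* Sc (Var 0) \<^bold>= Var 1 \<^bold>* Var 0 \<^bold>+ Var 1))"] by simp
  then show "x * (y + 1) = x * y + x"
    by (rule spec2)
  have "\<forall>x y::model. x < y \<longleftrightarrow> (\<exists>z. x + (z + 1) = y)"
    using *[of "All (All (Iff (Var 1 \<^bold>< Var 0) (Ex (Var 2 \<^bold>+ Sc (Var 0) \<^bold>= Var 1))))"]
    by (auto simp: eval_nat_numeral)
  then show "x < y \<longleftrightarrow> (\<exists>z. x + (z + 1) = y)"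
    by (rule spec2)
qed

text \<open>
  The definable relations (with parameters), given as sets of environments so that they are
  closed under quantification.
\<close>

inductive dft :: "((nat \<Rightarrow> model) \<Rightarrow> model) \<Rightarrow> bool" where
  dft_const: "dft (\<lambda>e. c)"
| dft_var: "dft (\<lambda>e. e i)"
| dft_add: "dft f \<Longrightarrow> dft g \<Longrightarrow> dft (\<lambda>e. f e + g e)"
| dft_mult: "dft f \<Longrightarrow> dft g \<Longrightarrow> dft (\<lambda>e. f e * g e)"

inductive dfr :: "((nat \<Rightarrow> model) \<Rightarrow> bool) \<Rightarrow> bool" where
  dfr_const: "dfr (\<lambda>e. b)"
| dfr_eq: "dft f \<Longrightarrow> dft g \<Longrightarrow> dfr (\<lambda>e. f e = g e)"
| dfr_less: "dft f \<Longrightarrow> dft g \<Longrightarrow> dfr (\<lambda>e. f e < g e)"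
| dfr_conj: "dfr P \<Longrightarrow> dfr Q \<Longrightarrow> dfr (\<lambda>e. P e \<and> Q e)"
| dfr_not: "dfr P \<Longrightarrow> dfr (\<lambda>e. \<not> P e)"
| dfr_case_nat: "dfr P \<Longrightarrow> dfr (\<lambda>e. \<forall>x. P (case_nat x e))"

text \<open>The bound variable becomes index 0 and the environment its tail. In this form the rule
  decomposes an ordinary HOL statement, and definability is read off its syntax; fixed elements of
  the model enter as constants, that is, as parameters.\<close>

lemma dfr_all: "dfr (\<lambda>e. P (e 0) (\<lambda>i. e (Suc i))) \<Longrightarrow> dfr (\<lambda>e. \<forall>x. P x e)"
  by (drule dfr_case_nat) (simp only: nat.case)

lemma dfr_disj: "dfr P \<Longrightarrow> dfr Q \<Longrightarrow> dfr (\<lambda>e. P e \<or> Q e)"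
  using dfr_not[OF dfr_conj[OF dfr_not dfr_not], of P Q] by (simp only: de_Morgan_conj not_not)

lemma dfr_imp: "dfr P \<Longrightarrow> dfr Q \<Longrightarrow> dfr (\<lambda>e. P e \<longrightarrow> Q e)"
  unfolding imp_conv_disj by (rule dfr_disj[OF dfr_not])

lemma dfr_iff: "dfr P \<Longrightarrow> dfr Q \<Longrightarrow> dfr (\<lambda>e. P e \<longleftrightarrow> Q e)"
  unfolding iff_conv_conj_imp by (rule dfr_conj[OF dfr_imp dfr_imp])

lemma dfr_ex: "dfr (\<lambda>e. P (e 0) (\<lambda>i. e (Suc i))) \<Longrightarrow> dfr (\<lambda>e. \<exists>x. P x e)"
  using dfr_not[OF dfr_all[OF dfr_not, of P]] by (simp only: not_all not_not)

lemma dfr_le: "dft f \<Longrightarrow> dft g \<Longrightarrow> dfr (\<lambda>e. f e \<le> g e)"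
  unfolding less_eq_model_def by (intro dfr_disj dfr_less dfr_eq)

lemmas dfr_intros = dfr_const dfr_eq dfr_less dfr_le dfr_conj dfr_disj dfr_imp dfr_iff dfr_not
  dfr_all dfr_ex dft_const dft_var dft_add dft_mult

section \<open>From definable relations to formulas with parameters\<close>

definition params :: "model list \<Rightarrow> (nat \<Rightarrow> model) \<Rightarrow> nat \<Rightarrow> model" where
  "params ps e i = (if i < length ps then ps ! i else e (i - length ps))"

text \<open>For merging two parameter lists: in the left formula the ordinary variables jump over
  the additional parameters, in the right formula all indices jump over \<open>ps\<close>.\<close>

lemma params_append_left:
  "(\<lambda>i. params (ps @ qs) e (if i < length ps then i else i + length qs)) = params ps e"
  by (rule ext) (auto simp: params_def nth_append)

lemma params_append_right: "(\<lambda>i. params (ps @ qs) e (i + length ps)) = params qs e"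
  by (rule ext) (auto simp: params_def nth_append)

lemma dft_tm: "dft f \<Longrightarrow> \<exists>t ps. \<forall>e. f e = value_at (params ps e) t"
proof (induction rule: dft.induct)
  case (dft_const c)
  show ?case
    by (intro exI[of _ "Var 0"] exI[of _ "[c]"]) (simp add: params_def)
next
  case (dft_var i)
  show ?case
    by (intro exI[of _ "Var i"] exI[of _ "[]"]) (simp add: params_def)
next
  case (dft_add f g)
  then obtain s t ps qs where *: "\<forall>e. f e = value_at (params ps e) s" "\<forall>e. g e = value_at (params qs e) t"
    by blast
  show ?case
    by (intro exI[of _ "substt (\<lambda>i. Var (if i < length ps then i else i + length qs)) s \<^bold>+
          substt (\<lambda>i. Var (i + length ps)) t"] exI[of _ "ps @ qs"])
      (simp only: * val.simps val_substt params_append_left params_append_right the_model_ops simp_thms)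
next
  case (dft_mult f g)
  then obtain s t ps qs where *: "\<forall>e. f e = value_at (params ps e) s" "\<forall>e. g e = value_at (params qs e) t"
    by blast
  show ?case
    by (intro exI[of _ "substt (\<lambda>i. Var (if i < length ps then i else i + length qs)) s \<^bold>*
          substt (\<lambda>i. Var (i + length ps)) t"] exI[of _ "ps @ qs"])
      (simp only: * val.simps val_substt params_append_left params_append_right the_model_ops simp_thms)
qed

lemma dft_tm2:
  assumes "dft f" "dft g"
  obtains s t ps where "\<And>e. f e = value_at (params ps e) s" "\<And>e. g e = value_at (params ps e) t"
proof -
  obtain s t ps qs where *: "\<forall>e. f e = value_at (params ps e) s" "\<forall>e. g e = value_at (params qs e) t"
    using assms dft_tm by metis
  show ?thesis
    by (rule that[of "ps @ qs" "substt (\<lambda>i. Var (if i < length ps then i else i + length qs)) s"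
          "substt (\<lambda>i. Var (i + length ps)) t"])
      (simp_all only: * val.simps val_substt params_append_left params_append_right)
qed

lemma dfr_fm: "dfr P \<Longrightarrow> \<exists>\<phi> ps. \<forall>e. P e \<longleftrightarrow> true_at (params ps e) \<phi>"
proof (induction rule: dfr.induct)
  case (dfr_const b)
  show ?case
    by (intro exI[of _ "if b then Fls \<^bold>\<longrightarrow> Fls else Fls"] exI[of _ "[]"]) simp
next
  case (dfr_eq f g)
  then obtain s t ps where "\<And>e. f e = value_at (params ps e) s" "\<And>e. g e = value_at (params ps e) t"
    using dft_tm2 by metis
  then show ?case
    by (intro exI[of _ "s \<^bold>= t"] exI[of _ ps]) simp
next
  case (dfr_less f g)
  then obtain s t ps where "\<And>e. f e = value_at (params ps e) s" "\<And>e. g e = value_at (params ps e) t"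
    using dft_tm2 by metis
  then show ?case
    by (intro exI[of _ "s \<^bold>< t"] exI[of _ ps]) simp
next
  case (dfr_conj P Q)
  then obtain \<phi> \<psi> ps qs where *: "\<forall>e. P e \<longleftrightarrow> true_at (params ps e) \<phi>" "\<forall>e. Q e \<longleftrightarrow> true_at (params qs e) \<psi>"
    by blast
  show ?case
    by (intro exI[of _ "subst (\<lambda>i. Var (if i < length ps then i else i + length qs)) \<phi> \<^bold>\<and>
          subst (\<lambda>i. Var (i + length ps)) \<psi>"] exI[of _ "ps @ qs"])
      (simp only: * val.simps holds.simps holds_subst params_append_left params_append_right simp_thms)
next
  case (dfr_not P)
  then obtain \<phi> ps where "\<forall>e. P e \<longleftrightarrow> true_at (params ps e) \<phi>"
    by blast
  then show ?case
    by (intro exI[of _ "Neg \<phi>"] exI[of _ ps]) simp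
next
  case (dfr_case_nat P)
  then obtain \<phi> ps where *: "\<forall>e. P e \<longleftrightarrow> true_at (params ps e) \<phi>"
    by blast
  define n where "n = length ps"
  \<comment> \<open>The quantified variable has index 0 below \<open>All\<close>, but index
    \<open>n\<close>, behind the parameters, in the formula given by the induction hypothesis. The
    renaming rotates the first \<open>n + 1\<close> indices accordingly.\<close>
  have "(\<lambda>i. value_at (case_nat x (params ps e)) (Var (if i < n then Suc i else if i = n then 0 else i)))
      = params ps (case_nat x e)" for x e
    by (rule ext) (auto simp: params_def n_def Suc_diff_le not_less split: nat.split)
  then show ?case
    by (intro exI[of _ "All (subst (\<lambda>i. Var (if i < n then Suc i else if i = n then 0 else i)) \<phi>)"]
        exI[of _ ps]) (simp add: * holds_subst del: val.simps)
qed

lemma model_induct [case_names dfr 0 step]: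
  assumes "dfr (\<lambda>e. P (e 0))" and "P 0" and step: "\<And>x. P x \<Longrightarrow> P (x + 1)"
  shows "P x"
proof -
  obtain \<phi> ps where \<phi>: "\<forall>e. P (e 0) \<longleftrightarrow> true_at (params ps e) \<phi>"
    using dfr_fm[OF assms(1)] by blast
  \<comment> \<open>As \<open>P\<close> reads only \<open>e 0\<close>, every index beyond the
    parameters may be identified with the induction variable.\<close>
  define \<phi>' where "\<phi>' = subst (\<lambda>i. Var (if i < length ps then Suc i else 0)) \<phi>"
  have "true_at (case_nat x (params ps (\<lambda>_. 0))) \<phi>' \<longleftrightarrow> P x" for x
  proof -
    have "P x \<longleftrightarrow> true_at (params ps (\<lambda>_. x)) \<phi>"
      using \<phi>[rule_format, of "\<lambda>_. x"] .
    also have "params ps (\<lambda>_. x) =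
        (\<lambda>i. value_at (case_nat x (params ps (\<lambda>_. 0))) (Var (if i < length ps then Suc i else 0)))"
      by (rule ext) (auto simp: params_def)
    finally show ?thesis
      unfolding \<phi>'_def holds_subst by blast
  qed
  then show ?thesis
    using induction_true[of "params ps (\<lambda>_. 0)" \<phi>'] assms(2) step
    by (simp add: induction_def del: params_def)
qed

section \<open>The laws of an ordered semiring, by induction in the model\<close>

instance model :: linordered_semidom
proof
  fix a b c :: model
  note [simp] = add_zero_model peano_model(1-5)
  have assoc: "x + y + z = x + (y + z)" for x y z :: model
    by (induction z rule: model_induct) (intro dfr_intros, simp_all)
  have zero_add: "0 + x = x" for x :: model
    by (induction x rule: model_induct) (intro dfr_intros, simp_all)
  have suc_add: "x + 1 + y = x + y + 1" for x y :: model
    by (induction y rule: model_induct) (intro dfr_intros, simp_all)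
  have comm: "x + y = y + x" for x y :: model
    by (induction y rule: model_induct) (intro dfr_intros, simp_all add: zero_add suc_add)
  have cancel: "x + z = y + z \<longleftrightarrow> x = y" for x y z :: model
    by (induction z rule: model_induct) (intro dfr_intros, simp_all)
  have left_comm: "x + (y + z) = y + (x + z)" for x y z :: model
    by (metis assoc comm)
  have zero_mult: "0 * x = 0" for x :: model
    by (induction x rule: model_induct) (intro dfr_intros, simp_all)
  have suc_mult: "(x + 1) * y = x * y + y" for x y :: model
    by (induction y rule: model_induct) (intro dfr_intros, simp_all, metis assoc comm)
  have mult_comm: "x * y = y * x" for x y :: model
    by (induction y rule: model_induct) (intro dfr_intros, simp_all add: zero_mult suc_mult)
  have distrib: "(x + y) * z = x * z + y * z" for x y z :: model
    by (induction z rule: model_induct) (intro dfr_intros, simp_all, metis assoc comm)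
  have mult_assoc: "x * y * z = x * (y * z)" for x y z :: model
    by (induction z rule: model_induct) (intro dfr_intros, simp_all, metis distrib mult_comm)
  have one_mult: "1 * x = x" for x :: model
    using suc_mult[of 0 x] by (simp add: zero_mult zero_add)
  have ex_suc: "x = 0 \<or> (\<exists>y. x = y + 1)" for x :: model
    by (induction x rule: model_induct) (intro dfr_intros, auto)
  have sum_zero: "x + y = 0 \<Longrightarrow> x = 0 \<and> y = 0" for x y :: model
    using ex_suc[of y] by auto
  have less: "x < y \<longleftrightarrow> (\<exists>z. z \<noteq> 0 \<and> x + z = y)" for x y :: model
    unfolding peano_model(6) using ex_suc by (metis peano_model(1))
  have le: "x \<le> y \<longleftrightarrow> (\<exists>z. x + z = y)" for x y :: model
    unfolding less_eq_model_def less by (metis add_zero_model)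
  have ex_add: "\<exists>z. y = x + z" if "x \<le> y" for x y :: model
    using that unfolding le by metis
  have total: "x \<le> y \<or> y \<le> x" for x y :: model
    unfolding le
  proof (induction x rule: model_induct)
    case dfr
    show ?case by (intro dfr_intros)
  next
    case 0
    then show ?case using zero_add by blast
  next
    case (step x)
    then show ?case
      using ex_suc suc_add by (metis add_zero_model comm assoc)
  qed
  have minus: "y + x - y = x" for x y :: model
    unfolding minus_model_def le by (auto simp: cancel comm[of y] intro: some_equality)
  have minus0: "x - y = 0" if "\<not> y \<le> x" for x y :: model
    using that by (simp add: minus_model_def)
  have self: "x - x = 0" for x :: model
    using minus[of x 0] by simp
  have zero_minus: "0 - x = 0" for x :: model
  proof (cases "x = 0")
    case False
    then have "\<not> x \<le> 0"
      unfolding le using sum_zero by blast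
    then show ?thesis
      by (rule minus0)
  qed (simp add: self)
  have left_cancel: "z + x = z + y \<longleftrightarrow> x = y" for x y z :: model
    using cancel[of x z y] unfolding comm[of x z] comm[of y z] .
  have no_zero_div: "x * y \<noteq> 0" if "x \<noteq> 0" "y \<noteq> 0" for x y :: model
  proof -
    obtain z where "y = z + 1"
      using ex_suc \<open>y \<noteq> 0\<close> by blast
    then show ?thesis
      using sum_zero[of "x * z" x] \<open>x \<noteq> 0\<close> by auto
  qed
  have distrib_left: "x * (y + z) = x * y + x * z" for x y z :: model
    using distrib[of y z x] by (simp only: mult_comm[of _ x])
  have irrefl: "\<not> x < x" for x :: model
    unfolding less using left_cancel[of x _ 0] by simp
  have antisym: "x = y" if xy: "x \<le> y" "y \<le> x" for x y :: model
  proof -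
    obtain u v where "x + u = y" "y + v = x"
      using xy le by blast
    then have "x + (u + v) = x + 0"
      by (simp flip: assoc)
    then have "u = 0"
      unfolding left_cancel using sum_zero by blast
    then show ?thesis
      using \<open>x + u = y\<close> by simp
  qed
  show "a + b + c = a + (b + c)" "a + b = b + a" "0 + a = a" "a * b * c = a * (b * c)"
    "a * b = b * a" "1 * a = a" "(a + b) * c = a * c + b * c" "a * (b + c) = a * b + a * c"
    "0 * a = 0" "a * 0 = 0"
    by (rule assoc comm zero_add mult_assoc mult_comm one_mult distrib distrib_left zero_mult
        peano_model)+
  show "(0::model) \<noteq> 1"
    using peano_model(1)[of 0] zero_add by metis
  show "a + b - a = b"
    by (rule minus)
  show "a - b - c = a - (b + c)"
  proof (cases "b \<le> a")
    case True
    then obtain d where d: "a = b + d"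
      using ex_add by blast
    show ?thesis
    proof (cases "c \<le> d")
      case True
      then obtain f where "d = c + f"
        using ex_add by blast
      then show ?thesis
        unfolding d minus using minus[of "b + c" f] by (simp add: assoc minus)
    next
      case False
      then have "\<not> b + c \<le> b + d"
        unfolding le by (simp add: assoc left_cancel)
      then show ?thesis
        using False unfolding d minus by (simp add: minus0)
    qed
  next
    case False
    then have "\<not> b + c \<le> a"
      unfolding le using assoc by metis
    then show ?thesis
      using False by (simp add: minus0 zero_minus)
  qed
  show "a * (b - c) = a * b - a * c"
  proof (cases "c \<le> b")
    case True
    then obtain d where "b = c + d"
      using ex_add by blast
    then show ?thesis
      by (simp add: minus distrib_left)
  next
    case False
    \<comment> \<open>The left side is 0 by truncation. So is the right side: either the two
      products agree, or the second is the larger.\<close>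
    then obtain d where d: "c = b + d" "b - c = 0"
      using total ex_add minus0 by blast
    show ?thesis
    proof (cases "a * d = 0")
      case True
      then show ?thesis
        unfolding d(2) by (simp add: d(1) distrib_left self)
    next
      case False
      have "\<not> a * c \<le> a * b"
      proof
        assume "a * c \<le> a * b"
        then obtain z where "a * b = a * c + z"
          using ex_add by blast
        then have "a * b + (a * d + z) = a * b + 0"
          by (simp add: d(1) distrib_left assoc)
        then have "a * d + z = 0"
          unfolding left_cancel .
        then show False
          using sum_zero False by blast
      qed
      then show ?thesis
        unfolding d(2) by (simp add: minus0)
    qed
  qed
  show "a \<noteq> 0 \<Longrightarrow> b \<noteq> 0 \<Longrightarrow> a * b \<noteq> 0"
    by (rule no_zero_div)
  show "a < b \<longleftrightarrow> a \<le> b \<and> \<not> b \<le> a"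
    using antisym[of a b] irrefl[of a] by (auto simp: less_eq_model_def)
  show "a \<le> a"
    by (simp add: less_eq_model_def)
  show "a \<le> b \<Longrightarrow> b \<le> c \<Longrightarrow> a \<le> c"
    unfolding le using assoc by metis
  show "a \<le> b \<Longrightarrow> b \<le> a \<Longrightarrow> a = b"
    by (rule antisym)
  show "a \<le> b \<or> b \<le> a"
    by (rule total)
  show "a \<le> b \<Longrightarrow> c + a \<le> c + b"
    unfolding le by (auto simp: assoc left_cancel)
  show "a < b \<Longrightarrow> 0 < c \<Longrightarrow> c * a < c * b"
    unfolding less using no_zero_div by (auto simp: zero_add distrib_left left_cancel)
  show "(0::model) < 1"
    unfolding less using peano_model(1)[of 0] by (intro exI[of _ 1]) (simp add: zero_add)
  show "b \<le> a \<Longrightarrow> a - b + b = a"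
    using ex_add[of b a] minus[of b] comm[of _ b] by auto
qed

lemma zero_le_model [simp]: "0 \<le> (x :: model)"
  by (induction x rule: model_induct) (intro dfr_intros, simp_all add: add_nonneg_nonneg)

lemma zero_less_model [simp]: "0 < x \<longleftrightarrow> x \<noteq> (0 :: model)"
  by (simp add: order_less_le)

lemma le_zero_model [simp]: "x \<le> 0 \<longleftrightarrow> x = (0 :: model)"
  by (metis antisym zero_le_model order_refl)

lemma add_eq_0_model [simp]: "x + y = 0 \<longleftrightarrow> x = 0 \<and> y = (0 :: model)"
  by (simp add: add_nonneg_eq_0_iff)

lemma not_less_zero_model [simp]: "\<not> x < (0 :: model)"
  by (simp add: not_less)

lemma double_cancel_model [simp]: "2 * x = 2 * y \<longleftrightarrow> x = (y :: model)"
  by (metis antisym mult_left_le_imp_le order_refl zero_less_numeral)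

lemma le_iff_add_model: "x \<le> y \<longleftrightarrow> (\<exists>z. y = x + (z :: model))"
  by (metis add.commute le_add_diff_inverse2 le_add_same_cancel1 zero_le_model)

lemma less_add_one_iff_model [simp]: "x < y + 1 \<longleftrightarrow> x \<le> (y :: model)"
proof -
  have "x < y + 1 \<longleftrightarrow> (\<exists>z. x + z + 1 = y + 1)"
    unfolding peano_model(6) by (simp add: add.assoc)
  then show ?thesis
    unfolding le_iff_add_model by auto
qed

lemma add_one_le_iff_model: "x + 1 \<le> y \<longleftrightarrow> x < (y :: model)"
  by (metis less_add_one_iff_model not_le)

lemma dft_subst: "dft f \<Longrightarrow> (\<And>i. dft (F i)) \<Longrightarrow> dft (\<lambda>e. f (\<lambda>i. F i e))"
  by (induction rule: dft.induct) (simp_all add: dft.intros)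

text \<open>Lets definability be shown once for a relation between variables and then be used for
  arbitrary definable terms. Below a quantifier the new variable is kept, and the substituted terms
  read the tail of the environment.\<close>

lemma dfr_subst: "dfr P \<Longrightarrow> (\<And>i. dft (F i)) \<Longrightarrow> dfr (\<lambda>e. P (\<lambda>i. F i e))"
proof (induction arbitrary: F rule: dfr.induct)
  case (dfr_case_nat P)
  define G where "G = case_nat (\<lambda>e. e 0) (\<lambda>i e. F i (\<lambda>j. e (Suc j)))"
  have "dft (G i)" for i
    unfolding G_def using dft_subst[OF dfr_case_nat.prems dft_var] dft_var
    by (simp split: nat.split)
  then have "dfr (\<lambda>e. P (\<lambda>i. G i e))"
    by (rule dfr_case_nat.IH)
  moreover have "(\<lambda>i. G i e) = case_nat (e 0) (\<lambda>i. F i (\<lambda>j. e (Suc j)))" for e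
    by (rule ext) (simp add: G_def split: nat.split)
  ultimately show ?case
    by (intro dfr_all) simp
qed (simp_all add: dfr.intros dft_subst)

lemma dfr_arg: "dfr (\<lambda>e. P (e 0)) \<Longrightarrow> dft f \<Longrightarrow> dfr (\<lambda>e. P (f e))"
  using dfr_subst[of "\<lambda>e. P (e 0)" "\<lambda>_. f"] by simp

lemma dfr_args:
  assumes "dfr (\<lambda>e. R (e 0) (e 1))" "dft f" "dft g"
  shows "dfr (\<lambda>e. R (f e) (g e))"
  using dfr_subst[OF assms(1), of "case_nat f (\<lambda>_. g)"] assms(2,3) by (simp split: nat.split)

lemma model_less_induct [case_names dfr less]:
  assumes "dfr (\<lambda>e. P (e 0))" and step: "\<And>x. (\<And>y. y < x \<Longrightarrow> P y) \<Longrightarrow> P x"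
  shows "P (x :: model)"
proof -
  have "\<forall>y<x. P y" for x
  proof (induction x rule: model_induct)
    case dfr
    show ?case
      by (intro dfr_intros dfr_arg[OF assms(1)])
  next
    case (step x)
    then show ?case
      using assms(2) by (metis less_add_one_iff_model order_le_less)
  qed (simp add: not_less)
  then show ?thesis
    using less_add_one_iff_model[of x x] by blast
qed


section \<open>Coding in the model\<close>

lemma ex_triangle: "\<exists>t. 2 * t = n * (n + 1 :: model)"
proof (induction n rule: model_induct)
  case dfr
  show ?case by (intro dfr_intros)
next
  case (step n)
  then obtain t where "2 * t = n * (n + 1)" ..
  then have "2 * (t + n + 1) = (n + 1) * (n + 1 + 1)"
    by (simp add: algebra_simps flip: one_add_one del: one_add_one)
  then show ?case ..
qed (auto intro: exI[of _ 0])

text \<open>The semiring has no division by two; the choice is unambiguous because doubling is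
  injective.\<close>

definition tri :: "model \<Rightarrow> model" where
  "tri n = (SOME t. 2 * t = n * (n + 1))"

lemma double_tri: "2 * tri n = n * (n + 1)"
  unfolding tri_def by (rule someI_ex) (rule ex_triangle)

lemma tri_0 [simp]: "tri 0 = 0"
  using double_tri[of 0] by simp

lemma tri_add_one: "tri (n + 1) = tri n + n + 1"
proof -
  have "2 * tri (n + 1) = 2 * (tri n + n + 1)"
    by (simp only: double_tri distrib_left)
      (simp add: algebra_simps flip: one_add_one del: one_add_one)
  then show ?thesis
    unfolding double_cancel_model .
qed

lemma tri_mono: "m \<le> n \<Longrightarrow> tri m \<le> tri n"
proof -
  assume "m \<le> n"
  then have "2 * tri m \<le> 2 * tri n"
    unfolding double_tri by (intro mult_mono) simp_all
  then show "tri m \<le> tri n"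
    by (rule mult_left_le_imp_le) simp
qed

lemma le_tri: "n \<le> tri n"
proof -
  have "n = 0 \<or> (\<exists>m. n = m + 1)"
    using peano_model(6)[of 0 n] by (metis add_0 order_le_less zero_le_model)
  then show ?thesis
    by (auto simp: tri_add_one)
qed

definition pr :: "model \<Rightarrow> model \<Rightarrow> model" where
  "pr x y = tri (x + y) + x"

text \<open>Replaces the choice in \<open>tri\<close> by a polynomial equation. This is the content
  of \<open>is_pair\<close>, and it makes the graph of \<open>pr\<close> definable although
  \<open>pr\<close> itself is not among the definable terms.\<close>

lemma pr_iff: "z = pr x y \<longleftrightarrow> 2 * z = (x + y) * (x + y + 1) + 2 * x"
proof -
  have "z = pr x y \<longleftrightarrow> 2 * z = 2 * pr x y"
    by simp
  then show ?thesis
    unfolding pr_def distrib_left double_tri .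
qed

lemma pr_inject [simp]: "pr x y = pr x' y' \<longleftrightarrow> x = x' \<and> y = y'"
proof
  assume eq: "pr x y = pr x' y'"
  \<comment> \<open>Since \<open>x\<close> is at most \<open>x + y\<close>, the codes on one
    diagonal stay below the triangular number at which the next one starts.\<close>
  have less: "pr x y < pr x' y'" if "x + y < x' + y'" for x y x' y'
  proof -
    have "pr x y < tri (x + y) + (x + y) + 1"
      by (simp add: pr_def add.assoc)
    also have "\<dots> = tri (x + y + 1)"
      by (simp add: tri_add_one)
    also have "\<dots> \<le> tri (x' + y')"
      using that by (intro tri_mono) (simp add: add_one_le_iff_model)
    also have "\<dots> \<le> pr x' y'"
      by (simp add: pr_def)
    finally show ?thesis .
  qed
  have "x + y = x' + y'"
    using less[of x y x' y'] less[of x' y' x y] eq by (metis neqE order_less_irrefl)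
  with eq show "x = x' \<and> y = y'"
    by (auto simp: pr_def)
qed simp

lemma pr_mono: "x \<le> x' \<Longrightarrow> y \<le> y' \<Longrightarrow> pr x y \<le> pr x' y'"
  unfolding pr_def by (intro add_mono tri_mono)

lemma le_pr [simp]: "x \<le> pr x y" "y \<le> pr x y"
proof -
  show "x \<le> pr x y"
    by (simp add: pr_def)
  have "y \<le> x + y" by simp
  also have "\<dots> \<le> tri (x + y)" by (rule le_tri)
  also have "\<dots> \<le> pr x y" by (simp add: pr_def)
  finally show "y \<le> pr x y" .
qed

lemma dfr_pr: "dft f \<Longrightarrow> dft g \<Longrightarrow> dft h \<Longrightarrow> dfr (\<lambda>e. h e = pr (f e) (g e))"
  unfolding pr_iff by (intro dfr_intros)

section \<open>The beta function and bounded comprehension\<close>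

definition elem :: "model \<Rightarrow> model \<Rightarrow> bool" where
  "elem x a \<longleftrightarrow> (\<exists>w u v. a = pr w (pr u v) \<and> x < w \<and> (x + 1) * v + 1 dvd u)"

lemma dfr_elem:
  assumes "dft f" "dft g"
  shows "dfr (\<lambda>e. elem (f e) (g e))"
proof -
  have "elem x a \<longleftrightarrow> (\<exists>w p u v. a = pr w p \<and> p = pr u v \<and> x < w \<and> (\<exists>q. u = ((x + 1) * v + 1) * q))"
    for x a
    unfolding elem_def dvd_def by blast
  then have "dfr (\<lambda>e. elem (e 0) (e 1))"
    by (simp only:) (intro dfr_pr dfr_intros)
  then show ?thesis
    using assms by (rule dfr_args)
qed

lemma elem_less: "elem x a \<Longrightarrow> x < a"
  unfolding elem_def using le_pr(1) order_less_le_trans by blast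

text \<open>Takes the place of a factorial, for which no recursion is available in the model.
  Positivity of \<open>v\<close> makes all moduli of the beta function exceed 1.\<close>

lemma ex_common_multiple: "\<exists>v>0. \<forall>i. 0 < i \<longrightarrow> i \<le> w \<longrightarrow> i dvd (v :: model)"
  unfolding dvd_def
proof (induction w rule: model_induct)
  case dfr
  show ?case by (intro dfr_intros)
next
  case 0
  show ?case by (intro exI[of _ 1]) simp
next
  case (step w)
  then obtain v where v: "v > 0" "\<forall>i. 0 < i \<longrightarrow> i \<le> w \<longrightarrow> i dvd v"
    unfolding dvd_def by blast
  have "i dvd v * (w + 1)" if "0 < i" "i \<le> w + 1" for i
    using that v(2) by (cases "i = w + 1") (auto simp: order_le_less)
  moreover have "v * (w + 1) > 0"
    using v(1) by (simp add: add_nonneg_pos)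
  ultimately show ?case
    unfolding dvd_def by blast
qed

text \<open>
  Avoids Bezout coefficients: \<open>(x + 1)(1 + (y + 1)v)\<close> and \<open>(y + 1)(1 + (x + 1)v)\<close> differ by
  \<open>\<bar>x - y\<bar>\<close>, which divides \<open>v\<close>.
\<close>

lemma beta_coprime:
  fixes u v x y w :: model
  assumes v: "\<forall>i. 0 < i \<longrightarrow> i \<le> w \<longrightarrow> i dvd v" and xy: "x < w" "y < w" "x \<noteq> y"
    and dvd: "(x + 1) * v + 1 dvd u * ((y + 1) * v + 1)"
  shows "(x + 1) * v + 1 dvd u"
proof -
  define d where "d = (x + 1) * v + 1"
  have *: "d dvd u * (x + 1) * ((y + 1) * v + 1)" "d dvd u * (y + 1) * d"
    using dvd_mult2[OF dvd, of "x + 1"] by (simp_all add: d_def mult_ac)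
  obtain i where i: "0 < i" "i \<le> w" "d dvd u * i"
  proof (cases "x < y")
    case True
    then obtain i where y: "y = x + i"
      using le_iff_add_model by (meson less_imp_le)
    then have "u * (y + 1) * d = u * (x + 1) * ((y + 1) * v + 1) + u * i"
      by (simp add: d_def algebra_simps)
    then have "d dvd u * i"
      using * dvd_add_right_iff by metis
    moreover have "0 < i" "i \<le> w"
      using True xy by (auto simp: y) (meson add_increasing le_less zero_le_model order_trans le_add_same_cancel2)
    ultimately show ?thesis
      using that by blast
  next
    case False
    then obtain i where x: "x = y + i" "y < x"
      using le_iff_add_model xy(3) by (metis neqE less_imp_le)
    then have "u * (x + 1) * ((y + 1) * v + 1) = u * (y + 1) * d + u * i"
      by (simp add: d_def algebra_simps)
    then have "d dvd u * i"
      using * dvd_add_right_iff by metis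
    moreover have "0 < i" "i \<le> w"
      using x(2) xy by (auto simp: x(1)) (meson add_increasing le_less zero_le_model order_trans le_add_same_cancel2)
    ultimately show ?thesis
      using that by blast
  qed
  from i(1,2) v obtain j where "v = i * j"
    by blast
  then have "u * d = u * i * (j * (x + 1)) + u"
    by (simp add: d_def algebra_simps)
  then show ?thesis
    using i(3) by (metis d_def dvd_add_right_iff dvd_mult2 dvd_triv_right)
qed

text \<open>The code \<open>u\<close> is built by running through the numbers below \<open>w\<close>
  and multiplying by the modulus of each one that satisfies \<open>P\<close>. By
  \<open>beta_coprime\<close> a new factor does not affect divisibility by the other moduli.\<close>

lemma comprehension:
  assumes P: "dfr (\<lambda>e. P (e 0))"
  obtains a where "\<And>x. elem x a \<longleftrightarrow> x < w \<and> P x"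
proof -
  obtain v where v: "v > 0" "\<forall>i. 0 < i \<longrightarrow> i \<le> w \<longrightarrow> i dvd v"
    using ex_common_multiple by blast
  define d where "d x = (x + 1) * v + 1" for x
  have not_dvd_1: "\<not> d x dvd 1" for x
  proof
    assume "d x dvd 1"
    then obtain q where q: "1 = d x * q" ..
    then have "1 \<le> q"
      using add_one_le_iff_model[of 0 q] by (cases "q = 0") (auto simp: order_le_less)
    then have "d x * 1 \<le> d x * q"
      unfolding d_def using v(1) by (intro mult_left_mono) simp_all
    moreover have "1 < d x"
      unfolding d_def using v(1) by (simp add: add_nonneg_pos)
    ultimately show False
      by (metis q mult_1_right not_less)
  qed
  \<comment> \<open>Divisibility is spelled out so that the induction statement is visibly
    definable. The restriction to \<open>k \<le> w\<close> is that of the coprimality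
    argument.\<close>
  have "k \<le> w \<longrightarrow> (\<exists>u. \<forall>x<w. (\<exists>q. u = ((x + 1) * v + 1) * q) \<longleftrightarrow> x < k \<and> P x)" for k
  proof (induction k rule: model_induct)
    case dfr
    show ?case
      by (intro dfr_intros dfr_arg[OF P])
  next
    case 0
    show ?case
      \<comment> \<open>The number 1 codes the empty set, since no modulus divides it.\<close>
      using not_dvd_1 by (intro impI exI[of _ 1]) (simp add: d_def dvd_def not_less)
  next
    case (step k)
    show ?case
    proof
      assume k: "k + 1 \<le> w"
      then have "k < w"
        by (simp add: add_one_le_iff_model)
      with step obtain u where u: "\<And>x. x < w \<Longrightarrow> d x dvd u \<longleftrightarrow> x < k \<and> P x"
        unfolding d_def dvd_def by auto
      define u' where "u' = (if P k then u * d k else u)"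
      have "d x dvd u' \<longleftrightarrow> x < k + 1 \<and> P x" if "x < w" for x
      proof (cases "x = k")
        case True
        then show ?thesis
          using u[OF \<open>k < w\<close>] by (simp add: u'_def)
      next
        case False
        then have "d x dvd u' \<longleftrightarrow> d x dvd u"
          using beta_coprime[OF v(2) that \<open>k < w\<close>] dvd_mult2 unfolding u'_def d_def by metis
        then show ?thesis
          using u[OF that] False by (simp add: order_le_less)
      qed
      then show "\<exists>u. \<forall>x<w. (\<exists>q. u = ((x + 1) * v + 1) * q) \<longleftrightarrow> x < k + 1 \<and> P x"
        unfolding d_def dvd_def by blast
    qed
  qed
  from this[of w] obtain u where u: "\<forall>x<w. d x dvd u \<longleftrightarrow> x < w \<and> P x"
    unfolding d_def dvd_def by auto
  then have "elem x (pr w (pr u v)) \<longleftrightarrow> x < w \<and> P x" for x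
    unfolding elem_def d_def by auto
  then show ?thesis
    by (rule that)
qed

section \<open>The coding formulas in the model\<close>

lemma true_at_Allb [simp]:
  "true_at e (Allb t \<phi>) \<longleftrightarrow> (\<forall>x < value_at e t. true_at (case_nat x e) \<phi>)"
  by (auto simp: Allb_def)

lemma true_at_Exb [simp]:
  "true_at e (Exb t \<phi>) \<longleftrightarrow> (\<exists>x < value_at e t. true_at (case_nat x e) \<phi>)"
  by (auto simp: Exb_def)

lemma true_at_is_pair [simp]:
  "true_at e (is_pair x y z) \<longleftrightarrow> value_at e z = pr (value_at e x) (value_at e y)"
  unfolding is_pair_def pr_iff by simp

definition cons :: "model \<Rightarrow> model \<Rightarrow> model" where
  "cons x y = pr x y + 1"

lemma cons_inject [simp]: "cons x y = cons x' y' \<longleftrightarrow> x = x' \<and> y = y'"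
  by (simp add: cons_def)

lemma cons_neq_0 [simp]: "cons x y \<noteq> 0" "0 \<noteq> cons x y"
  by (simp_all add: cons_def)

lemma less_cons [simp]: "x < cons x y" "y < cons x y"
  by (simp_all add: cons_def)

lemma true_at_is_cons [simp]:
  "true_at e (is_cons x y z) \<longleftrightarrow> value_at e z = cons (value_at e x) (value_at e y)"
proof -
  have "2 * cons a b = (a + b) * (a + b + 1) + 2 * (a + 1)" for a b
    using iffD1[OF pr_iff refl, of a b] by (simp add: cons_def distrib_left add.assoc)
  then have "z = cons a b \<longleftrightarrow> 2 * z = (a + b) * (a + b + 1) + 2 * (a + 1)" for a b z
    by (metis double_cancel_model)
  then show ?thesis
    by (simp add: is_cons_def del: distrib_left_numeral)
qed

lemma ex_cons_bounded_model:
  "(\<exists>x<z. \<exists>y<z. z = cons x y \<and> P x y) \<longleftrightarrow> (\<exists>x y. z = cons x y \<and> P x y)"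
  using less_cons by blast

lemma true_at_mem [simp]: "true_at e (mem x a) \<longleftrightarrow> elem (value_at e x) (value_at e a)"
proof -
  have bound: "(\<exists>q < u + 1. q * (k * v + 1) = u) \<longleftrightarrow> k * v + 1 dvd u" for u v k :: model
  proof
    assume "k * v + 1 dvd u"
    then obtain q where q: "u = (k * v + 1) * q" ..
    have "q * 1 \<le> q * (k * v + 1)"
      by (rule mult_left_mono) simp_all
    then have "q < u + 1"
      by (simp add: q mult.commute)
    then show "\<exists>q < u + 1. q * (k * v + 1) = u"
      using q mult.commute by blast
  qed (metis dvd_triv_right)
  have "true_at e (mem x a) \<longleftrightarrow>
    (\<exists>w < value_at e a + 1. \<exists>p < value_at e a + 1. \<exists>u < value_at e a + 1. \<exists>v < value_at e a + 1.
      value_at e a = pr w p \<and> p = pr u v \<and> value_at e x < w \<and> (value_at e x + 1) * v + 1 dvd u)"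
    unfolding bound[symmetric] by (simp add: mem_def eval_nat_numeral del: less_add_one_iff_model)
  also have "\<dots> \<longleftrightarrow> elem (value_at e x) (value_at e a)"
  proof
    assume "elem (value_at e x) (value_at e a)"
    then obtain w u v where a: "value_at e a = pr w (pr u v)"
      and *: "value_at e x < w" "(value_at e x + 1) * v + 1 dvd u"
      unfolding elem_def by blast
    have "w < value_at e a + 1" "pr u v < value_at e a + 1"
      unfolding a by simp_all
    moreover from this have "u < value_at e a + 1" "v < value_at e a + 1"
      using order_le_less_trans[OF le_pr(1)] order_le_less_trans[OF le_pr(2)] by blast+
    ultimately show "\<exists>w < value_at e a + 1. \<exists>p < value_at e a + 1. \<exists>u < value_at e a + 1. \<exists>v < value_at e a + 1.
      value_at e a = pr w p \<and> p = pr u v \<and> value_at e x < w \<and> (value_at e x + 1) * v + 1 dvd u"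
      using a * by blast
  qed (unfold elem_def, blast)
  finally show ?thesis .
qed

definition pelem :: "model \<Rightarrow> model \<Rightarrow> model \<Rightarrow> bool" where
  "pelem x y a \<longleftrightarrow> elem (pr x y) a"

lemma true_at_pmem [simp]:
  "true_at e (pmem x y a) \<longleftrightarrow> pelem (value_at e x) (value_at e y) (value_at e a)"
  by (auto simp: pmem_def pelem_def elem_less)

lemma pelem_less: "pelem x y a \<Longrightarrow> x < a" "pelem x y a \<Longrightarrow> y < a"
  unfolding pelem_def using elem_less le_pr by (blast intro: order_le_less_trans)+

lemma dfr_cons: "dft f \<Longrightarrow> dft g \<Longrightarrow> dft h \<Longrightarrow> dfr (\<lambda>e. h e = cons (f e) (g e))"
proof -
  have "z = cons x y \<longleftrightarrow> (\<exists>p. p = pr x y \<and> z = p + 1)" for x y z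
    by (auto simp: cons_def)
  then have "dfr (\<lambda>e. e 0 = cons (e 1) (e 2))"
    by (simp only:) (intro dfr_pr dfr_intros)
  then show "dft f \<Longrightarrow> dft g \<Longrightarrow> dft h \<Longrightarrow> dfr (\<lambda>e. h e = cons (f e) (g e))"
    using dfr_subst[of "\<lambda>e. e 0 = cons (e 1) (e 2)" "case_nat h (case_nat f (\<lambda>_. g))"]
    by (simp split: nat.split)
qed

lemma dfr_pelem:
  assumes "dft f" "dft g" "dft h"
  shows "dfr (\<lambda>e. pelem (f e) (g e) (h e))"
proof -
  have "pelem x y z \<longleftrightarrow> (\<exists>p. p = pr x y \<and> elem p z)" for x y z
    by (auto simp: pelem_def)
  then have "dfr (\<lambda>e. pelem (e 0) (e 1) (e 2))"
    by (simp only:) (intro dfr_pr dfr_elem dfr_intros)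
  then show ?thesis
    using dfr_subst[of "\<lambda>e. pelem (e 0) (e 1) (e 2)" "case_nat f (case_nat g (\<lambda>_. h))"] assms
    by (simp split: nat.split)
qed

lemma pcomprehension:
  assumes "dfr (\<lambda>e. R (e 0) (e 1))"
  obtains a where "\<And>x y. pelem x y a \<longleftrightarrow> pr x y < w \<and> R x y"
proof -
  have "dfr (\<lambda>e. \<exists>x y. e 0 = pr x y \<and> R x y)"
    by (intro dfr_pr dfr_args[OF assms] dfr_intros)
  then obtain a where "\<And>z. elem z a \<longleftrightarrow> z < w \<and> (\<exists>x y. z = pr x y \<and> R x y)"
    using comprehension[of "\<lambda>z. \<exists>x y. z = pr x y \<and> R x y" w] by blast
  then show ?thesis
    by (intro that[of a]) (simp add: pelem_def)
qed


section \<open>Trees and ordinals in the model\<close>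

text \<open>Abstract in the relation used for the recursive calls, which will be membership in a
  witness set as well as \<open>olt\<close> itself.\<close>

definition ord_clause :: "(model \<Rightarrow> model \<Rightarrow> bool) \<Rightarrow> model \<Rightarrow> model \<Rightarrow> bool" where
  "ord_clause R x y \<longleftrightarrow> (\<exists>b bs. y = cons b bs \<and>
    (x = 0 \<or> (\<exists>a as. x = cons a as \<and> (R a b \<or> a = b \<and> R as bs))))"

definition ord_witness :: "model \<Rightarrow> bool" where
  "ord_witness c \<longleftrightarrow> (\<forall>x y. pelem x y c \<longrightarrow> ord_clause (\<lambda>x y. pelem x y c) x y)"

definition olt :: "model \<Rightarrow> model \<Rightarrow> bool" where
  "olt x y \<longleftrightarrow> (\<exists>c. pelem x y c \<and> ord_witness c)"

text \<open>Abstract in the comparison \<open>L\<close>: it is \<open>olt\<close> for genuine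
  normality, and membership in one finite set of pairs in the version with a bounded matrix.\<close>

definition nf_witness :: "(model \<Rightarrow> model \<Rightarrow> bool) \<Rightarrow> model \<Rightarrow> bool" where
  "nf_witness L c \<longleftrightarrow> (\<forall>x. elem x c \<longrightarrow> x = 0 \<or>
    (\<exists>l r. x = cons l r \<and> elem l c \<and> elem r c \<and>
      (r = 0 \<or> (\<exists>l' r'. r = cons l' r' \<and> (l' = l \<or> L l' l)))))"

definition onf :: "model \<Rightarrow> bool" where
  "onf x \<longleftrightarrow> (\<exists>c. elem x c \<and> nf_witness olt c)"

definition is_tree :: "model \<Rightarrow> bool" where
  "is_tree x \<longleftrightarrow> (\<exists>c. elem x c \<and>
    (\<forall>x. elem x c \<longrightarrow> x = 0 \<or> (\<exists>l r. x = cons l r \<and> elem l c \<and> elem r c)))"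

definition tle_witness :: "model \<Rightarrow> bool" where
  "tle_witness c \<longleftrightarrow> (\<forall>s t. pelem s t c \<longrightarrow> s = 0 \<or>
    (\<exists>t0 t1. t = cons t0 t1 \<and>
      ((\<exists>s0 s1. s = cons s0 s1 \<and> pelem s0 t0 c \<and> pelem s1 t1 c) \<or>
        pelem s t0 c \<or> pelem s t1 c)))"

definition tle :: "model \<Rightarrow> model \<Rightarrow> bool" where
  "tle s t \<longleftrightarrow> (\<exists>c. pelem s t c \<and> tle_witness c)"

lemma true_at_ord_less_fm [simp]:
  "true_at e (ord_less_fm x y) \<longleftrightarrow> olt (value_at e x) (value_at e y)"
proof -
  have "true_at e (ord_less_fm x y) \<longleftrightarrow> (\<exists>c. pelem (value_at e x) (value_at e y) c \<and>
      (\<forall>x<c. \<forall>y<c. pelem x y c \<longrightarrow> ord_clause (\<lambda>x y. pelem x y c) x y))"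
    by (simp add: ord_less_fm_def ord_clause_def ex_cons_bounded_model eval_nat_numeral)
  then show ?thesis
    unfolding olt_def ord_witness_def using pelem_less by meson
qed

lemma true_at_nf_fm [simp]: "true_at e (nf_fm x) \<longleftrightarrow> onf (value_at e x)"
proof -
  have "true_at e (nf_fm x) \<longleftrightarrow> (\<exists>c. elem (value_at e x) c \<and>
      (\<forall>x<c. elem x c \<longrightarrow> x = 0 \<or> (\<exists>l r. x = cons l r \<and> elem l c \<and> elem r c \<and>
        (r = 0 \<or> (\<exists>l' r'. r = cons l' r' \<and> (l' = l \<or> olt l' l))))))"
    by (simp add: nf_fm_def ex_cons_bounded_model eval_nat_numeral)
  then show ?thesis
    unfolding onf_def nf_witness_def using elem_less by meson
qed

lemma true_at_tree_fm [simp]: "true_at e (tree_fm x) \<longleftrightarrow> is_tree (value_at e x)"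
proof -
  have "true_at e (tree_fm x) \<longleftrightarrow> (\<exists>c. elem (value_at e x) c \<and>
      (\<forall>x<c. elem x c \<longrightarrow> x = 0 \<or> (\<exists>l r. x = cons l r \<and> elem l c \<and> elem r c)))"
    by (simp add: tree_fm_def ex_cons_bounded_model eval_nat_numeral)
  then show ?thesis
    unfolding is_tree_def using elem_less by meson
qed

lemma true_at_tree_le_fm [simp]:
  "true_at e (tree_le_fm s t) \<longleftrightarrow> tle (value_at e s) (value_at e t)"
proof -
  have "true_at e (tree_le_fm s t) \<longleftrightarrow> (\<exists>c. pelem (value_at e s) (value_at e t) c \<and>
      (\<forall>s<c. \<forall>t<c. pelem s t c \<longrightarrow> s = 0 \<or>
        (\<exists>t0 t1. t = cons t0 t1 \<and>
          ((\<exists>s0 s1. s = cons s0 s1 \<and> pelem s0 t0 c \<and> pelem s1 t1 c) \<or>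
            pelem s t0 c \<or> pelem s t1 c))))"
    by (simp add: tree_le_fm_def ex_cons_bounded_model eval_nat_numeral)
  then show ?thesis
    unfolding tle_def tle_witness_def using pelem_less by meson
qed

section \<open>Recursion equations and order properties of ordinal codes\<close>

lemma dfr_olt: "dft f \<Longrightarrow> dft g \<Longrightarrow> dfr (\<lambda>e. olt (f e) (g e))"
proof (rule dfr_args)
  show "dfr (\<lambda>e. olt (e 0) (e 1))"
    unfolding olt_def ord_witness_def ord_clause_def
    by (intro dfr_cons dfr_pelem dfr_intros)
qed

lemma dfr_onf: "dft f \<Longrightarrow> dfr (\<lambda>e. onf (f e))"
proof (rule dfr_arg)
  show "dfr (\<lambda>e. onf (e 0))"
    unfolding onf_def nf_witness_def
    by (intro dfr_cons dfr_elem dfr_olt dfr_intros)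
qed

text \<open>Recursive calls concern smaller codes only, so inclusion of the relations is required
  just below \<open>x\<close> and \<open>y\<close>. This is what allows witness sets to be cut off
  at a bound.\<close>

lemma ord_clause_mono:
  assumes "ord_clause R x y" and sub: "\<And>a b. a \<le> x \<Longrightarrow> b \<le> y \<Longrightarrow> R a b \<Longrightarrow> S a b"
  shows "ord_clause S x y"
proof -
  obtain b bs where y: "y = cons b bs"
    and "x = 0 \<or> (\<exists>a as. x = cons a as \<and> (R a b \<or> a = b \<and> R as bs))"
    using assms(1) unfolding ord_clause_def by blast
  then consider "x = 0" | a as where "x = cons a as" "R a b" | as where "x = cons b as" "R as bs"
    by blast
  then show ?thesis
  proof cases
    case (2 a as)
    then show ?thesis
      using sub[of a b] by (simp add: ord_clause_def y less_imp_le)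
  next
    case (3 as)
    then show ?thesis
      using sub[of as bs] by (simp add: ord_clause_def y less_imp_le)
  qed (simp add: ord_clause_def y)
qed

text \<open>From left to right, a witness for a pair also serves its recursive calls. From right to
  left, all smaller true comparisons are collected into one witness by comprehension.\<close>

lemma olt_clause: "olt x y \<longleftrightarrow> ord_clause olt x y"
proof
  have clause: "ord_clause olt a b" if ab: "olt a b" for a b
  proof -
    obtain c where c: "pelem a b c" "ord_witness c"
      using ab unfolding olt_def by blast
    then have "ord_clause (\<lambda>x y. pelem x y c) a b"
      unfolding ord_witness_def by blast
    then show ?thesis
      by (rule ord_clause_mono) (use c(2) olt_def in blast)
  qed
  then show "olt x y \<Longrightarrow> ord_clause olt x y" .
  assume xy: "ord_clause olt x y"
  have "dfr (\<lambda>e. ord_clause olt (e 0) (e 1))"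
    unfolding ord_clause_def by (intro dfr_cons dfr_olt dfr_intros)
  \<comment> \<open>The set is defined by the clause rather than by \<open>olt\<close>, because
    \<open>olt x y\<close> is still to be shown. The added 1 admits the pair of \<open>x\<close> and
    \<open>y\<close> itself.\<close>
  then obtain c where c: "\<And>a b. pelem a b c \<longleftrightarrow> pr a b < pr x y + 1 \<and> ord_clause olt a b"
    by (rule pcomprehension) blast
  have "ord_clause (\<lambda>a b. pelem a b c) a b" if ab: "pelem a b c" for a b
  proof (rule ord_clause_mono)
    show "ord_clause olt a b"
      using ab c by blast
    show "pelem a' b' c" if "a' \<le> a" "b' \<le> b" "olt a' b'" for a' b'
      using that clause ab pr_mono[of a' a b' b] unfolding c by (auto intro: order_trans)
  qed
  moreover have "pelem x y c"
    using xy by (simp add: c)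
  ultimately show "olt x y"
    unfolding olt_def ord_witness_def by blast
qed

lemma olt_simps [simp]:
  "olt 0 (cons b bs)" "\<not> olt x 0"
  "olt (cons a as) (cons b bs) \<longleftrightarrow> olt a b \<or> a = b \<and> olt as bs"
  by (subst olt_clause, simp add: ord_clause_def)+

lemma olt_cases:
  assumes "olt x y"
  obtains b bs where "x = 0" "y = cons b bs"
  | a as b bs where "x = cons a as" "y = cons b bs" "olt a b"
  | a as bs where "x = cons a as" "y = cons a bs" "olt as bs"
  using assms unfolding olt_clause[of x y] ord_clause_def by blast

lemma onf_unfold:
  assumes "onf x"
  shows "x = 0 \<or> (\<exists>l r. x = cons l r \<and> onf l \<and> onf r \<and>
    (r = 0 \<or> (\<exists>l' r'. r = cons l' r' \<and> (l' = l \<or> olt l' l))))"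
proof -
  obtain c where c: "elem x c" "nf_witness olt c"
    using assms unfolding onf_def by blast
  then have "onf y" if "elem y c" for y
    using that unfolding onf_def by blast
  then show ?thesis
    using c unfolding nf_witness_def by blast
qed

lemma onf_cons: "onf (cons l r) \<Longrightarrow> onf l \<and> onf r"
  using onf_unfold[of "cons l r"] by auto

lemma onf_cases:
  assumes "onf x"
  obtains "x = 0" | l where "x = cons l 0" "onf l"
  | l l' r' where "x = cons l (cons l' r')" "onf l" "onf (cons l' r')" "l' = l \<or> olt l' l"
  using onf_unfold[OF assms] by blast

lemma olt_trans: "olt x y \<Longrightarrow> olt y z \<Longrightarrow> olt x z"
proof -
  have "\<forall>x y. olt x y \<longrightarrow> olt y z \<longrightarrow> olt x z"
  proof (induction z rule: model_less_induct)
    case dfr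
    show ?case
      by (intro dfr_olt dfr_intros)
  next
    case (less z)
    have "olt x z" if "olt x y" "olt y z" for x y
      using that(2)
    proof (cases rule: olt_cases)
      case (2 a as b bs)
      then show ?thesis
        using that(1) less.IH[of b] by (auto elim: olt_cases)
    next
      case (3 a as bs)
      then show ?thesis
        using that(1) less.IH[of bs] by (auto elim: olt_cases)
    qed (use that(1) in auto)
    then show ?case by blast
  qed
  then show "olt x y \<Longrightarrow> olt y z \<Longrightarrow> olt x z"
    by blast
qed

lemma olt_irrefl: "\<not> olt x x"
proof (induction x rule: model_less_induct)
  case dfr
  show ?case
    by (intro dfr_olt dfr_intros)
next
  case (less x)
  show ?case
  proof
    assume "olt x x"
    then show False
      by (cases rule: olt_cases) (use less.IH in auto)
  qed
qed

lemma olt_total: "onf x \<Longrightarrow> onf y \<Longrightarrow> olt x y \<or> x = y \<or> olt y x"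
proof -
  have "\<forall>y. onf x \<longrightarrow> onf y \<longrightarrow> olt x y \<or> x = y \<or> olt y x"
  proof (induction x rule: model_less_induct)
    case dfr
    show ?case
      by (intro dfr_olt dfr_onf dfr_intros)
  next
    case (less x)
    have zero_or_cons: "x = 0 \<or> (\<exists>a as. x = cons a as \<and> onf a \<and> onf as)" if "onf x" for x
      using that onf_unfold[of x] by blast
    have "olt x y \<or> x = y \<or> olt y x" if nf: "onf x" "onf y" for y
    proof (cases "x = 0 \<or> y = 0")
      case True
      then show ?thesis
        using zero_or_cons[OF nf(1)] zero_or_cons[OF nf(2)] by auto
    next
      case False
      then obtain a as b bs where *: "x = cons a as" "onf a" "onf as" "y = cons b bs" "onf b" "onf bs"
        using zero_or_cons[OF nf(1)] zero_or_cons[OF nf(2)] by blast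
      have "olt a b \<or> a = b \<or> olt b a" "olt as bs \<or> as = bs \<or> olt bs as"
        using less.IH[of a] less.IH[of as] *(2,3,5,6) unfolding *(1) by simp_all
      then show ?thesis
        unfolding *(1,4) by auto
    qed
    then show ?case by blast
  qed
  then show "onf x \<Longrightarrow> onf y \<Longrightarrow> olt x y \<or> x = y \<or> olt y x"
    by blast
qed

text \<open>No ordinal below \<open>\<epsilon>\<^sub>0\<close> is a fixed point of exponentiation:
  the leading exponent of \<open>l\<close> is below \<open>l\<close> by induction, which already
  decides the comparison of \<open>l\<close> with \<open>cons l r\<close>. The extra variable
  \<open>x\<close> keeps the statement definable, as \<open>cons\<close> is given only by its
  graph.\<close>

lemma olt_exponent: "onf l \<Longrightarrow> olt l (cons l r)"
proof -
  have "onf l \<longrightarrow> (\<forall>r x. x = cons l r \<longrightarrow> olt l x)"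
  proof (induction l rule: model_less_induct)
    case dfr
    show ?case
      by (intro dfr_cons dfr_olt dfr_onf dfr_intros)
  next
    case (less l)
    show ?case
    proof (intro impI allI)
      fix r x assume "onf l" and x: "x = cons l r"
      then consider "l = 0" | a as where "l = cons a as" "onf a"
        by (metis onf_cases)
      then show "olt l x"
        by cases (use less.IH x in auto)
    qed
  qed
  then show "onf l \<Longrightarrow> olt l (cons l r)"
    by blast
qed

text \<open>Normality bounds the leading exponent of \<open>r\<close> by \<open>l\<close>. If it is
  smaller, the comparison is decided; if it equals \<open>l\<close>, the remainders are compared,
  and induction applies to \<open>r\<close>.\<close>

lemma olt_remainder: "onf (cons l r) \<Longrightarrow> olt r (cons l r)"
proof -
  have "onf x \<longrightarrow> (\<forall>l r. x = cons l r \<longrightarrow> olt r x)" for x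
  proof (induction x rule: model_less_induct)
    case dfr
    show ?case
      by (intro dfr_cons dfr_olt dfr_onf dfr_intros)
  next
    case (less x)
    show ?case
    proof (intro impI allI)
      fix l r assume "onf x" and x: "x = cons l r"
      from \<open>onf x\<close> show "olt r x"
        by (cases rule: onf_cases) (use less.IH[of r] x in auto)
    qed
  qed
  then show "onf (cons l r) \<Longrightarrow> olt r (cons l r)"
    by blast
qed

text \<open>
  Codes of ordinals are also codes of trees: \<open>\<omega>\<^sup>\<alpha> + \<rho>\<close> corresponds to the tree with subtrees
  \<open>\<alpha>\<close> and \<open>\<rho>\<close>. This correspondence is a quasi-embedding.
\<close>

lemma is_tree_onf: "onf x \<Longrightarrow> is_tree x"
  unfolding onf_def nf_witness_def is_tree_def by blast

text \<open>Induction on \<open>t\<close> within one fixed witness \<open>c\<close>, which enters as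
  a parameter. Componentwise comparison implies lexicographic comparison; if \<open>s\<close> embeds
  into a subtree of \<open>t\<close>, that subtree is an exponent or a remainder and hence below
  \<open>t\<close>.\<close>

lemma tle_olt:
  assumes "tle s t" "onf s" "onf t"
  shows "s = t \<or> olt s t"
proof -
  obtain c where c: "pelem s t c" "tle_witness c"
    using assms(1) unfolding tle_def by blast
  have "\<forall>s. pelem s t c \<longrightarrow> onf s \<longrightarrow> onf t \<longrightarrow> s = t \<or> olt s t" for t
  proof (induction t rule: model_less_induct)
    case dfr
    show ?case
      by (intro dfr_pelem dfr_olt dfr_onf dfr_intros)
  next
    case (less t)
    show ?case
    proof (intro allI impI)
      fix s assume st: "pelem s t c" and nf: "onf s" "onf t"
      have sub: "olt s t" if "t = cons t0 t1" "pelem s t0 c \<or> pelem s t1 c" for t0 t1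
      proof -
        have "onf t0" "onf t1" "olt t0 t" "olt t1 t"
          using nf(2) onf_cons olt_exponent olt_remainder unfolding that(1) by blast+
        then show ?thesis
          using less.IH[of t0] less.IH[of t1] that(2) nf(1) olt_trans unfolding that(1)
          by (metis less_cons)
      qed
      from st c(2) consider "s = 0"
        | s0 s1 t0 t1 where "s = cons s0 s1" "t = cons t0 t1" "pelem s0 t0 c" "pelem s1 t1 c"
        | t0 t1 where "t = cons t0 t1" "pelem s t0 c \<or> pelem s t1 c"
        unfolding tle_witness_def by blast
      then show "s = t \<or> olt s t"
      proof cases
        case 1
        then show ?thesis
          using nf(2) by (auto elim: onf_cases)
      next
        case (2 s0 s1 t0 t1)
        then have "onf s0" "onf s1" "onf t0" "onf t1"
          using nf onf_cons by blast+
        then show ?thesis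
          using less.IH[of t0] less.IH[of t1] 2 by auto
      qed (use sub in blast)
    qed
  qed
  then show ?thesis
    using assms(2,3) c(1) by blast
qed

text \<open>The coded set is finite only in the sense of the model, so its minimum is found by
  induction on a bound \<open>k\<close> for the elements considered. The code \<open>a\<close>
  finally serves as the bound.\<close>

lemma ex_olt_least:
  assumes nf: "\<And>x. elem x a \<Longrightarrow> onf x" and "elem x0 a"
  obtains m where "elem m a" "\<And>x. elem x a \<Longrightarrow> m = x \<or> olt m x"
proof -
  have "(\<exists>x<k. elem x a) \<longrightarrow> (\<exists>m. elem m a \<and> (\<forall>x<k. elem x a \<longrightarrow> m = x \<or> olt m x))" for k
  proof (induction k rule: model_induct)
    case dfr
    show ?case
      by (intro dfr_elem dfr_olt dfr_intros)
  next
    case (step k)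
    show ?case
    proof (cases "elem k a")
      case False
      then show ?thesis
        using step by (auto simp: order_le_less)
    next
      case k: True
      show ?thesis
      proof (cases "\<exists>x<k. elem x a")
        case True
        then obtain m where m: "elem m a" "\<And>x. x < k \<Longrightarrow> elem x a \<Longrightarrow> m = x \<or> olt m x"
          using step by blast
        consider "m = k \<or> olt m k" | "olt k m"
          using olt_total nf m(1) k by blast
        then show ?thesis
        proof cases
          case 1
          then show ?thesis
            using m by (intro impI exI[of _ m]) (auto simp: order_le_less)
        next
          case 2
          then show ?thesis
            using k m(2) olt_trans by (intro impI exI[of _ k]) (auto simp: order_le_less)
        qed
      next
        case False
        then show ?thesis
          using k by (intro impI exI[of _ k]) (auto simp: order_le_less)
      qed
    qed
  qed simp
  from this[of a] show ?thesis
    using that assms(2) elem_less by blast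
qed

section \<open>The instance of the finite basis scheme\<close>

lemma fvt_shift [simp]: "fvt (shift k t) = (\<lambda>i. i + k) ` fvt t"
proof -
  have "fvt (substt (\<lambda>i. Var (i + k)) t) = (\<lambda>i. i + k) ` fvt t"
    by (induction t) auto
  then show ?thesis
    by (simp add: shift_def)
qed

lemma fv_Allb [simp]: "fv (Allb t \<phi>) = fvt t \<union> {i. Suc i \<in> fv \<phi>}"
  and fv_Exb [simp]: "fv (Exb t \<phi>) = fvt t \<union> {i. Suc i \<in> fv \<phi>}"
  by (auto simp: Allb_def Exb_def)

lemma fv_is_pair [simp]: "fv (is_pair x y z) = fvt x \<union> fvt y \<union> fvt z"
  and fv_is_cons [simp]: "fv (is_cons x y z) = fvt x \<union> fvt y \<union> fvt z"
  by (auto simp: is_pair_def is_cons_def)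

lemma fv_mem [simp]: "fv (mem x a) = fvt x \<union> fvt a"
  by (auto simp: mem_def eval_nat_numeral)

lemma fv_pmem [simp]: "fv (pmem x y a) = fvt x \<union> fvt y \<union> fvt a"
  by (auto simp: pmem_def)

lemma fvt_substt: "fvt (substt \<sigma> t) = (\<Union>i\<in>fvt t. fvt (\<sigma> i))"
  by (induction t) auto

lemma fvt_up: "Suc j \<in> fvt (up \<sigma> i) \<longleftrightarrow> (\<exists>k. i = Suc k \<and> j \<in> fvt (\<sigma> k))"
  by (cases i) (auto simp: up_def)

lemma fv_subst: "fv (subst \<sigma> \<phi>) = (\<Union>i\<in>fv \<phi>. fvt (\<sigma> i))"
  by (induction \<phi> arbitrary: \<sigma>) (auto simp: fvt_substt fvt_up)

lemma Delta0_is_pair: "Delta0 (is_pair x y z)"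
  and Delta0_is_cons: "Delta0 (is_cons x y z)"
  unfolding is_pair_def is_cons_def by (rule Delta0.intros)+

lemma Delta0_mem: "Delta0 (mem x a)"
  unfolding mem_def by (intro Delta0.intros Delta0_is_pair)

lemma Delta0_pmem: "Delta0 (pmem x y a)"
  unfolding pmem_def by (intro Delta0.intros Delta0_is_pair Delta0_mem)

lemma Delta0_subst: "Delta0 \<phi> \<Longrightarrow> Delta0 (subst \<sigma> \<phi>)"
proof (induction arbitrary: \<sigma> rule: Delta0.induct)
  case (7 \<phi> t)
  have "subst \<sigma> (Allb t \<phi>) = Allb (substt \<sigma> t) (subst (up \<sigma>) \<phi>)"
    by (simp only: Allb_def subst.simps substt.simps substt_up_shift) (simp add: up_def)
  then show ?case
    using 7 Delta0.intros by metis
next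
  case (8 \<phi> t)
  have "subst \<sigma> (Exb t \<phi>) = Exb (substt \<sigma> t) (subst (up \<sigma>) \<phi>)"
    by (simp only: Exb_def subst.simps substt.simps substt_up_shift) (simp add: up_def)
  then show ?case
    using 8 Delta0.intros by metis
qed (simp_all add: Delta0.intros)

text \<open>
  The formula says that \<open>x\<close> is in normal form and \<open>\<theta>(z, x)\<close> fails for some \<open>z\<close>. As \<open>nf_fm\<close> has the
  unbounded quantifier of \<open>ord_less_fm\<close> below bounded ones, a single set \<open>d\<close> witnesses all
  comparisons that occur; \<open>p\<close> bounds \<open>z\<close>, \<open>d\<close> and the witness \<open>c\<close> for normality.
  The variables are \<open>c = Var 0\<close>, \<open>d = Var 1\<close>, \<open>z = Var 2\<close>, \<open>p = Var 3\<close>, \<open>x = Var 4\<close>.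
\<close>

definition counterexample_fm :: "fm \<Rightarrow> fm" where
  "counterexample_fm \<theta> = Ex (Exb (Sc (Var 0)) (Exb (Sc (Var 1)) (Exb (Sc (Var 2))
    (mem (Var 4) (Var 0) \<^bold>\<and>
     Allb (Var 0) (mem (Var 0) (Var 1) \<^bold>\<longrightarrow>
       Var 0 \<^bold>= Zr \<^bold>\<or>
       Exb (Var 0) (Exb (Var 1)
         (is_cons (Var 1) (Var 0) (Var 2) \<^bold>\<and> mem (Var 1) (Var 3) \<^bold>\<and> mem (Var 0) (Var 3) \<^bold>\<and>
          (Var 0 \<^bold>= Zr \<^bold>\<or>
           Exb (Var 0) (Exb (Var 1)
             (is_cons (Var 1) (Var 0) (Var 2) \<^bold>\<and>
              (Var 1 \<^bold>= Var 3 \<^bold>\<or> pmem (Var 1) (Var 3) (Var 6)))))))) \<^bold>\<and>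
     Allb (Var 1) (Allb (Var 2) (pmem (Var 1) (Var 0) (Var 3) \<^bold>\<longrightarrow>
       Exb (Var 0) (Exb (Var 1)
         (is_cons (Var 1) (Var 0) (Var 2) \<^bold>\<and>
          (Var 3 \<^bold>= Zr \<^bold>\<or>
           Exb (Var 3) (Exb (Var 4)
             (is_cons (Var 1) (Var 0) (Var 5) \<^bold>\<and>
              (pmem (Var 1) (Var 3) (Var 7) \<^bold>\<or>
               Var 1 \<^bold>= Var 3 \<^bold>\<and> pmem (Var 0) (Var 2) (Var 7))))))))) \<^bold>\<and>
     Neg (subst (case_nat (Var 2) (\<lambda>_. Var 4)) \<theta>)))))"

lemma Sigma_counterexample_fm: "Delta0 \<theta> \<Longrightarrow> Sigma_fm 1 (counterexample_fm \<theta>)"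
  unfolding counterexample_fm_def One_nat_def Sigma_fm.simps Pi_fm.simps
  by (rule exI, rule conjI, rule refl)
    (intro Delta0.intros Delta0_mem Delta0_pmem Delta0_is_cons Delta0_subst)

lemma fv_counterexample_fm: "fv (counterexample_fm \<theta>) = {0}"
proof -
  have "fv (subst (case_nat (Var 2) (\<lambda>_. Var 4)) \<theta>) \<subseteq> {2, 4}"
    by (auto simp: fv_subst split: nat.splits)
  then show ?thesis
    unfolding counterexample_fm_def by (auto simp: eval_nat_numeral)
qed

text \<open>Every pair in a witness set \<open>d\<close> is a true comparison, so the formula
  implies normality. Conversely, comprehension gathers all true comparisons up to a bound given by
  \<open>c\<close> into one \<open>d\<close>.\<close>

lemma true_at_counterexample_fm:
  assumes "fv (All \<theta>) = {0}"
  shows "true_at (case_nat x e) (counterexample_fm \<theta>) \<longleftrightarrow>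
    onf x \<and> \<not> true_at (case_nat x e) (All \<theta>)"
proof -
  \<comment> \<open>The substitution in the formula sends every index from 1 on to \<open>x\<close>,
    whereas \<open>\<theta>\<close> contains at most the indices 0 and 1.\<close>
  have \<theta>: "true_at (case_nat z (\<lambda>_. x)) \<theta> \<longleftrightarrow> true_at (case_nat z (case_nat x e)) \<theta>" for z
  proof (rule holds_cong)
    fix i assume "i \<in> fv \<theta>"
    then have "i = 0 \<or> i = Suc 0"
      using assms by (cases i) auto
    then show "case_nat z (\<lambda>_. x) i = case_nat z (case_nat x e) i"
      by auto
  qed
  have "true_at (case_nat x e) (counterexample_fm \<theta>) \<longleftrightarrow>
    (\<exists>p. \<exists>z<p + 1. \<exists>d<p + 1. \<exists>c<p + 1. elem x c \<and>
      (\<forall>y<c. elem y c \<longrightarrow> y = 0 \<or> (\<exists>l r. y = cons l r \<and> elem l c \<and> elem r c \<and>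
        (r = 0 \<or> (\<exists>l' r'. r = cons l' r' \<and> (l' = l \<or> pelem l' l d))))) \<and>
      (\<forall>x<d. \<forall>y<d. pelem x y d \<longrightarrow> ord_clause (\<lambda>x y. pelem x y d) x y) \<and>
      \<not> true_at (case_nat z (case_nat x e)) \<theta>)"
    unfolding counterexample_fm_def
    by (simp add: holds_subst val_case_nat \<theta> ord_clause_def ex_cons_bounded_model eval_nat_numeral)
  also have "\<dots> \<longleftrightarrow> (\<exists>p. \<exists>z<p + 1. \<exists>d<p + 1. \<exists>c<p + 1. elem x c \<and>
      nf_witness (\<lambda>x y. pelem x y d) c \<and> ord_witness d \<and>
      \<not> true_at (case_nat z (case_nat x e)) \<theta>)"
  proof -
    have "(\<forall>x<d. \<forall>y<d. pelem x y d \<longrightarrow> Q x y) \<longleftrightarrow> (\<forall>x y. pelem x y d \<longrightarrow> Q x y)" for d Q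
      using pelem_less by blast
    moreover have "(\<forall>x<d. elem x d \<longrightarrow> Q x) \<longleftrightarrow> (\<forall>x. elem x d \<longrightarrow> Q x)" for d Q
      using elem_less by blast
    ultimately show ?thesis
      unfolding nf_witness_def ord_witness_def by simp
  qed
  also have "\<dots> \<longleftrightarrow> (\<exists>z d c. elem x c \<and> nf_witness (\<lambda>x y. pelem x y d) c \<and> ord_witness d \<and>
      \<not> true_at (case_nat z (case_nat x e)) \<theta>)"
  proof -
    have "(\<exists>p. \<exists>z<p + 1. \<exists>d<p + 1. \<exists>c<p + 1. Q z d c) \<longleftrightarrow> (\<exists>z d c. Q z d c)"
      for Q :: "model \<Rightarrow> model \<Rightarrow> model \<Rightarrow> bool"
    proof
      assume "\<exists>z d c. Q z d c"
      then obtain z d c where "Q z d c"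
        by blast
      \<comment> \<open>The sum \<open>z + d + c\<close> is taken for the common bound
        \<open>p\<close>.\<close>
      moreover have "z < z + d + c + 1" "d < z + d + c + 1" "c < z + d + c + 1"
        by (simp_all add: add_increasing add_increasing2)
      ultimately show "\<exists>p. \<exists>z<p + 1. \<exists>d<p + 1. \<exists>c<p + 1. Q z d c"
        by blast
    qed blast
    then show ?thesis .
  qed
  also have "\<dots> \<longleftrightarrow> onf x \<and> \<not> true_at (case_nat x e) (All \<theta>)"
  proof -
    have "(\<exists>d c. elem x c \<and> nf_witness (\<lambda>x y. pelem x y d) c \<and> ord_witness d) \<longleftrightarrow> onf x"
    proof
      assume "\<exists>d c. elem x c \<and> nf_witness (\<lambda>x y. pelem x y d) c \<and> ord_witness d"
      then obtain c d where *: "elem x c" "nf_witness (\<lambda>x y. pelem x y d) c" "ord_witness d"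
        by blast
      then have "nf_witness olt c"
        unfolding nf_witness_def olt_def by meson
      with * show "onf x"
        unfolding onf_def by blast
    next
      assume "onf x"
      then obtain c where c: "elem x c" "nf_witness olt c"
        unfolding onf_def by blast
      have "dfr (\<lambda>e. olt (e 0) (e 1))"
        by (intro dfr_olt dfr_intros)
      \<comment> \<open>Both exponents compared are below \<open>c\<close>: one is an element of
        \<open>c\<close>, the other a component of an element. By monotonicity of pairing the bound
        \<open>pr c c\<close> suffices.\<close>
      then obtain d where d: "\<And>a b. pelem a b d \<longleftrightarrow> pr a b < pr c c + 1 \<and> olt a b"
        by (rule pcomprehension) blast
      have "pelem l' l d" if "elem l c" "elem (cons l' r') c" "olt l' l" for l l' r'
      proof -
        have "l \<le> c" "l' \<le> c"
          using elem_less that(1,2) less_cons by (meson less_imp_le less_trans)+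
        then show ?thesis
          using that(3) pr_mono by (simp add: d)
      qed
      then have "nf_witness (\<lambda>x y. pelem x y d) c"
        using c(2) unfolding nf_witness_def by metis
      moreover have "ord_witness d"
        unfolding ord_witness_def
      proof (intro allI impI)
        fix a b assume ab: "pelem a b d"
        then have "ord_clause olt a b"
          using olt_clause d by blast
        then show "ord_clause (\<lambda>x y. pelem x y d) a b"
        proof (rule ord_clause_mono)
          show "pelem a' b' d" if "a' \<le> a" "b' \<le> b" "olt a' b'" for a' b'
            using that ab pr_mono[of a' a b' b] unfolding d by (auto intro: order_trans)
        qed
      qed
      ultimately show "\<exists>d c. elem x c \<and> nf_witness (\<lambda>x y. pelem x y d) c \<and> ord_witness d"
        using c(1) by blast
    qed
    then show ?thesis
      by auto
  qed
  finally show ?thesis .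
qed

section \<open>From a finite basis to transfinite induction\<close>

lemma closed_K_fm:
  assumes "fv \<phi> = {0}"
  shows "fv (K_fm \<phi>) = {}"
proof -
  have "fv (app k \<phi> (Var 0)) \<subseteq> {0}" for k
    using fv_subst[of "case_nat (Var 0) (\<lambda>i. Var (i + k))" \<phi>] assms by (simp add: app_def)
  then show ?thesis
    by (auto simp: K_fm_def finite_tree_set_fm_def tree_fm_def tree_le_fm_def eval_nat_numeral)
qed

lemma TI_true:
  assumes K: "\<And>\<phi>. \<phi> \<in> K_Sigma1_minus \<Longrightarrow> true_at e \<phi>" and \<psi>: "Pi_fm 1 \<psi>" "fv \<psi> = {0}"
  shows "true_at e (TI_fm \<psi>)"
proof -
  define P where "P x \<longleftrightarrow> true_at (case_nat x e) \<psi>" for x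
  obtain \<theta> where \<theta>: "\<psi> = All \<theta>" "Delta0 \<theta>"
    using \<psi>(1) by auto
  define \<phi> where "\<phi> = counterexample_fm \<theta>"
  have \<phi>: "true_at (case_nat x e) \<phi> \<longleftrightarrow> onf x \<and> \<not> P x" for x
    using true_at_counterexample_fm \<psi>(2) by (simp add: \<phi>_def P_def \<theta>(1))
  have "K_fm \<phi> \<in> K_Sigma1_minus"
    unfolding K_Sigma1_minus_def \<phi>_def
    using Sigma_counterexample_fm[OF \<theta>(2)] fv_counterexample_fm by blast
  then have "true_at e (K_fm \<phi>)"
    by (rule K)
  then obtain a where a: "\<forall>s. elem s a \<longrightarrow> onf s \<and> \<not> P s"
    "\<forall>t. is_tree t \<longrightarrow> onf t \<and> \<not> P t \<longrightarrow> (\<exists>s. elem s a \<and> tle s t)"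
    by (auto simp: K_fm_def \<phi> eval_nat_numeral)
  have "P x" if prog: "\<forall>x. onf x \<longrightarrow> (\<forall>y. onf y \<longrightarrow> olt y x \<longrightarrow> P y) \<longrightarrow> P x" and "onf x" for x
  proof (rule ccontr)
    assume "\<not> P x"
    \<comment> \<open>The code \<open>x\<close> is also a tree, so the basis provides an element for
      it and is nonempty.\<close>
    then obtain s where "elem s a"
      using a(2) is_tree_onf \<open>onf x\<close> by blast
    then obtain m where m: "elem m a" "\<And>x. elem x a \<Longrightarrow> m = x \<or> olt m x"
      using ex_olt_least a(1) by metis
    have "P y" if "onf y" "olt y m" for y
    proof (rule ccontr)
      assume "\<not> P y"
      then obtain s where s: "elem s a" "tle s y"
        using a(2) is_tree_onf \<open>onf y\<close> by blast
      then have "s = y \<or> olt s y"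
        using tle_olt a(1) \<open>onf y\<close> by blast
      then have "olt m m"
        using m(2)[OF s(1)] \<open>olt y m\<close> olt_trans by blast
      then show False
        using olt_irrefl by blast
    qed
    then show False
      using prog a(1) m(1) by blast
  qed
  then show ?thesis
    by (auto simp: TI_fm_def P_def eval_nat_numeral)
qed

theorem proposition4p4:
  shows "\<forall>\<chi> \<in> TI_Pi1_minus. PA \<union> K_Sigma1_minus \<turnstile> \<chi>"
proof (rule ccontr)
  assume "\<not> (\<forall>\<chi> \<in> TI_Pi1_minus. PA \<union> K_Sigma1_minus \<turnstile> \<chi>)"
  then obtain \<chi> where \<chi>: "\<chi> \<in> TI_Pi1_minus" "\<not> (PA \<union> K_Sigma1_minus \<turnstile> \<chi>)"
    by blast
  \<comment> \<open>Closed axioms leave all variables available as Henkin witnesses.\<close>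
  have "fv \<phi> = {}" if "\<phi> \<in> PA \<union> K_Sigma1_minus" for \<phi>
    using that closed_PA closed_K_fm by (auto simp: K_Sigma1_minus_def)
  then have "finite (\<Union> (fv ` (PA \<union> K_Sigma1_minus)))"
    by simp
  moreover have "basic_axioms \<subseteq> PA \<union> K_Sigma1_minus"
    by (auto simp: PA_def)
  ultimately obtain M :: "model struct" and e where
    "\<And>\<phi>. \<phi> \<in> PA \<union> K_Sigma1_minus \<Longrightarrow> holds M e \<phi>" "\<not> holds M e \<chi>"
    using completeness[OF infinite_model _ _ \<chi>(2)] by metis
  then have "\<exists>e M. countermodel e M"
    unfolding countermodel_def using \<chi>(1) by blast
  then obtain e where e: "countermodel e the_model"
    using the_model by blast
  \<comment> \<open>The instance that fails in \<open>the_model\<close> may differ from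
    \<open>\<chi>\<close>; any failing instance gives the contradiction.\<close>
  then obtain \<psi> where \<psi>: "Pi_fm 1 \<psi>" "fv \<psi> = {0}" "\<not> true_at e (TI_fm \<psi>)"
    unfolding countermodel_def TI_Pi1_minus_def by blast
  have "true_at e (TI_fm \<psi>)"
    by (rule TI_true[OF _ \<psi>(1,2)]) (use e in \<open>simp add: countermodel_def\<close>)
  with \<psi>(3) show False ..
qed

end
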